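(* Let $(W,S)$ be a finitely generated Coxeter system with presentation diagram $\Gamma(W,S)$. The following are equivalent: (1) $W$ is virtually free. (2) $W$ has a visual graph of groups decomposition (with respect to $S$) in which each vertex group is finite. (3) (a) Every complete subgraph of $\Gamma(W,S)$ is the presentation diagram of a finite Coxeter group (that is, its vertices generate a finite special subgroup of $W$), and (b) no induced subgraph of $\Gamma(W,S)$ is a circuit of more than three vertices.
   Context: A Coxeter system $(W,S)$ is a group $W$ with generating set $S$ having a presentation $\langle S : (st)^{m(s,t)}\ (s,t\in S,\ m(s,t)<\infty)\rangle$, where $m:S^2\to\{1,2,\ldots,\infty\}$, $m(s,t)=m(t,s)$, and $m(s,t)=1$ iff $s=t$; it is finitely generated if $S$ is finite. A special subgroup is a subgroup generated by a subset of $S$. The presentation diagram $\Gamma(W,S)$ is the labeled graph with vertex set $S$ and an edge labeled $m(s,t)$ between distinct $s,t\in S$ exactly when $m(s,t)<\infty$. A visual graph of groups decomposition of $W$ (with respect to $S$) is a graph of groups $\Psi$ in which each vertex group and edge group is a special subgroup of $(W,S)$, the injection of each edge group into each of its endpoint vertex groups is inclusion, and the homomorphism $\pi_1(\Psi)\to W$ induced by the inclusions of the vertex groups into $W$ is an isomorphism. *)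

theory Defs
  imports
    "HOL-Algebra.Generated_Groups"
    "HOL-Library.Extended_Nat"
    "HOL-Library.Infinite_Typeclass"
begin

section \<open>Groups given by generators and relators\<close>

text \<open>A letter \<open>(x, True)\<close> stands for the generator \<open>x\<close> and \<open>(x, False)\<close> for its formal inverse.
  A relator is a word that is set equal to the identity.\<close>

type_synonym 'x word = "('x \<times> bool) list"

definition words_over :: "'x set \<Rightarrow> 'x word set" where
  "words_over X = lists (X \<times> UNIV)"

inductive word_eq :: "'x set \<Rightarrow> 'x word set \<Rightarrow> 'x word \<Rightarrow> 'x word \<Rightarrow> bool"
  for X :: "'x set" and R :: "'x word set" where
  refl: "w \<in> words_over X \<Longrightarrow> word_eq X R w w"
| sym: "word_eq X R v w \<Longrightarrow> word_eq X R w v"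
| trans: "word_eq X R u v \<Longrightarrow> word_eq X R v w \<Longrightarrow> word_eq X R u w"
| cancel: "u @ [(x, b), (x, \<not> b)] @ v \<in> words_over X \<Longrightarrow>
    word_eq X R (u @ [(x, b), (x, \<not> b)] @ v) (u @ v)"
| relator: "r \<in> R \<Longrightarrow> u @ r @ v \<in> words_over X \<Longrightarrow> word_eq X R (u @ r @ v) (u @ v)"

definition word_class :: "'x set \<Rightarrow> 'x word set \<Rightarrow> 'x word \<Rightarrow> 'x word set" where
  "word_class X R w = {v. word_eq X R w v}"

definition presented_group :: "'x set \<Rightarrow> 'x word set \<Rightarrow> 'x word set monoid" where
  "presented_group X R =
     \<lparr>carrier = word_class X R ` words_over X,
      mult = (\<lambda>A B. \<Union>a\<in>A. \<Union>b\<in>B. word_class X R (a @ b)),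
      one = word_class X R []\<rparr>"

lemma word_eq_words:
  "word_eq X R v w \<Longrightarrow> v \<in> words_over X \<and> w \<in> words_over X"
  by (induction rule: word_eq.induct) (auto simp: words_over_def)

lemma word_eq_append_left:
  "word_eq X R v w \<Longrightarrow> u \<in> words_over X \<Longrightarrow> word_eq X R (u @ v) (u @ w)"
proof (induction rule: word_eq.induct)
  case (refl w)
  then show ?case by (auto simp: words_over_def intro: word_eq.refl)
next
  case (sym v w)
  then show ?case by (simp add: word_eq.sym)
next
  case (trans v w x)
  then show ?case by (blast intro: word_eq.trans)
next
  case (cancel u' x b v)
  then show ?case
    using word_eq.cancel[of "u @ u'" x b v X R] by (simp add: words_over_def)
next
  case (relator r u' v)
  then show ?case
    using word_eq.relator[of r R "u @ u'" v X] by (simp add: words_over_def)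
qed

lemma word_eq_append_right:
  "word_eq X R v w \<Longrightarrow> u \<in> words_over X \<Longrightarrow> word_eq X R (v @ u) (w @ u)"
proof (induction rule: word_eq.induct)
  case (refl w)
  then show ?case by (auto simp: words_over_def intro: word_eq.refl)
next
  case (sym v w)
  then show ?case by (simp add: word_eq.sym)
next
  case (trans v w x)
  then show ?case by (blast intro: word_eq.trans)
next
  case (cancel u' x b v)
  then show ?case
    using word_eq.cancel[of u' x b "v @ u" X R] by (simp add: words_over_def)
next
  case (relator r u' v)
  then show ?case
    using word_eq.relator[of r R u' "v @ u" X] by (simp add: words_over_def)
qed

lemma word_eq_append:
  assumes "word_eq X R a a'" "word_eq X R b b'"
  shows "word_eq X R (a @ b) (a' @ b')"
proof (rule word_eq.trans)
  show "word_eq X R (a @ b) (a' @ b)"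
    using assms word_eq_words[OF assms(2)] by (simp add: word_eq_append_right)
  show "word_eq X R (a' @ b) (a' @ b')"
    using assms word_eq_words[OF assms(1)] by (simp add: word_eq_append_left)
qed

lemma word_class_eq_iff:
  assumes "v \<in> words_over X"
  shows "word_class X R v = word_class X R w \<longleftrightarrow> word_eq X R v w"
proof
  assume eq: "word_class X R v = word_class X R w"
  have "v \<in> word_class X R v"
    using assms by (simp add: word_class_def word_eq.refl)
  then have "word_eq X R w v"
    unfolding eq by (simp add: word_class_def)
  then show "word_eq X R v w"
    by (rule word_eq.sym)
next
  assume eq: "word_eq X R v w"
  have "word_eq X R v u \<longleftrightarrow> word_eq X R w u" for u
    using word_eq.trans[OF eq] word_eq.trans[OF word_eq.sym[OF eq]] by blast
  then show "word_class X R v = word_class X R w"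
    by (simp add: word_class_def)
qed

lemma presented_group_mult:
  assumes "v \<in> words_over X" "w \<in> words_over X"
  shows "word_class X R v \<otimes>\<^bsub>presented_group X R\<^esub> word_class X R w = word_class X R (v @ w)"
proof -
  have "word_class X R (a @ b) = word_class X R (v @ w)"
    if "a \<in> word_class X R v" "b \<in> word_class X R w" for a b
  proof -
    have eq: "word_eq X R (v @ w) (a @ b)"
      using that by (simp add: word_class_def word_eq_append)
    have "v @ w \<in> words_over X"
      using word_eq_words[OF eq] by simp
    then show ?thesis
      using eq word_class_eq_iff[of "v @ w" X R "a @ b"] by simp
  qed
  moreover have "v \<in> word_class X R v" "w \<in> word_class X R w"
    using assms by (simp_all add: word_class_def word_eq.refl)
  ultimately have "(\<Union>a\<in>word_class X R v. \<Union>b\<in>word_class X R w. word_class X R (a @ b)) =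
      word_class X R (v @ w)"
    by blast
  then show ?thesis
    by (simp add: presented_group_def)
qed

lemma word_eq_inverse:
  assumes "w \<in> words_over X"
  shows "word_eq X R (rev (map (apsnd Not) w) @ w) []"
  using assms
proof (induction w)
  case Nil
  then show ?case by (simp add: word_eq.refl)
next
  case (Cons a w)
  obtain x b where a: "a = (x, b)" by force
  let ?v = "rev (map (apsnd Not) w)"
  have w: "w \<in> words_over X" and "x \<in> X"
    using Cons.prems a by (auto simp: words_over_def)
  moreover have "?v \<in> words_over X"
    using w by (fastforce simp: words_over_def in_lists_conv_set)
  ultimately have "?v @ [(x, \<not> b), (x, \<not> \<not> b)] @ w \<in> words_over X"
    by (auto simp: words_over_def)
  from word_eq.cancel[OF this, of R] have "word_eq X R (?v @ [(x, \<not> b), (x, b)] @ w) (?v @ w)"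
    by simp
  then have "word_eq X R (?v @ [(x, \<not> b), (x, b)] @ w) []"
    using Cons.IH[OF w] by (rule word_eq.trans)
  then show ?case
    using a by simp
qed

lemma group_presented_group: "group (presented_group X R)"
proof (rule groupI)
  let ?P = "presented_group X R"
  have carr: "carrier ?P = word_class X R ` words_over X"
    and one: "\<one>\<^bsub>?P\<^esub> = word_class X R []"
    by (auto simp: presented_group_def)
  have app: "v @ w \<in> words_over X" if "v \<in> words_over X" "w \<in> words_over X"
    for v w :: "'a word"
    using that by (auto simp: words_over_def)
  have nil: "[] \<in> words_over X" by (auto simp: words_over_def)
  show "\<one>\<^bsub>?P\<^esub> \<in> carrier ?P"
    using carr one nil by auto
  show "x \<otimes>\<^bsub>?P\<^esub> y \<in> carrier ?P" if "x \<in> carrier ?P" "y \<in> carrier ?P" for x y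
    using that app by (auto simp: carr presented_group_mult)
  show "x \<otimes>\<^bsub>?P\<^esub> y \<otimes>\<^bsub>?P\<^esub> z = x \<otimes>\<^bsub>?P\<^esub> (y \<otimes>\<^bsub>?P\<^esub> z)"
    if "x \<in> carrier ?P" "y \<in> carrier ?P" "z \<in> carrier ?P" for x y z
    using that app by (auto simp: carr presented_group_mult)
  show "\<one>\<^bsub>?P\<^esub> \<otimes>\<^bsub>?P\<^esub> x = x" if "x \<in> carrier ?P" for x
    using that nil by (auto simp: carr one presented_group_mult)
  show "\<exists>y\<in>carrier ?P. y \<otimes>\<^bsub>?P\<^esub> x = \<one>\<^bsub>?P\<^esub>" if x: "x \<in> carrier ?P" for x
  proof -
    obtain w where w: "w \<in> words_over X" "x = word_class X R w"
      using x carr by auto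
    let ?v = "rev (map (apsnd Not) w)"
    have v: "?v \<in> words_over X"
      using w by (auto simp: words_over_def in_lists_conv_set)
    have "word_class X R (?v @ w) = word_class X R []"
      using word_eq_inverse[OF w(1)] word_class_eq_iff[OF app[OF v w(1)]] by blast
    then have "word_class X R ?v \<otimes>\<^bsub>?P\<^esub> x = \<one>\<^bsub>?P\<^esub>"
      using v w one by (simp add: presented_group_mult)
    then show ?thesis
      using v carr by auto
  qed
qed

text \<open>\<open>has_presentation G X R\<close>: the inclusion of \<open>X\<close> into \<open>G\<close> extends to an isomorphism
  onto \<open>G\<close> of the group with generators \<open>X\<close> and relators \<open>R\<close>.\<close>

definition has_presentation :: "'a monoid \<Rightarrow> 'a set \<Rightarrow> 'a word set \<Rightarrow> bool" where
  "has_presentation G X R \<longleftrightarrow>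
     X \<subseteq> carrier G \<and>
     (\<exists>h \<in> iso (presented_group X R) G. \<forall>x\<in>X. h (word_class X R [(x, True)]) = x)"

definition is_free_group :: "'a monoid \<Rightarrow> bool" where
  "is_free_group G \<longleftrightarrow> group G \<and> (\<exists>X. has_presentation G X {})"

definition virtually_free :: "'a monoid \<Rightarrow> bool" where
  "virtually_free G \<longleftrightarrow>
     group G \<and>
     (\<exists>H. subgroup H G \<and> finite (rcosets\<^bsub>G\<^esub> H) \<and> is_free_group (G\<lparr>carrier := H\<rparr>))"


section \<open>Coxeter systems\<close>

definition coxeter_relators :: "'a set \<Rightarrow> ('a \<Rightarrow> 'a \<Rightarrow> enat) \<Rightarrow> 'a word set" where
  "coxeter_relators S m =
     {concat (replicate (the_enat (m s t)) [(s, True), (t, True)]) | s t.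
        s \<in> S \<and> t \<in> S \<and> m s t < \<infinity>}"

locale coxeter_system = group W for W :: "'a monoid" (structure) +
  fixes S :: "'a set" and m :: "'a \<Rightarrow> 'a \<Rightarrow> enat"
  assumes gens_closed: "S \<subseteq> carrier W"
    and generates: "generate W S = carrier W"
    and m_nonzero: "\<And>s t. s \<in> S \<Longrightarrow> t \<in> S \<Longrightarrow> m s t \<noteq> 0"
    and m_sym: "\<And>s t. s \<in> S \<Longrightarrow> t \<in> S \<Longrightarrow> m s t = m t s"
    and m_eq_1_iff: "\<And>s t. s \<in> S \<Longrightarrow> t \<in> S \<Longrightarrow> m s t = 1 \<longleftrightarrow> s = t"
    and presentation: "has_presentation W S (coxeter_relators S m)"

definition special_subgroup :: "'a monoid \<Rightarrow> 'a set \<Rightarrow> 'a set \<Rightarrow> bool" where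
  "special_subgroup W S H \<longleftrightarrow> (\<exists>A\<subseteq>S. H = generate W A)"


section \<open>Labelled simple graphs and the presentation diagram\<close>

record 'a lgraph =
  lverts :: "'a set"
  ledges :: "'a set set"
  llabel :: "'a \<Rightarrow> 'a \<Rightarrow> nat"

definition presentation_diagram :: "'a set \<Rightarrow> ('a \<Rightarrow> 'a \<Rightarrow> enat) \<Rightarrow> 'a lgraph" where
  "presentation_diagram S m =
     \<lparr>lverts = S,
      ledges = {{s, t} | s t. s \<in> S \<and> t \<in> S \<and> s \<noteq> t \<and> m s t < \<infinity>},
      llabel = (\<lambda>s t. the_enat (m s t))\<rparr>"

definition induced_lgraph :: "'a lgraph \<Rightarrow> 'a set \<Rightarrow> 'a lgraph" where
  "induced_lgraph \<Gamma> A = \<Gamma>\<lparr>lverts := A, ledges := {e \<in> ledges \<Gamma>. e \<subseteq> A}\<rparr>"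

definition complete_lgraph :: "'a lgraph \<Rightarrow> bool" where
  "complete_lgraph \<Gamma> \<longleftrightarrow> (\<forall>s\<in>lverts \<Gamma>. \<forall>t\<in>lverts \<Gamma>. s \<noteq> t \<longrightarrow> {s, t} \<in> ledges \<Gamma>)"

definition circuit_lgraph :: "'a lgraph \<Rightarrow> bool" where
  "circuit_lgraph \<Gamma> \<longleftrightarrow>
     (\<exists>n\<ge>3. \<exists>c. bij_betw c {..<n} (lverts \<Gamma>) \<and>
        ledges \<Gamma> = {{c i, c (Suc i mod n)} | i. i < n})"


section \<open>Graphs of groups\<close>

text \<open>The underlying graph is an undirected multigraph, possibly infinite and with loops; each edge
  carries an arbitrarily chosen orientation. A pair \<open>(e, True)\<close> is the edge \<open>e\<close> traversed along its
  orientation, and \<open>(e, False)\<close> the same edge traversed backwards.\<close>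

record ('v, 'e, 'g) gog =
  gverts :: "'v set"
  gedges :: "'e set"
  gsrc :: "'e \<Rightarrow> 'v"
  gtgt :: "'e \<Rightarrow> 'v"
  vgroup :: "'v \<Rightarrow> 'g monoid"
  egroup :: "'e \<Rightarrow> 'g monoid"
  inj_src :: "'e \<Rightarrow> 'g \<Rightarrow> 'g"
  inj_tgt :: "'e \<Rightarrow> 'g \<Rightarrow> 'g"

fun step_from :: "('v, 'e, 'g) gog \<Rightarrow> 'e \<times> bool \<Rightarrow> 'v" where
  "step_from \<Psi> (e, b) = (if b then gsrc \<Psi> e else gtgt \<Psi> e)"

fun step_to :: "('v, 'e, 'g) gog \<Rightarrow> 'e \<times> bool \<Rightarrow> 'v" where
  "step_to \<Psi> (e, b) = (if b then gtgt \<Psi> e else gsrc \<Psi> e)"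

fun edge_path :: "('v, 'e, 'g) gog \<Rightarrow> 'e set \<Rightarrow> 'v \<Rightarrow> ('e \<times> bool) list \<Rightarrow> 'v \<Rightarrow> bool" where
  "edge_path \<Psi> T u [] v \<longleftrightarrow> u \<in> gverts \<Psi> \<and> u = v"
| "edge_path \<Psi> T u (d # p) v \<longleftrightarrow>
     fst d \<in> T \<and> u \<in> gverts \<Psi> \<and> step_from \<Psi> d = u \<and> edge_path \<Psi> T (step_to \<Psi> d) p v"

definition no_backtracking :: "('e \<times> bool) list \<Rightarrow> bool" where
  "no_backtracking p \<longleftrightarrow> \<not> (\<exists>xs e b ys. p = xs @ [(e, b), (e, \<not> b)] @ ys)"

definition connected_edges :: "('v, 'e, 'g) gog \<Rightarrow> 'e set \<Rightarrow> bool" where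
  "connected_edges \<Psi> T \<longleftrightarrow> (\<forall>u\<in>gverts \<Psi>. \<forall>v\<in>gverts \<Psi>. \<exists>p. edge_path \<Psi> T u p v)"

definition acyclic_edges :: "('v, 'e, 'g) gog \<Rightarrow> 'e set \<Rightarrow> bool" where
  "acyclic_edges \<Psi> T \<longleftrightarrow> (\<forall>u p. edge_path \<Psi> T u p u \<and> no_backtracking p \<longrightarrow> p = [])"

definition maximal_tree :: "('v, 'e, 'g) gog \<Rightarrow> 'e set \<Rightarrow> bool" where
  "maximal_tree \<Psi> T \<longleftrightarrow> T \<subseteq> gedges \<Psi> \<and> connected_edges \<Psi> T \<and> acyclic_edges \<Psi> T"

definition graph_of_groups :: "('v, 'e, 'g) gog \<Rightarrow> bool" where
  "graph_of_groups \<Psi> \<longleftrightarrow>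
     gverts \<Psi> \<noteq> {} \<and>
     connected_edges \<Psi> (gedges \<Psi>) \<and>
     (\<forall>v\<in>gverts \<Psi>. group (vgroup \<Psi> v)) \<and>
     (\<forall>e\<in>gedges \<Psi>.
        gsrc \<Psi> e \<in> gverts \<Psi> \<and> gtgt \<Psi> e \<in> gverts \<Psi> \<and> group (egroup \<Psi> e) \<and>
        inj_src \<Psi> e \<in> hom (egroup \<Psi> e) (vgroup \<Psi> (gsrc \<Psi> e)) \<and>
        inj_on (inj_src \<Psi> e) (carrier (egroup \<Psi> e)) \<and>
        inj_tgt \<Psi> e \<in> hom (egroup \<Psi> e) (vgroup \<Psi> (gtgt \<Psi> e)) \<and>
        inj_on (inj_tgt \<Psi> e) (carrier (egroup \<Psi> e)))"

text \<open>The fundamental group relative to a maximal tree \<open>T\<close>, as in Serre: the generators are the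
  elements of the vertex groups (tagged by their vertex) and one stable letter for each edge. The
  relators are the multiplication tables of the vertex groups, the relations
  \<open>e (inj_tgt e a) e\<inverse> = inj_src e a\<close>, and \<open>e = 1\<close> for the edges \<open>e\<close> of \<open>T\<close>.\<close>

definition gog_gens :: "('v, 'e, 'g) gog \<Rightarrow> ('v \<times> 'g + 'e) set" where
  "gog_gens \<Psi> = (SIGMA v : gverts \<Psi>. carrier (vgroup \<Psi> v)) <+> gedges \<Psi>"

definition gog_relators :: "('v, 'e, 'g) gog \<Rightarrow> 'e set \<Rightarrow> ('v \<times> 'g + 'e) word set" where
  "gog_relators \<Psi> T =
     {[(Inl (v, x), True), (Inl (v, y), True), (Inl (v, x \<otimes>\<^bsub>vgroup \<Psi> v\<^esub> y), False)] | v x y.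
        v \<in> gverts \<Psi> \<and> x \<in> carrier (vgroup \<Psi> v) \<and> y \<in> carrier (vgroup \<Psi> v)} \<union>
     {[(Inr e, True), (Inl (gtgt \<Psi> e, inj_tgt \<Psi> e a), True),
       (Inr e, False), (Inl (gsrc \<Psi> e, inj_src \<Psi> e a), False)] | e a.
        e \<in> gedges \<Psi> \<and> a \<in> carrier (egroup \<Psi> e)} \<union>
     {[(Inr e, True)] | e. e \<in> T}"

definition gog_pi1 ::
    "('v, 'e, 'g) gog \<Rightarrow> 'e set \<Rightarrow> ('v \<times> 'g + 'e) word set monoid" where
  "gog_pi1 \<Psi> T = presented_group (gog_gens \<Psi>) (gog_relators \<Psi> T)"

definition gog_incl ::
    "('v, 'e, 'g) gog \<Rightarrow> 'e set \<Rightarrow> 'v \<Rightarrow> 'g \<Rightarrow> ('v \<times> 'g + 'e) word set" where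
  "gog_incl \<Psi> T v g = word_class (gog_gens \<Psi>) (gog_relators \<Psi> T) [(Inl (v, g), True)]"

text \<open>The last clause asks for an isomorphism from the fundamental group to \<open>W\<close> that restricts to the
  inclusion on every vertex group. No values are prescribed on the stable letters: since \<open>W\<close> is
  generated by involutions, such an isomorphism can only exist when the underlying graph is a tree,
  and then all stable letters are trivial and the isomorphism is determined by the vertex groups.\<close>

definition visual_decomposition :: "'a monoid \<Rightarrow> 'a set \<Rightarrow> ('v, 'e, 'a) gog \<Rightarrow> bool" where
  "visual_decomposition W S \<Psi> \<longleftrightarrow>
     graph_of_groups \<Psi> \<and>
     (\<forall>v\<in>gverts \<Psi>. \<exists>H. special_subgroup W S H \<and> vgroup \<Psi> v = W\<lparr>carrier := H\<rparr>) \<and>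
     (\<forall>e\<in>gedges \<Psi>. \<exists>H. special_subgroup W S H \<and> egroup \<Psi> e = W\<lparr>carrier := H\<rparr>) \<and>
     (\<forall>e\<in>gedges \<Psi>. \<forall>a\<in>carrier (egroup \<Psi> e). inj_src \<Psi> e a = a \<and> inj_tgt \<Psi> e a = a) \<and>
     (\<exists>T. maximal_tree \<Psi> T \<and>
        (\<exists>h \<in> iso (gog_pi1 \<Psi> T) W.
           \<forall>v\<in>gverts \<Psi>. \<forall>g\<in>carrier (vgroup \<Psi> v). h (gog_incl \<Psi> T v g) = g))"

end

theory Submission
  imports Defs "HOL-Combinatorics.Permutations" Complex_Main
begin

text \<open>Suppose that \<open>W\<close> is virtually free. The positive and the negative powers of a nontrivial
  element of a free group tend to different ends, so every infinite subgroup of \<open>W\<close> is cut into two infinite pieces by a subset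
  of \<open>W\<close> that is almost invariant under right translations. On the other hand, call \<open>s\<close> an ascent of
  \<open>w\<close> if \<open>w s\<close> is longer than \<open>w\<close>. If the ascents in \<open>K \<subseteq> S\<close> of every element of
  the special subgroup on \<open>K\<close> span a connected graph, then a path in the Cayley graph of this subgroup
  can be pushed off balls by detours around cosets of finite dihedral subgroups. So the subgroup
  cannot be cut in this way, and it is finite. This applies if \<open>K\<close> is complete, and also if \<open>K\<close> is an
  induced circuit with more than three vertices, where the special subgroup is infinite because the
  descents of an element span a complete graph.

  A graph without induced circuits of more than three vertices has a perfect elimination ordering,
  from which its cliques can be arranged in a tree. The special subgroups on these cliques form a
  visual decomposition.

  In a visual decomposition the graph is a tree, since \<open>W\<close> is generated by involutions and has no
  homomorphism onto the integers. If the vertex groups are finite, they act freely on a common finite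
  set in such a way that the actions agree on the edge groups. The resulting action of \<open>W\<close> has point
  stabilizers of finite index, and a cocycle with values in a free group shows that these are free.\<close>

section \<open>Presentations, permutation actions and free groups\<close>

section \<open>Evaluating words\<close>

text \<open>The implications are proved in the cycle (1), (3), (2), (1). Ends of groups, actions on
  trees and normal forms of amalgams are replaced by homomorphisms into permutation groups: a
  presented group acts as soon as its relations hold for permutations. Actions on pairs of a point
  and a second component that keeps a record carry the main steps. With records in a free group they
  show that subgroups of free groups are free and that the point stabilizers at the end embed in a
  free group; with a sign as record they give the exchange condition. The relations alone do not
  show that \<open>s \<otimes> t\<close> has infinite order if its label is infinite. The geometric
  representation supplies this, and it is what makes the descents of an element span a complete
  graph. For a finite label an upper bound on the order suffices, since a detour may go around a
  smaller polygon.\<close>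

definition letter :: "('g, 'b) monoid_scheme \<Rightarrow> ('x \<Rightarrow> 'g) \<Rightarrow> 'x \<times> bool \<Rightarrow> 'g" where
  "letter G f a = (if snd a then f (fst a) else inv\<^bsub>G\<^esub> (f (fst a)))"

definition ev :: "('g, 'b) monoid_scheme \<Rightarrow> ('x \<Rightarrow> 'g) \<Rightarrow> 'x word \<Rightarrow> 'g" where
  "ev G f w = foldr (\<lambda>a g. letter G f a \<otimes>\<^bsub>G\<^esub> g) w \<one>\<^bsub>G\<^esub>"

abbreviation flip :: "'x \<times> bool \<Rightarrow> 'x \<times> bool" where
  "flip \<equiv> apsnd Not"

lemma flip_flip [simp]: "flip (flip a) = a"
  by (cases a) auto

lemma ev_Nil [simp]: "ev G f [] = \<one>\<^bsub>G\<^esub>"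
  and ev_Cons [simp]: "ev G f (a # w) = letter G f a \<otimes>\<^bsub>G\<^esub> ev G f w"
  by (simp_all add: ev_def)

lemma words_over_simps [simp]:
  "[] \<in> words_over X"
  "a # w \<in> words_over X \<longleftrightarrow> fst a \<in> X \<and> w \<in> words_over X"
  "v @ w \<in> words_over X \<longleftrightarrow> v \<in> words_over X \<and> w \<in> words_over X"
  by (auto simp: words_over_def mem_Times_iff)

context group
begin

lemma letter_closed: "f \<in> X \<rightarrow> carrier G \<Longrightarrow> fst a \<in> X \<Longrightarrow> letter G f a \<in> carrier G"
  by (auto simp: letter_def)

lemma ev_closed: "f \<in> X \<rightarrow> carrier G \<Longrightarrow> w \<in> words_over X \<Longrightarrow> ev G f w \<in> carrier G"
  by (induction w) (auto intro: letter_closed)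

lemma ev_append:
  assumes "f \<in> X \<rightarrow> carrier G" "v \<in> words_over X" "w \<in> words_over X"
  shows "ev G f (v @ w) = ev G f v \<otimes> ev G f w"
  using assms(2) by (induction v) (auto simp: m_assoc letter_closed[OF assms(1)] ev_closed[OF assms(1)] assms)

lemma letter_flip:
  assumes "f \<in> X \<rightarrow> carrier G" "fst a \<in> X"
  shows "letter G f (flip a) = inv (letter G f a)"
  using assms by (cases a) (auto simp: letter_def Pi_def)

lemma ev_word_eq:
  assumes f: "f \<in> X \<rightarrow> carrier G"
    and R: "\<And>r. r \<in> R \<Longrightarrow> r \<in> words_over X \<Longrightarrow> ev G f r = \<one>"
    and "word_eq X R v w"
  shows "ev G f v = ev G f w"
  using assms(3)
proof (induction rule: word_eq.induct)
  case (cancel u x b v)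
  then have "letter G f (x, b) \<otimes> letter G f (x, \<not> b) = \<one>"
    using letter_flip[OF f, of "(x, b)"] letter_closed[OF f, of "(x, b)"] by simp
  then have "ev G f ([(x, b), (x, \<not> b)] @ v) = ev G f v"
    using cancel f ev_closed[OF f, of v] by (simp add: m_assoc[symmetric] letter_closed[OF f])
  then show ?case
    using cancel by (simp add: ev_append[OF f] del: ev_Cons append_Cons)
next
  case (relator r u v)
  then show ?case
    using R[OF relator(1)] by (simp add: ev_append[OF f] ev_closed[OF f])
qed auto

lemma ev_generate:
  assumes "X \<subseteq> carrier G"
  shows "generate G X = (\<lambda>w. ev G (\<lambda>x. x) w) ` words_over X"
proof
  have id: "(\<lambda>x. x) \<in> X \<rightarrow> carrier G"
    using assms by auto
  show "generate G X \<subseteq> (\<lambda>w. ev G (\<lambda>x. x) w) ` words_over X"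
  proof
    fix g assume "g \<in> generate G X"
    then show "g \<in> (\<lambda>w. ev G (\<lambda>x. x) w) ` words_over X"
    proof induction
      case one
      show ?case by (rule image_eqI[of _ _ "[]"]) auto
    next
      case (incl h)
      then show ?case
        using assms by (intro image_eqI[of _ _ "[(h, True)]"]) (auto simp: letter_def)
    next
      case (inv h)
      then show ?case
        using assms by (intro image_eqI[of _ _ "[(h, False)]"]) (auto simp: letter_def)
    next
      case (eng h1 h2)
      then obtain v w where "v \<in> words_over X" "h1 = ev G (\<lambda>x. x) v"
        "w \<in> words_over X" "h2 = ev G (\<lambda>x. x) w" by auto
      then show ?case
        by (intro image_eqI[of _ _ "v @ w"]) (auto simp: ev_append[OF id])
    qed
  qed
  have "ev G (\<lambda>x. x) w \<in> generate G X" if "w \<in> words_over X" for w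
    using that
    by (induction w) (auto simp: letter_def intro: generate.intros)
  then show "(\<lambda>w. ev G (\<lambda>x. x) w) ` words_over X \<subseteq> generate G X"
    by auto
qed

lemma generate_left_induct [consumes 2, case_names one gen inv]:
  assumes "X \<subseteq> carrier G" "g \<in> generate G X" and one: "P \<one>"
    and gen: "\<And>x g. x \<in> X \<Longrightarrow> g \<in> generate G X \<Longrightarrow> P g \<Longrightarrow> P (x \<otimes> g)"
    and inv: "\<And>x g. x \<in> X \<Longrightarrow> g \<in> generate G X \<Longrightarrow> P g \<Longrightarrow> P (inv x \<otimes> g)"
  shows "P g"
proof -
  obtain w where w: "w \<in> words_over X" "g = ev G (\<lambda>x. x) w"
    using assms(2) ev_generate[OF assms(1)] by auto
  have "P (ev G (\<lambda>x. x) w)" using w(1)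
  proof (induction w)
    case (Cons a w)
    then have "ev G (\<lambda>x. x) w \<in> generate G X"
      using ev_generate[OF assms(1)] by simp
    then show ?case
      using Cons gen[of "fst a"] inv[of "fst a"] by (auto simp: letter_def)
  qed (simp add: one)
  then show ?thesis using w by simp
qed

lemma hom_eq_on_generate:
  assumes "X \<subseteq> carrier G" "group K" "\<phi> \<in> hom G K" "\<psi> \<in> hom G K" "\<And>x. x \<in> X \<Longrightarrow> \<phi> x = \<psi> x"
    and "g \<in> generate G X"
  shows "\<phi> g = \<psi> g"
proof -
  interpret \<phi>: group_hom G K \<phi>
    using assms by (simp add: group_hom_def group_hom_axioms_def is_group)
  interpret \<psi>: group_hom G K \<psi>
    using assms by (simp add: group_hom_def group_hom_axioms_def is_group)
  have "\<phi> g = \<psi> g \<and> g \<in> carrier G"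
    using assms(1,6)
  proof (induction rule: generate_left_induct)
    case (gen x g)
    then show ?case using assms(1,5) by auto
  next
    case (inv x g)
    then show ?case using assms(1,5) by (auto simp: subset_iff)
  qed auto
  then show ?thesis by simp
qed

end

lemma (in group_hom) hom_letter:
  assumes "f \<in> X \<rightarrow> carrier G" "fst a \<in> X"
  shows "h (letter G f a) = letter H (\<lambda>x. h (f x)) a"
proof -
  have "f (fst a) \<in> carrier G" using assms by auto
  then show ?thesis by (simp add: letter_def)
qed

lemma (in group_hom) hom_ev:
  assumes "f \<in> X \<rightarrow> carrier G" "w \<in> words_over X"
  shows "h (ev G f w) = ev H (\<lambda>x. h (f x)) w"
  using assms(2)
proof (induction w)
  case (Cons a w)
  then show ?case
    using hom_letter[OF assms(1), of a] G.ev_closed[OF assms(1), of w] G.letter_closed[OF assms(1), of a]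
    by simp
qed simp

section \<open>Universal property of a presentation\<close>

lemma carrier_presented_group: "carrier (presented_group X R) = word_class X R ` words_over X"
  and one_presented_group: "\<one>\<^bsub>presented_group X R\<^esub> = word_class X R []"
  by (simp_all add: presented_group_def)

lemma gen_in_presented_group:
  "(\<lambda>x. word_class X R [(x, True)]) \<in> X \<rightarrow> carrier (presented_group X R)"
  by (auto simp: carrier_presented_group)

text \<open>With this, \<open>hom_ev\<close> computes every homomorphism out of a presented group
  from its values on the generators.\<close>

lemma ev_presented_group:
  assumes "w \<in> words_over X"
  shows "ev (presented_group X R) (\<lambda>x. word_class X R [(x, True)]) w = word_class X R w"
proof -
  let ?P = "presented_group X R"
  interpret P: group ?P by (rule group_presented_group)
  have l: "letter ?P (\<lambda>x. word_class X R [(x, True)]) a = word_class X R [a]" if "fst a \<in> X" for a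
  proof (cases "snd a")
    case True
    then show ?thesis by (cases a) (simp add: letter_def)
  next
    case False
    define x where "x = fst a"
    have a: "a = (x, False)" and x: "x \<in> X" using False that by (cases a, auto simp: x_def)+
    have "word_eq X R [(x, False), (x, True)] []"
      using word_eq.cancel[of "[]" x False "[]" X R] x by simp
    then have "word_class X R [(x, False)] \<otimes>\<^bsub>?P\<^esub> word_class X R [(x, True)] = \<one>\<^bsub>?P\<^esub>"
      using x by (simp add: presented_group_mult one_presented_group word_class_eq_iff)
    then have "inv\<^bsub>?P\<^esub> word_class X R [(x, True)] = word_class X R [(x, False)]"
      using x by (intro P.inv_equality) (auto simp: carrier_presented_group)
    then show ?thesis by (simp add: letter_def a)
  qed
  show ?thesis
    using assms by (induction w) (auto simp: l presented_group_mult one_presented_group)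
qed

text \<open>Von Dyck's theorem. A class is evaluated at a chosen representative, and
  \<open>ev_word_eq\<close> makes the value independent of the choice. A relator with letters
  outside \<open>X\<close> never applies, so only relators over \<open>X\<close> have to be
  checked.\<close>

lemma presented_group_hom:
  assumes "group K" and f: "f \<in> X \<rightarrow> carrier K"
    and R: "\<And>r. r \<in> R \<Longrightarrow> r \<in> words_over X \<Longrightarrow> ev K f r = \<one>\<^bsub>K\<^esub>"
  obtains \<phi> where "\<phi> \<in> hom (presented_group X R) K"
    "\<And>w. w \<in> words_over X \<Longrightarrow> \<phi> (word_class X R w) = ev K f w"
proof
  interpret K: group K by fact
  define \<phi> where "\<phi> c = ev K f (SOME w. w \<in> words_over X \<and> word_class X R w = c)" for c
  show \<phi>: "\<phi> (word_class X R w) = ev K f w" if "w \<in> words_over X" for w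
  proof -
    define v where "v = (SOME v. v \<in> words_over X \<and> word_class X R v = word_class X R w)"
    have "v \<in> words_over X \<and> word_class X R v = word_class X R w"
      unfolding v_def by (rule someI[of _ w]) (use that in auto)
    then have "word_eq X R v w"
      using word_class_eq_iff[of v X R w] by blast
    then show ?thesis
      using K.ev_word_eq[OF f R, where v=v and w=w] by (simp add: \<phi>_def v_def)
  qed
  show "\<phi> \<in> hom (presented_group X R) K"
    by (rule homI)
      (auto simp: carrier_presented_group \<phi> presented_group_mult K.ev_closed[OF f] K.ev_append[OF f])
qed

text \<open>Replaces the abstract isomorphism by a criterion for words: the relators identify two
  words exactly if their values in \<open>G\<close> agree.\<close>

lemma has_presentationE:
  assumes "has_presentation G X R" "group G"
  shows "X \<subseteq> carrier G" "generate G X = carrier G"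
    and "\<And>v w. v \<in> words_over X \<Longrightarrow> w \<in> words_over X \<Longrightarrow>
      ev G (\<lambda>x. x) v = ev G (\<lambda>x. x) w \<longleftrightarrow> word_eq X R v w"
proof -
  let ?P = "presented_group X R"
  interpret G: group G by fact
  interpret P: group ?P by (rule group_presented_group)
  obtain h where h: "h \<in> iso ?P G" "\<And>x. x \<in> X \<Longrightarrow> h (word_class X R [(x, True)]) = x"
    and X: "X \<subseteq> carrier G"
    using assms(1) by (auto simp: has_presentation_def)
  interpret h: group_hom ?P G h
    using h by (auto simp: group_hom_def group_hom_axioms_def iso_def P.is_group G.is_group)
  have cong: "ev G f w = ev G g w" if "\<And>x. x \<in> X \<Longrightarrow> f x = g x" "w \<in> words_over X" for f g w
    using that(2) by (induction w) (auto simp: letter_def that(1))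
  have hw: "h (word_class X R w) = ev G (\<lambda>x. x) w" if "w \<in> words_over X" for w
    using h.hom_ev[OF gen_in_presented_group that] cong[of "\<lambda>x. h (word_class X R [(x, True)])" "\<lambda>x. x" w]
      h(2) that by (simp add: ev_presented_group)
  show "X \<subseteq> carrier G" by fact
  have bij: "bij_betw h (carrier ?P) (carrier G)"
    using h by (auto simp: iso_def)
  show "generate G X = carrier G"
  proof -
    have "carrier G = h ` word_class X R ` words_over X"
      using bij by (simp add: bij_betw_def carrier_presented_group)
    also have "\<dots> = (\<lambda>w. ev G (\<lambda>x. x) w) ` words_over X"
      by (auto simp: image_image hw)
    finally show ?thesis using G.ev_generate[OF X] by simp
  qed
  show "ev G (\<lambda>x. x) v = ev G (\<lambda>x. x) w \<longleftrightarrow> word_eq X R v w"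
    if "v \<in> words_over X" "w \<in> words_over X" for v w
  proof -
    have "h (word_class X R v) = h (word_class X R w) \<longleftrightarrow> word_class X R v = word_class X R w"
      using bij that by (auto simp: bij_betw_def inj_on_def carrier_presented_group)
    then show ?thesis using that by (simp add: hw word_class_eq_iff)
  qed
qed

lemma has_presentationI:
  assumes "group G" "X \<subseteq> carrier G" "generate G X = carrier G"
    and R: "\<And>r. r \<in> R \<Longrightarrow> r \<in> words_over X \<Longrightarrow> ev G (\<lambda>x. x) r = \<one>\<^bsub>G\<^esub>"
    and inj: "\<And>v w. v \<in> words_over X \<Longrightarrow> w \<in> words_over X \<Longrightarrow>
      ev G (\<lambda>x. x) v = ev G (\<lambda>x. x) w \<Longrightarrow> word_eq X R v w"
  shows "has_presentation G X R"
proof -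
  interpret G: group G by fact
  have "(\<lambda>x. x) \<in> X \<rightarrow> carrier G" using assms(2) by auto
  then obtain \<phi> where \<phi>: "\<phi> \<in> hom (presented_group X R) G"
    "\<And>w. w \<in> words_over X \<Longrightarrow> \<phi> (word_class X R w) = ev G (\<lambda>x. x) w"
    using presented_group_hom[OF assms(1) _ R] by blast
  have "inj_on \<phi> (carrier (presented_group X R))"
    using inj by (auto simp: inj_on_def carrier_presented_group \<phi>(2) word_class_eq_iff)
  moreover have "\<phi> ` carrier (presented_group X R) = carrier G"
    using G.ev_generate[OF assms(2)] assms(3) by (auto simp: carrier_presented_group image_image \<phi>(2))
  ultimately have "\<phi> \<in> iso (presented_group X R) G"
    using \<phi>(1) by (simp add: iso_def bij_betw_def)
  moreover have "\<phi> (word_class X R [(x, True)]) = x" if "x \<in> X" for x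
    using that assms(2) by (auto simp: \<phi>(2) letter_def)
  ultimately show ?thesis
    using assms(2) by (auto simp: has_presentation_def)
qed

lemma presentation_hom:
  assumes "has_presentation G X R" "group G" "group K" and f: "f \<in> X \<rightarrow> carrier K"
    and R: "\<And>r. r \<in> R \<Longrightarrow> r \<in> words_over X \<Longrightarrow> ev K f r = \<one>\<^bsub>K\<^esub>"
  obtains \<phi> where "\<phi> \<in> hom G K" "\<And>x. x \<in> X \<Longrightarrow> \<phi> x = f x"
proof -
  let ?P = "presented_group X R"
  interpret P: group ?P by (rule group_presented_group)
  interpret K: group K by fact
  obtain h where h: "h \<in> iso ?P G" "\<And>x. x \<in> X \<Longrightarrow> h (word_class X R [(x, True)]) = x"
    using assms(1) by (auto simp: has_presentation_def)
  have h': "inv_into (carrier ?P) h \<in> iso G ?P"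
    by (rule P.iso_set_sym[OF h(1)])
  obtain \<psi> where \<psi>: "\<psi> \<in> hom ?P K" "\<And>w. w \<in> words_over X \<Longrightarrow> \<psi> (word_class X R w) = ev K f w"
    using presented_group_hom[OF assms(3) f R] by blast
  show ?thesis
  proof
    show "\<psi> \<circ> inv_into (carrier ?P) h \<in> hom G K"
      using h' \<psi>(1) by (auto intro: hom_compose simp: iso_def)
    fix x assume x: "x \<in> X"
    have "inv_into (carrier ?P) h x = word_class X R [(x, True)]"
      using h x by (intro inv_into_f_eq) (auto simp: iso_def bij_betw_def carrier_presented_group)
    then show "(\<psi> \<circ> inv_into (carrier ?P) h) x = f x"
      using x \<psi>(2)[of "[(x, True)]"] f by (auto simp: letter_def Pi_def)
  qed
qed

section \<open>Groups of permutations\<close>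

text \<open>The target of all actions. Its elements are total functions that fix everything outside
  \<open>A\<close>, so relations can be checked pointwise as equations of functions.\<close>

definition perm_group :: "'x set \<Rightarrow> ('x \<Rightarrow> 'x) monoid" where
  "perm_group A = \<lparr>carrier = {p. p permutes A}, monoid.mult = (\<circ>), one = id\<rparr>"

lemma perm_group_simps [simp]:
  "p \<in> carrier (perm_group A) \<longleftrightarrow> p permutes A"
  "p \<otimes>\<^bsub>perm_group A\<^esub> q = p \<circ> q"
  "\<one>\<^bsub>perm_group A\<^esub> = id"
  by (simp_all add: perm_group_def)

lemma group_perm_group: "group (perm_group A)"
proof (rule groupI)
  show "\<exists>q\<in>carrier (perm_group A). q \<otimes>\<^bsub>perm_group A\<^esub> p = \<one>\<^bsub>perm_group A\<^esub>"
    if "p \<in> carrier (perm_group A)" for p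
    using that permutes_inv[of p A] permutes_inv_o(2)[of p A] by (intro bexI[of _ "inv_into UNIV p"]) auto
qed (auto simp: permutes_compose permutes_id[unfolded id_def] id_def comp_assoc)

lemma hom_perm_group_simps:
  assumes "group G" "\<rho> \<in> hom G (perm_group A)" "g \<in> carrier G"
  shows "\<And>h. h \<in> carrier G \<Longrightarrow> \<rho> (g \<otimes>\<^bsub>G\<^esub> h) x = \<rho> g (\<rho> h x)"
    and "\<rho> \<one>\<^bsub>G\<^esub> x = x"
    and "\<rho> g x \<in> A \<longleftrightarrow> x \<in> A"
    and "\<rho> (inv\<^bsub>G\<^esub> g) (\<rho> g x) = x"
    and "\<rho> g (\<rho> (inv\<^bsub>G\<^esub> g) x) = x"
    and "\<rho> g permutes A"
proof -
  interpret group_hom G "perm_group A" \<rho>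
    using assms by (simp add: group_hom_def group_hom_axioms_def group_perm_group)
  have m: "\<rho> (g \<otimes>\<^bsub>G\<^esub> h) x = \<rho> g (\<rho> h x)" if "g \<in> carrier G" "h \<in> carrier G" for g h x
    using that by simp
  then show "\<rho> (g \<otimes>\<^bsub>G\<^esub> h) x = \<rho> g (\<rho> h x)" if "h \<in> carrier G" for h
    using that assms(3) by blast
  have o: "\<rho> \<one>\<^bsub>G\<^esub> x = x" for x by simp
  then show "\<rho> \<one>\<^bsub>G\<^esub> x = x" .
  show p: "\<rho> g permutes A" using hom_closed[OF assms(3)] by simp
  then show "\<rho> g x \<in> A \<longleftrightarrow> x \<in> A" by (rule permutes_in_image)
  show "\<rho> (inv\<^bsub>G\<^esub> g) (\<rho> g x) = x" "\<rho> g (\<rho> (inv\<^bsub>G\<^esub> g) x) = x"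
    using m[of "inv\<^bsub>G\<^esub> g" g x] m[of g "inv\<^bsub>G\<^esub> g" x] o[of x] assms(3) by simp_all
qed

section \<open>Free groups\<close>

abbreviation free_group :: "'x set \<Rightarrow> 'x word set monoid" where
  "free_group X \<equiv> presented_group X {}"

definition reduced :: "'x word \<Rightarrow> bool" where
  "reduced = successively (\<lambda>a b. b \<noteq> flip a)"

definition red_cons :: "'x \<times> bool \<Rightarrow> 'x word \<Rightarrow> 'x word" where
  "red_cons a w = (if w \<noteq> [] \<and> hd w = flip a then tl w else a # w)"

definition norm_word :: "'x word \<Rightarrow> 'x word" where
  "norm_word w = foldr red_cons w []"

lemma reduced_simps [simp]: "reduced []" "reduced (a # w) \<longleftrightarrow> (w \<noteq> [] \<longrightarrow> hd w \<noteq> flip a) \<and> reduced w"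
  by (auto simp: reduced_def successively_Cons)

lemma reduced_append:
  "reduced (v @ w) \<longleftrightarrow> reduced v \<and> reduced w \<and> (v \<noteq> [] \<and> w \<noteq> [] \<longrightarrow> hd w \<noteq> flip (last v))"
  by (auto simp: reduced_def successively_append_iff)

lemma norm_word_simps [simp]: "norm_word [] = []" "norm_word (a # w) = red_cons a (norm_word w)"
  by (simp_all add: norm_word_def)

lemma norm_word_append: "norm_word (v @ w) = foldr red_cons v (norm_word w)"
  by (simp add: norm_word_def)

lemma reduced_red_cons: "reduced w \<Longrightarrow> reduced (red_cons a w)"
  by (cases w) (auto simp: red_cons_def)

lemma reduced_norm_word: "reduced (norm_word w)"
  by (induction w) (auto intro: reduced_red_cons)

lemma norm_word_reduced: "reduced w \<Longrightarrow> norm_word w = w"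
  by (induction w) (auto simp: red_cons_def)

text \<open>Van der Waerden's trick: letters act on reduced words, inverse letters by inverse maps.
  Acting on the empty word then gives a normal form that cancellation cannot change.\<close>

lemma red_cons_flip: "reduced w \<Longrightarrow> red_cons a (red_cons (flip a) w) = w"
  by (cases w; cases "tl w") (auto simp: red_cons_def)

lemma norm_word_closed: "w \<in> words_over X \<Longrightarrow> norm_word w \<in> words_over X"
proof (induction w)
  case (Cons a w)
  then have "norm_word w \<in> words_over X" "fst a \<in> X" by auto
  then show ?case by (cases "norm_word w") (auto simp: red_cons_def)
qed simp

lemma word_eq_norm_word: "w \<in> words_over X \<Longrightarrow> word_eq X R w (norm_word w)"
proof (induction w)
  case (Cons a w)
  then have w: "word_eq X R w (norm_word w)" "norm_word w \<in> words_over X" "fst a \<in> X"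
    by (auto simp: norm_word_closed)
  then have eq: "word_eq X R (a # w) (a # norm_word w)"
    using word_eq_append_left[of X R w "norm_word w" "[a]"] by simp
  show ?case
  proof (cases "norm_word w \<noteq> [] \<and> hd (norm_word w) = flip a")
    case True
    then obtain v where v: "norm_word w = flip a # v" by (cases "norm_word w") auto
    have "word_eq X R (a # flip a # v) v"
      using word_eq.cancel[of "[]" "fst a" "snd a" v X R] w v by (cases a) auto
    then show ?thesis using eq v by (auto simp: red_cons_def intro: word_eq.trans)
  qed (use eq in \<open>auto simp: red_cons_def\<close>)
qed (simp add: word_eq.refl)

lemma norm_word_eq: "word_eq X {} v w \<Longrightarrow> norm_word v = norm_word w"
proof (induction rule: word_eq.induct)
  case (cancel u x b v)
  then show ?case
    using red_cons_flip[OF reduced_norm_word[of v], of "(x, b)"] by (simp add: norm_word_append)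
qed auto

lemma word_eq_free_iff:
  assumes "v \<in> words_over X" "w \<in> words_over X"
  shows "word_eq X {} v w \<longleftrightarrow> norm_word v = norm_word w"
  using assms norm_word_eq word_eq_norm_word[of v X "{}"] word_eq_norm_word[of w X "{}"]
  by (metis word_eq.sym word_eq.trans)

lemma word_eq_map:
  assumes "word_eq X {} v w"
  shows "word_eq (f ` X) {} (map (apfst f) v) (map (apfst f) w)"
proof -
  have words: "map (apfst f) w \<in> words_over (f ` X)" if "w \<in> words_over X" for w :: "'a word"
    using that by (induction w) auto
  show ?thesis using assms
  proof (induction rule: word_eq.induct)
    case (cancel u x b v)
    have "map (apfst f) (u @ [(x, b), (x, \<not> b)] @ v) \<in> words_over (f ` X)"
      by (rule words[OF cancel])
    then show ?case using word_eq.cancel[of "map (apfst f) u" "f x" b "map (apfst f) v" "f ` X" "{}"]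
      by simp
  qed (auto intro: word_eq.intros words)
qed

text \<open>\<open>is_free_group\<close> wants a basis inside the group. It is the image of the
  generators under \<open>\<phi>\<close>; words over it are lifted to \<open>Y\<close> letter by
  letter.\<close>

lemma is_free_groupI:
  assumes "group G" "\<phi> \<in> iso (free_group Y) G"
  shows "is_free_group G"
proof -
  interpret P: group "free_group Y" by (rule group_presented_group)
  interpret G: group G by fact
  interpret \<phi>: group_hom "free_group Y" G \<phi>
    using assms by (auto simp: group_hom_def group_hom_axioms_def iso_def P.is_group)
  define f where "f = (\<lambda>y. \<phi> (word_class Y {} [(y, True)]))"
  define X where "X = f ` Y"
  have bij: "bij_betw \<phi> (carrier (free_group Y)) (carrier G)"
    using assms by (simp add: iso_def)
  have X: "X \<subseteq> carrier G"
    using bij by (auto simp: X_def f_def bij_betw_def carrier_presented_group)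
  have fX: "f \<in> Y \<rightarrow> carrier G" using X by (auto simp: X_def)
  have ev: "ev G f w = \<phi> (word_class Y {} w)" if "w \<in> words_over Y" for w
    using \<phi>.hom_ev[OF gen_in_presented_group that] that by (simp add: ev_presented_group f_def)
  have ev_map: "ev G (\<lambda>x. x) (map (apfst f) w) = ev G f w" for w
    by (induction w) (auto simp: letter_def)
  have ex: "\<exists>v\<in>words_over Y. w = map (apfst f) v" if "w \<in> words_over X" for w
    using that
  proof (induction w)
    case (Cons a w)
    then obtain v y where "v \<in> words_over Y" "w = map (apfst f) v" "y \<in> Y" "fst a = f y"
      by (auto simp: X_def)
    then show ?case by (intro bexI[of _ "(y, snd a) # v"]) (cases a, auto)
  qed simp
  have "has_presentation G X {}"
  proof (rule has_presentationI[OF assms(1) X])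
    have "ev G f w \<in> generate G X" if "w \<in> words_over Y" for w
      using that by (induction w) (auto simp: letter_def X_def intro: generate.intros)
    moreover have "carrier G = (\<lambda>w. \<phi> (word_class Y {} w)) ` words_over Y"
      using bij by (simp add: bij_betw_def carrier_presented_group image_image)
    ultimately have "carrier G \<subseteq> generate G X"
      using ev by auto
    then show "generate G X = carrier G"
      using G.generate_incl[OF X] by blast
    fix v w assume vw: "v \<in> words_over X" "w \<in> words_over X" "ev G (\<lambda>x. x) v = ev G (\<lambda>x. x) w"
    obtain v' w' where v': "v' \<in> words_over Y" "v = map (apfst f) v'"
      and w': "w' \<in> words_over Y" "w = map (apfst f) w'"
      using ex[OF vw(1)] ex[OF vw(2)] by blast
    have "\<phi> (word_class Y {} v') = \<phi> (word_class Y {} w')"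
      using vw(3) v' w' by (simp add: ev_map ev)
    then have "word_class Y {} v' = word_class Y {} w'"
      using bij v' w' by (auto simp: bij_betw_def inj_on_def carrier_presented_group)
    then have "word_eq Y {} v' w'"
      using word_class_eq_iff[OF v'(1), of "{}" w'] by blast
    then show "word_eq X {} v w"
      using word_eq_map[of Y v' w' f] v' w' by (simp add: X_def)
  qed auto
  then show ?thesis using assms(1) by (auto simp: is_free_group_def)
qed

lemma generate_presented_group:
  "generate (presented_group X R) ((\<lambda>x. word_class X R [(x, True)]) ` X) = carrier (presented_group X R)"
proof
  let ?P = "presented_group X R" and ?f = "\<lambda>x. word_class X R [(x, True)]"
  interpret P: group ?P by (rule group_presented_group)
  have X: "?f ` X \<subseteq> carrier ?P"
    by (rule funcset_image[OF gen_in_presented_group])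
  then show "generate ?P (?f ` X) \<subseteq> carrier ?P"
    by (rule P.generate_incl)
  have "ev ?P ?f w \<in> generate ?P (?f ` X)" if "w \<in> words_over X" for w
    using that by (induction w) (auto simp: letter_def intro: generate.intros)
  then show "carrier ?P \<subseteq> generate ?P (?f ` X)"
    by (auto simp: carrier_presented_group ev_presented_group)
qed

lemma is_free_group_free_group: "is_free_group (free_group Y)"
proof (rule is_free_groupI)
  show "(\<lambda>x. x) \<in> iso (free_group Y) (free_group Y)"
    by (auto simp: iso_def hom_def bij_betw_def)
qed (rule group_presented_group)

text \<open>The group \<open>G\<close> permutes the pairs of a left coset of \<open>H\<close> and an
  element of the free group on the edges of the Schreier graph outside a spanning tree; the second
  component records the edges crossed. On the stabilizer \<open>H\<close> of the trivial coset this record is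
  an isomorphism.\<close>

theorem nielsen_schreier:
  assumes "is_free_group G" "subgroup H G"
  shows "is_free_group (G\<lparr>carrier := H\<rparr>)"
proof -
  interpret G: group G using assms(1) by (simp add: is_free_group_def)
  obtain X where pres: "has_presentation G X {}"
    using assms(1) by (auto simp: is_free_group_def)
  note X = has_presentationE(1,2)[OF pres G.is_group]
  interpret H: subgroup H G by fact
  have id: "(\<lambda>x. x) \<in> X \<rightarrow> carrier G" using X by auto
  let ?ev = "ev G (\<lambda>x. x)" and ?letter = "letter G (\<lambda>x. x)"
  define C where "C = (\<lambda>g. g <#\<^bsub>G\<^esub> H) ` carrier G"
  have HC: "H \<in> C"
    using G.lcos_mult_one[OF H.subset] by (auto simp: C_def image_iff)
  have C_sub: "A \<subseteq> carrier G" if "A \<in> C" for A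
    using that H.subset by (auto simp: C_def l_coset_def)
  have act: "(g \<otimes>\<^bsub>G\<^esub> h) <#\<^bsub>G\<^esub> A = g <#\<^bsub>G\<^esub> (h <#\<^bsub>G\<^esub> A)"
    if "A \<in> C" "g \<in> carrier G" "h \<in> carrier G" for A g h
    using G.lcos_m_assoc[OF C_sub[OF that(1)] that(2,3)] by simp
  have act_one: "\<one>\<^bsub>G\<^esub> <#\<^bsub>G\<^esub> A = A" if "A \<in> C" for A
    by (rule G.lcos_mult_one[OF C_sub[OF that]])
  have actC: "g <#\<^bsub>G\<^esub> A \<in> C" if "A \<in> C" "g \<in> carrier G" for A g
    using that act[OF HC] by (auto simp: C_def image_iff)
  have act_inv: "inv\<^bsub>G\<^esub> g <#\<^bsub>G\<^esub> (g <#\<^bsub>G\<^esub> A) = A" "g <#\<^bsub>G\<^esub> (inv\<^bsub>G\<^esub> g <#\<^bsub>G\<^esub> A) = A"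
    if "A \<in> C" "g \<in> carrier G" for A g
    using that by (simp_all add: act[symmetric] act_one)
  have stab: "g <#\<^bsub>G\<^esub> H = H \<longleftrightarrow> g \<in> H" if "g \<in> carrier G" for g
  proof
    assume "g <#\<^bsub>G\<^esub> H = H"
    moreover have "g \<in> g <#\<^bsub>G\<^esub> H"
      using that by (auto simp: l_coset_def intro!: bexI[of _ "\<one>\<^bsub>G\<^esub>"])
    ultimately show "g \<in> H" by simp
  next
    assume g: "g \<in> H"
    have "h \<in> g <#\<^bsub>G\<^esub> H" if "h \<in> H" for h
      using that g by (auto simp: l_coset_def G.inv_solve_left intro!: bexI[of _ "inv\<^bsub>G\<^esub> g \<otimes>\<^bsub>G\<^esub> h"]
          simp flip: G.m_assoc)
    with g show "g <#\<^bsub>G\<^esub> H = H" by (auto simp: l_coset_def)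
  qed

  \<comment> \<open>The distance from the trivial coset \<open>H\<close> in the Schreier graph.
    Every other coset has a neighbour closer to \<open>H\<close>, which drives the recursion for the
    spanning tree.\<close>
  define len where
    "len A = (LEAST n. \<exists>w\<in>words_over X. length w = n \<and> A = ?ev w <#\<^bsub>G\<^esub> H)" for A
  have len_le: "len (?ev w <#\<^bsub>G\<^esub> H) \<le> length w" if "w \<in> words_over X" for w
    unfolding len_def by (rule Least_le) (use that in auto)
  have parent: "\<exists>a A'. fst a \<in> X \<and> A' \<in> C \<and> len A' < len A \<and> A = ?letter a <#\<^bsub>G\<^esub> A'"
    if A: "A \<in> C" "A \<noteq> H" for A
  proof -
    have "\<exists>n. \<exists>w\<in>words_over X. length w = n \<and> A = ?ev w <#\<^bsub>G\<^esub> H"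
    proof -
      obtain g where g: "g \<in> carrier G" "A = g <#\<^bsub>G\<^esub> H" using A by (auto simp: C_def)
      then obtain w where "w \<in> words_over X" "g = ?ev w"
        using G.ev_generate[OF X(1)] X(2) by blast
      then show ?thesis using g by blast
    qed
    from LeastI_ex[OF this] obtain w where w: "w \<in> words_over X" "length w = len A" "A = ?ev w <#\<^bsub>G\<^esub> H"
      unfolding len_def[symmetric] by auto
    then obtain a v where v: "w = a # v"
      using A(2) act_one[OF HC] by (cases w) auto
    have "len (?ev v <#\<^bsub>G\<^esub> H) < len A"
      using len_le[of v] w v by auto
    moreover have "A = ?letter a <#\<^bsub>G\<^esub> (?ev v <#\<^bsub>G\<^esub> H)"
      using w v act[OF HC G.letter_closed[OF id] G.ev_closed[OF id]] by simp
    ultimately show ?thesis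
      using w v G.ev_closed[OF id] by (intro exI[of _ a] exI[of _ "?ev v <#\<^bsub>G\<^esub> H"]) (auto simp: C_def)
  qed
  define edge where "edge A a A' \<longleftrightarrow> fst a \<in> X \<and> A' \<in> C \<and> len A' < len A \<and> A = ?letter a <#\<^bsub>G\<^esub> A'" for A a A'
  have "\<exists>\<tau>. \<forall>A. if A \<in> C \<and> A \<noteq> H then \<exists>a A'. edge A a A' \<and> \<tau> A = a # \<tau> A' else \<tau> A = []"
    (is "\<exists>\<tau>. \<forall>A. ?Q \<tau> A (\<tau> A)")
  proof (rule dependent_wf_choice[of "measure len" ?Q])
    fix f g :: "'a set \<Rightarrow> 'a word" and A r assume "\<And>B. (B, A) \<in> measure len \<Longrightarrow> f B = g B"
    then have "f A' = g A'" if "edge A a A'" for a A' using that unfolding edge_def in_measure by blast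
    then show "?Q f A r = ?Q g A r" by (simp cong: conj_cong)
  next
    fix A f
    show "\<exists>r. ?Q f A r" using parent[of A] by (auto simp: edge_def)
  qed simp
  then obtain \<tau> where \<tau>': "\<And>A. ?Q \<tau> A (\<tau> A)" by blast
  have \<tau>: "\<exists>a A'. fst a \<in> X \<and> A' \<in> C \<and> len A' < len A \<and> A = ?letter a <#\<^bsub>G\<^esub> A' \<and> \<tau> A = a # \<tau> A'"
    if "A \<in> C" "A \<noteq> H" for A
    using \<tau>'[of A] that by (auto simp: edge_def)
  have \<tau>H: "\<tau> H = []"
    using \<tau>'[of H] by simp
  define t where "t A = ?ev (\<tau> A)" for A
  have \<tau>_word: "\<tau> A \<in> words_over X \<and> A = t A <#\<^bsub>G\<^esub> H" if "A \<in> C" for A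
    using that
  proof (induction "len A" arbitrary: A rule: less_induct)
    case less
    show ?case
    proof (cases "A = H")
      case True
      then show ?thesis using \<tau>H act_one[OF HC] by (simp add: t_def)
    next
      case False
      from \<tau>[OF less.prems False] obtain a A' where a: "fst a \<in> X" "A' \<in> C" "len A' < len A"
        "A = ?letter a <#\<^bsub>G\<^esub> A'" "\<tau> A = a # \<tau> A'" by blast
      have "\<tau> A' \<in> words_over X" "A' = t A' <#\<^bsub>G\<^esub> H" using less.hyps[OF a(3,2)] by auto
      then show ?thesis
        using a act[OF HC G.letter_closed[OF id a(1)] G.ev_closed[OF id, of "\<tau> A'"]] by (simp add: t_def)
    qed
  qed
  have t_closed: "t A \<in> carrier G" if "A \<in> C" for A
    using \<tau>_word[OF that] G.ev_closed[OF id] by (simp add: t_def)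

  \<comment> \<open>An edge from \<open>B\<close> to \<open>x B\<close> is in the tree if one end is
    the parent of the other; which end that is decides between \<open>x\<close> and its
    inverse.\<close>
  define tree where "tree B x \<longleftrightarrow> \<tau> (x <#\<^bsub>G\<^esub> B) = (x, True) # \<tau> B \<or> \<tau> B = (x, False) # \<tau> (x <#\<^bsub>G\<^esub> B)" for B x
  define Z where "Z = {(B, x). B \<in> C \<and> x \<in> X \<and> \<not> tree B x}"
  define K where "K = free_group Z"
  interpret K: group K unfolding K_def by (rule group_presented_group)
  define \<zeta> where "\<zeta> B x = (if tree B x then \<one>\<^bsub>K\<^esub> else word_class Z {} [((B, x), True)])" for B x
  have \<zeta>_closed: "\<zeta> B x \<in> carrier K" if "B \<in> C" "x \<in> X" for B x
  proof (cases "tree B x")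
    case False
    then have "(B, x) \<in> Z" using that by (simp add: Z_def)
    then show ?thesis
      using funcset_mem[OF gen_in_presented_group, of "(B, x)" Z "{}"] False by (simp add: \<zeta>_def K_def)
  qed (simp add: \<zeta>_def)
  \<comment> \<open>A skew product over the action on cosets: crossing the edge labelled
    \<open>x\<close> at \<open>B\<close> multiplies the record by \<open>\<zeta> B x\<close>, which
    is trivial on the tree and a free generator elsewhere.\<close>
  define f where "f x = (\<lambda>(B, k). if B \<in> C \<and> k \<in> carrier K then (x <#\<^bsub>G\<^esub> B, \<zeta> B x \<otimes>\<^bsub>K\<^esub> k) else (B, k))" for x
  have f_perm: "f x permutes (C \<times> carrier K)" if x: "x \<in> X" for x
  proof (rule bij_imp_permutes)
    have xG: "x \<in> carrier G" using x X by auto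
    have *: "inv\<^bsub>K\<^esub> \<zeta> B x \<otimes>\<^bsub>K\<^esub> (\<zeta> B x \<otimes>\<^bsub>K\<^esub> k) = k" "\<zeta> B x \<otimes>\<^bsub>K\<^esub> (inv\<^bsub>K\<^esub> \<zeta> B x \<otimes>\<^bsub>K\<^esub> k) = k"
      if "B \<in> C" "k \<in> carrier K" for B k
      using that \<zeta>_closed[OF that(1) x] by (simp_all flip: K.m_assoc)
    let ?g = "\<lambda>(B, k). (inv\<^bsub>G\<^esub> x <#\<^bsub>G\<^esub> B, inv\<^bsub>K\<^esub> \<zeta> (inv\<^bsub>G\<^esub> x <#\<^bsub>G\<^esub> B) x \<otimes>\<^bsub>K\<^esub> k)"
    have xi: "inv\<^bsub>G\<^esub> x \<in> carrier G" using xG by simp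
    have f: "f x (B, k) = (x <#\<^bsub>G\<^esub> B, \<zeta> B x \<otimes>\<^bsub>K\<^esub> k)" if "B \<in> C" "k \<in> carrier K" for B k
      using that by (simp add: f_def)
    have f_in: "f x p \<in> C \<times> carrier K" "?g (f x p) = p" if "p \<in> C \<times> carrier K" for p
      using that actC[OF _ xG] \<zeta>_closed[OF _ x] *(1) by (auto simp: f act_inv(1) xG)
    have g_in: "?g p \<in> C \<times> carrier K" if "p \<in> C \<times> carrier K" for p
      using that actC[OF _ xi] \<zeta>_closed[OF actC[OF _ xi] x] by auto
    have fg: "f x (?g p) = p" if p: "p \<in> C \<times> carrier K" for p
    proof -
      obtain B k where Bk: "p = (B, k)" "B \<in> C" "k \<in> carrier K" using p by auto
      have B: "inv\<^bsub>G\<^esub> x <#\<^bsub>G\<^esub> B \<in> C" using actC[OF Bk(2) xi] .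
      have "inv\<^bsub>K\<^esub> \<zeta> (inv\<^bsub>G\<^esub> x <#\<^bsub>G\<^esub> B) x \<otimes>\<^bsub>K\<^esub> k \<in> carrier K"
        using \<zeta>_closed[OF B x] Bk(3) by simp
      then show ?thesis
        using f[OF B] *(2)[OF B Bk(3)] act_inv(2)[OF Bk(2) xG] by (simp add: Bk(1))
    qed
    show "bij_betw (f x) (C \<times> carrier K) (C \<times> carrier K)"
    proof (rule bij_betw_byWitness[where f' = ?g])
      show "\<forall>p\<in>C \<times> carrier K. ?g (f x p) = p" by (rule ballI, erule f_in(2))
      show "\<forall>p\<in>C \<times> carrier K. f x (?g p) = p" by (rule ballI, erule fg)
      show "f x ` (C \<times> carrier K) \<subseteq> C \<times> carrier K" by (rule image_subsetI, erule f_in(1))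
      show "?g ` (C \<times> carrier K) \<subseteq> C \<times> carrier K" by (rule image_subsetI, erule g_in)
    qed
    show "f x p = p" if "p \<notin> C \<times> carrier K" for p
      using that unfolding f_def by (cases p) auto
  qed
  have fX: "f \<in> X \<rightarrow> carrier (perm_group (C \<times> carrier K))" using f_perm by auto
  obtain \<rho> where \<rho>: "\<rho> \<in> hom G (perm_group (C \<times> carrier K))" "\<And>x. x \<in> X \<Longrightarrow> \<rho> x = f x"
    using presentation_hom[OF pres G.is_group group_perm_group fX] by blast
  note \<rho>_simps = hom_perm_group_simps[OF G.is_group \<rho>(1)]
  note \<rho>_one = \<rho>_simps(2)[OF G.one_closed]

  \<comment> \<open>The Schreier generators: loops from \<open>H\<close> along the tree, across one
    edge and back. \<open>val\<close> sends the free generator of an edge to its loop.\<close>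
  have edge_closed: "inv\<^bsub>G\<^esub> t (x <#\<^bsub>G\<^esub> B) \<otimes>\<^bsub>G\<^esub> (x \<otimes>\<^bsub>G\<^esub> t B) \<in> carrier G" if "B \<in> C" "x \<in> X" for B x
    using that X t_closed actC by (auto intro!: G.m_closed)
  have edgeZ: "(\<lambda>(B, x). inv\<^bsub>G\<^esub> t (x <#\<^bsub>G\<^esub> B) \<otimes>\<^bsub>G\<^esub> (x \<otimes>\<^bsub>G\<^esub> t B)) \<in> Z \<rightarrow> carrier G"
    using edge_closed by (auto simp: Z_def)
  obtain val where val: "val \<in> hom K G"
    and val_gen: "\<And>w. w \<in> words_over Z \<Longrightarrow>
      val (word_class Z {} w) = ev G (\<lambda>(B, x). inv\<^bsub>G\<^esub> t (x <#\<^bsub>G\<^esub> B) \<otimes>\<^bsub>G\<^esub> (x \<otimes>\<^bsub>G\<^esub> t B)) w"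
    using presented_group_hom[OF G.is_group edgeZ, of "{}"] unfolding K_def by blast
  interpret val: group_hom K G val
    using val by (simp add: group_hom_def group_hom_axioms_def K.is_group G.is_group)
  have val_\<zeta>: "t (x <#\<^bsub>G\<^esub> B) \<otimes>\<^bsub>G\<^esub> val (\<zeta> B x) = x \<otimes>\<^bsub>G\<^esub> t B" if B: "B \<in> C" and x: "x \<in> X" for B x
  proof (cases "tree B x")
    case True
    have xG: "x \<in> carrier G" using x X by auto
    have "t (x <#\<^bsub>G\<^esub> B) = x \<otimes>\<^bsub>G\<^esub> t B"
      using True unfolding tree_def
    proof
      assume "\<tau> B = (x, False) # \<tau> (x <#\<^bsub>G\<^esub> B)"
      then have "t B = inv\<^bsub>G\<^esub> x \<otimes>\<^bsub>G\<^esub> t (x <#\<^bsub>G\<^esub> B)" by (simp add: t_def letter_def)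
      then show ?thesis
        using xG t_closed[OF actC[OF B xG]] by (simp add: G.m_assoc[symmetric])
    qed (simp add: t_def letter_def)
    then show ?thesis using True t_closed[OF actC[OF B xG]] by (simp add: \<zeta>_def)
  next
    case False
    have xG: "x \<in> carrier G" using x X by auto
    have "val (\<zeta> B x) = inv\<^bsub>G\<^esub> t (x <#\<^bsub>G\<^esub> B) \<otimes>\<^bsub>G\<^esub> (x \<otimes>\<^bsub>G\<^esub> t B)"
    proof -
      have "(B, x) \<in> Z" using False B x by (simp add: Z_def)
      then show ?thesis
        using val_gen[of "[((B, x), True)]"] edge_closed[OF B x] False by (simp add: \<zeta>_def letter_def)
    qed
    then show ?thesis
      using xG t_closed[OF actC[OF B xG]] t_closed[OF B] by (simp add: G.m_assoc[symmetric])
  qed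

  \<comment> \<open>Each \<open>g\<close> acts on the fibre over \<open>B\<close> by left
    translation with some \<open>c\<close>, and \<open>val c\<close> is \<open>g\<close> corrected
    by the transversal at both ends. At \<open>B = H\<close> the correction is trivial, so
    \<open>val\<close> inverts the record \<open>\<eta>\<close> there.\<close>
  have cocycle: "\<forall>B\<in>C. \<exists>c\<in>carrier K. (\<forall>k\<in>carrier K. \<rho> g (B, k) = (g <#\<^bsub>G\<^esub> B, c \<otimes>\<^bsub>K\<^esub> k)) \<and>
      t (g <#\<^bsub>G\<^esub> B) \<otimes>\<^bsub>G\<^esub> val c = g \<otimes>\<^bsub>G\<^esub> t B" if "g \<in> carrier G" for g
    using X(1) that[folded X(2)]
  proof (induction rule: G.generate_left_induct)
    case one
    show ?case
      by (intro ballI bexI[of _ "\<one>\<^bsub>K\<^esub>"]) (auto simp: \<rho>_one act_one t_closed)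
  next
    case (gen x g)
    have g: "g \<in> carrier G" and x: "x \<in> carrier G" using gen X by auto
    show ?case
    proof
      fix B assume B: "B \<in> C"
      then obtain c where c: "c \<in> carrier K" "\<And>k. k \<in> carrier K \<Longrightarrow> \<rho> g (B, k) = (g <#\<^bsub>G\<^esub> B, c \<otimes>\<^bsub>K\<^esub> k)"
        "t (g <#\<^bsub>G\<^esub> B) \<otimes>\<^bsub>G\<^esub> val c = g \<otimes>\<^bsub>G\<^esub> t B" using gen by blast
      let ?B = "g <#\<^bsub>G\<^esub> B"
      have gB: "?B \<in> C" using actC[OF B g] .
      note z = \<zeta>_closed[OF gB gen(1)]
      have "t (x <#\<^bsub>G\<^esub> ?B) \<otimes>\<^bsub>G\<^esub> val (\<zeta> ?B x \<otimes>\<^bsub>K\<^esub> c) = (t (x <#\<^bsub>G\<^esub> ?B) \<otimes>\<^bsub>G\<^esub> val (\<zeta> ?B x)) \<otimes>\<^bsub>G\<^esub> val c"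
        using z c t_closed[OF actC[OF gB x]] by (simp add: G.m_assoc)
      also have "\<dots> = (x \<otimes>\<^bsub>G\<^esub> g) \<otimes>\<^bsub>G\<^esub> t B"
        using val_\<zeta>[OF gB gen(1)] c x g t_closed[OF gB] t_closed[OF B] by (simp add: G.m_assoc)
      finally have 1: "t (x <#\<^bsub>G\<^esub> ?B) \<otimes>\<^bsub>G\<^esub> val (\<zeta> ?B x \<otimes>\<^bsub>K\<^esub> c) = (x \<otimes>\<^bsub>G\<^esub> g) \<otimes>\<^bsub>G\<^esub> t B" .
      show "\<exists>c\<in>carrier K. (\<forall>k\<in>carrier K. \<rho> (x \<otimes>\<^bsub>G\<^esub> g) (B, k) = ((x \<otimes>\<^bsub>G\<^esub> g) <#\<^bsub>G\<^esub> B, c \<otimes>\<^bsub>K\<^esub> k)) \<and>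
          t ((x \<otimes>\<^bsub>G\<^esub> g) <#\<^bsub>G\<^esub> B) \<otimes>\<^bsub>G\<^esub> val c = x \<otimes>\<^bsub>G\<^esub> g \<otimes>\<^bsub>G\<^esub> t B"
        using 1 z c x g gB
        by (intro bexI[of _ "\<zeta> ?B x \<otimes>\<^bsub>K\<^esub> c"])
          (auto simp: \<rho>_simps(1) \<rho>(2)[OF gen(1)] f_def act[OF B] K.m_assoc)
    qed
  next
    case (inv x g)
    have g: "g \<in> carrier G" and x: "x \<in> carrier G" using inv X by auto
    show ?case
    proof
      fix B assume B: "B \<in> C"
      then obtain c where c: "c \<in> carrier K" "\<And>k. k \<in> carrier K \<Longrightarrow> \<rho> g (B, k) = (g <#\<^bsub>G\<^esub> B, c \<otimes>\<^bsub>K\<^esub> k)"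
        "t (g <#\<^bsub>G\<^esub> B) \<otimes>\<^bsub>G\<^esub> val c = g \<otimes>\<^bsub>G\<^esub> t B" using inv by blast
      let ?B = "inv\<^bsub>G\<^esub> x <#\<^bsub>G\<^esub> (g <#\<^bsub>G\<^esub> B)"
      have gB: "g <#\<^bsub>G\<^esub> B \<in> C" and B': "?B \<in> C" using actC B g x by auto
      have xB: "x <#\<^bsub>G\<^esub> ?B = g <#\<^bsub>G\<^esub> B" using act_inv(2)[OF gB x] .
      note z = \<zeta>_closed[OF B' inv(1)]
      have 2: "\<rho> (inv\<^bsub>G\<^esub> x) (g <#\<^bsub>G\<^esub> B, k) = (?B, inv\<^bsub>K\<^esub> \<zeta> ?B x \<otimes>\<^bsub>K\<^esub> k)" if k: "k \<in> carrier K" for k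
      proof -
        have "\<rho> x (?B, inv\<^bsub>K\<^esub> \<zeta> ?B x \<otimes>\<^bsub>K\<^esub> k) = (g <#\<^bsub>G\<^esub> B, k)"
          using z B' k by (simp add: \<rho>(2)[OF inv(1)] f_def xB flip: K.m_assoc)
        then show ?thesis
          using \<rho>_simps(4)[OF x, of "(?B, inv\<^bsub>K\<^esub> \<zeta> ?B x \<otimes>\<^bsub>K\<^esub> k)"] by simp
      qed
      have "t ?B = inv\<^bsub>G\<^esub> x \<otimes>\<^bsub>G\<^esub> (t (g <#\<^bsub>G\<^esub> B) \<otimes>\<^bsub>G\<^esub> val (\<zeta> ?B x))"
        using val_\<zeta>[OF B' inv(1)] x t_closed[OF B'] unfolding xB by (simp add: G.m_assoc[symmetric])
      then have "t ?B \<otimes>\<^bsub>G\<^esub> val (inv\<^bsub>K\<^esub> \<zeta> ?B x \<otimes>\<^bsub>K\<^esub> c) = inv\<^bsub>G\<^esub> x \<otimes>\<^bsub>G\<^esub> (t (g <#\<^bsub>G\<^esub> B) \<otimes>\<^bsub>G\<^esub> (val (\<zeta> ?B x) \<otimes>\<^bsub>G\<^esub> val (inv\<^bsub>K\<^esub> \<zeta> ?B x \<otimes>\<^bsub>K\<^esub> c)))"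
        using z c x t_closed[OF gB] by (simp add: G.m_assoc)
      also have "val (\<zeta> ?B x) \<otimes>\<^bsub>G\<^esub> val (inv\<^bsub>K\<^esub> \<zeta> ?B x \<otimes>\<^bsub>K\<^esub> c) = val c"
        using z c by (simp add: G.m_assoc[symmetric])
      also have "inv\<^bsub>G\<^esub> x \<otimes>\<^bsub>G\<^esub> (t (g <#\<^bsub>G\<^esub> B) \<otimes>\<^bsub>G\<^esub> val c) = inv\<^bsub>G\<^esub> x \<otimes>\<^bsub>G\<^esub> g \<otimes>\<^bsub>G\<^esub> t B"
        using c x g t_closed[OF B] by (simp add: G.m_assoc)
      finally show "\<exists>c\<in>carrier K. (\<forall>k\<in>carrier K. \<rho> (inv\<^bsub>G\<^esub> x \<otimes>\<^bsub>G\<^esub> g) (B, k) = ((inv\<^bsub>G\<^esub> x \<otimes>\<^bsub>G\<^esub> g) <#\<^bsub>G\<^esub> B, c \<otimes>\<^bsub>K\<^esub> k)) \<and>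
          t ((inv\<^bsub>G\<^esub> x \<otimes>\<^bsub>G\<^esub> g) <#\<^bsub>G\<^esub> B) \<otimes>\<^bsub>G\<^esub> val c = inv\<^bsub>G\<^esub> x \<otimes>\<^bsub>G\<^esub> g \<otimes>\<^bsub>G\<^esub> t B"
        using 2 z c x g gB
        by (intro bexI[of _ "inv\<^bsub>K\<^esub> \<zeta> ?B x \<otimes>\<^bsub>K\<^esub> c"])
          (auto simp: \<rho>_simps(1) act[OF B] K.m_assoc)
    qed
  qed

  define \<eta> where "\<eta> h = snd (\<rho> h (H, \<one>\<^bsub>K\<^esub>))" for h
  have tH: "t H = \<one>\<^bsub>G\<^esub>" by (simp add: t_def \<tau>H)
  have \<eta>: "\<eta> h \<in> carrier K" "val (\<eta> h) = h" "\<And>k. k \<in> carrier K \<Longrightarrow> \<rho> h (H, k) = (H, \<eta> h \<otimes>\<^bsub>K\<^esub> k)"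
    if h: "h \<in> H" for h
  proof -
    have hG: "h \<in> carrier G" using h by simp
    obtain c where c: "c \<in> carrier K" "\<And>k. k \<in> carrier K \<Longrightarrow> \<rho> h (H, k) = (H, c \<otimes>\<^bsub>K\<^esub> k)"
      "t H \<otimes>\<^bsub>G\<^esub> val c = h \<otimes>\<^bsub>G\<^esub> t H"
      using cocycle[OF hG] HC stab[OF hG] h by metis
    then have "\<eta> h = c" by (simp add: \<eta>_def)
    then show "\<eta> h \<in> carrier K" "val (\<eta> h) = h" "\<And>k. k \<in> carrier K \<Longrightarrow> \<rho> h (H, k) = (H, \<eta> h \<otimes>\<^bsub>K\<^esub> k)"
      using c hG by (auto simp: tH)
  qed
  have \<eta>_mult: "\<eta> (g \<otimes>\<^bsub>G\<^esub> h) = \<eta> g \<otimes>\<^bsub>K\<^esub> \<eta> h" if "g \<in> H" "h \<in> H" for g h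
    using that \<eta>(3)[OF that(2), of "\<one>\<^bsub>K\<^esub>"] \<eta>(3)[OF that(1), of "\<eta> h"] \<eta>(1)
    by (simp add: \<eta>_def[of "g \<otimes>\<^bsub>G\<^esub> h"] \<rho>_simps(1))
  interpret GH: group "G\<lparr>carrier := H\<rparr>"
    by (rule G.subgroup_imp_group[OF assms(2)])
  have \<eta>_hom: "\<eta> \<in> hom (G\<lparr>carrier := H\<rparr>) K"
    by (rule homI) (auto simp: \<eta> \<eta>_mult)
  interpret \<eta>: group_hom "G\<lparr>carrier := H\<rparr>" K \<eta>
    using \<eta>_hom by (simp add: group_hom_def group_hom_axioms_def K.is_group GH.is_group)
  \<comment> \<open>Transversal words run inside the tree and leave the record trivial. Hence the
    loop of an edge outside the tree has the single free generator of this edge as its record, which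
    makes \<open>\<eta>\<close> surjective.\<close>
  have \<rho>_t: "\<rho> (t B) (H, \<one>\<^bsub>K\<^esub>) = (B, \<one>\<^bsub>K\<^esub>)" if "B \<in> C" for B
    using that
  proof (induction "len B" arbitrary: B rule: less_induct)
    case less
    show ?case
    proof (cases "B = H")
      case True
      then show ?thesis by (simp add: tH \<rho>_one)
    next
      case False
      from \<tau>[OF less.prems False] obtain a B' where a: "fst a \<in> X" "B' \<in> C" "len B' < len B"
        "B = ?letter a <#\<^bsub>G\<^esub> B'" "\<tau> B = a # \<tau> B'" by blast
      have IH: "\<rho> (t B') (H, \<one>\<^bsub>K\<^esub>) = (B', \<one>\<^bsub>K\<^esub>)" using less.hyps[OF a(3,2)] .
      have tB: "t B = ?letter a \<otimes>\<^bsub>G\<^esub> t B'" using a by (simp add: t_def)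
      have aG: "?letter a \<in> carrier G" using G.letter_closed[OF id a(1)] .
      define x where "x = fst a"
      have x: "x \<in> X" "x \<in> carrier G" using a X by (auto simp: x_def)
      have "\<rho> (?letter a) (B', \<one>\<^bsub>K\<^esub>) = (B, \<one>\<^bsub>K\<^esub>)"
      proof (cases "snd a")
        case True
        then have ax: "a = (x, True)" by (cases a) (simp add: x_def)
        then have B: "B = x <#\<^bsub>G\<^esub> B'" using a by (simp add: letter_def)
        then have "tree B' x" using a ax by (simp add: tree_def)
        then show ?thesis using ax x a B by (simp add: letter_def \<rho>(2) f_def \<zeta>_def)
      next
        case False
        then have ax: "a = (x, False)" by (cases a) (simp add: x_def)
        then have B: "x <#\<^bsub>G\<^esub> B = B'" using a x act_inv(2)[OF a(2)] by (simp add: letter_def)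
        then have "tree B x" using a ax by (simp add: tree_def)
        then have "\<rho> x (B, \<one>\<^bsub>K\<^esub>) = (B', \<one>\<^bsub>K\<^esub>)" using x less.prems B by (simp add: \<rho>(2) f_def \<zeta>_def)
        then show ?thesis using \<rho>_simps(4)[OF x(2), of "(B, \<one>\<^bsub>K\<^esub>)"] ax by (simp add: letter_def)
      qed
      then show ?thesis
        using IH aG t_closed[OF a(2)] by (simp add: tB \<rho>_simps(1))
    qed
  qed
  have "carrier K \<subseteq> \<eta> ` H"
  proof -
    have "word_class Z {} [((B, x), True)] \<in> \<eta> ` H" if "(B, x) \<in> Z" for B x
    proof -
      have B: "B \<in> C" and x: "x \<in> X" "x \<in> carrier G" and nt: "\<not> tree B x" using that X by (auto simp: Z_def)
      let ?B = "x <#\<^bsub>G\<^esub> B" and ?k = "word_class Z {} [((B, x), True)]"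
      have B': "?B \<in> C" using actC[OF B x(2)] .
      have k: "?k \<in> carrier K" using \<zeta>_closed[OF B x(1)] nt by (simp add: \<zeta>_def)
      define h where "h = inv\<^bsub>G\<^esub> t ?B \<otimes>\<^bsub>G\<^esub> (x \<otimes>\<^bsub>G\<^esub> t B)"
      have t: "t B \<in> carrier G" "t ?B \<in> carrier G" using t_closed B B' by auto
      have "\<rho> (x \<otimes>\<^bsub>G\<^esub> t B) (H, \<one>\<^bsub>K\<^esub>) = (?B, ?k)"
        using x t B k nt by (simp add: \<rho>_simps(1) \<rho>_t \<rho>(2) f_def \<zeta>_def)
      moreover have "\<rho> (t ?B) (H, ?k) = (?B, ?k)"
      proof -
        obtain c where c: "c \<in> carrier K" "\<And>k. k \<in> carrier K \<Longrightarrow> \<rho> (t ?B) (H, k) = (t ?B <#\<^bsub>G\<^esub> H, c \<otimes>\<^bsub>K\<^esub> k)"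
          using cocycle[OF t(2)] HC by metis
        then have "c = \<one>\<^bsub>K\<^esub>" "t ?B <#\<^bsub>G\<^esub> H = ?B" using \<rho>_t[OF B'] by auto
        then show ?thesis using c k by simp
      qed
      ultimately have "\<rho> h (H, \<one>\<^bsub>K\<^esub>) = (H, ?k)"
        using \<rho>_simps(4)[OF t(2), of "(H, ?k)"] x t by (simp add: h_def \<rho>_simps(1))
      moreover have h: "h \<in> carrier G" using x t by (simp add: h_def)
      then obtain c where "\<rho> h (H, \<one>\<^bsub>K\<^esub>) = (h <#\<^bsub>G\<^esub> H, c)"
        using cocycle[OF h] HC by blast
      ultimately have "h <#\<^bsub>G\<^esub> H = H" "\<eta> h = ?k" by (auto simp: \<eta>_def)
      then show ?thesis using stab[OF h] by blast
    qed
    moreover have "subgroup (\<eta> ` H) K"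
      using \<eta>.img_is_subgroup by simp
    ultimately have "generate K ((\<lambda>z. word_class Z {} [(z, True)]) ` Z) \<subseteq> \<eta> ` H"
      by (intro K.generate_subgroup_incl) auto
    then show ?thesis
      using generate_presented_group[of Z "{}"] by (simp add: K_def)
  qed
  moreover have "inj_on \<eta> H"
    using \<eta>(2) by (rule inj_on_inverseI)
  ultimately have "\<eta> \<in> iso (G\<lparr>carrier := H\<rparr>) K"
    using \<eta>_hom \<eta>(1) by (auto simp: iso_def bij_betw_def)
  from GH.iso_set_sym[OF this] show ?thesis
    unfolding K_def by (rule is_free_groupI[OF GH.is_group])
qed

lemma is_free_group_if_embeds:
  assumes "group G" "group F" "is_free_group F" "\<phi> \<in> hom G F" "inj_on \<phi> (carrier G)"
  shows "is_free_group G"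
proof -
  interpret group_hom G F \<phi>
    using assms by (simp add: group_hom_def group_hom_axioms_def)
  have "is_free_group (F\<lparr>carrier := \<phi> ` carrier G\<rparr>)"
    by (rule nielsen_schreier[OF assms(3) img_is_subgroup])
  then obtain X where "has_presentation (F\<lparr>carrier := \<phi> ` carrier G\<rparr>) X {}"
    unfolding is_free_group_def by blast
  then obtain h where h: "h \<in> iso (free_group X) (F\<lparr>carrier := \<phi> ` carrier G\<rparr>)"
    unfolding has_presentation_def by blast
  have "\<phi> \<in> iso G (F\<lparr>carrier := \<phi> ` carrier G\<rparr>)"
    using assms by (auto simp: iso_def hom_def bij_betw_def)
  from G.iso_set_sym[OF this] have "inv_into (carrier G) \<phi> \<in> iso (F\<lparr>carrier := \<phi> ` carrier G\<rparr>) G" .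
  from iso_set_trans[OF h this] show ?thesis
    by (rule is_free_groupI[OF assms(1)])
qed

section \<open>Coxeter groups: exchange, infinite order, dihedral cosets\<close>

section \<open>Coxeter systems\<close>

lemma (in group) ev_coxeter_relator:
  assumes "f s \<in> carrier G" "f t \<in> carrier G"
  shows "ev G f (concat (replicate n [(s, True), (t, True)])) = (f s \<otimes> f t) [^] n"
proof (induction n)
  case (Suc n)
  have "f s \<otimes> (f t \<otimes> (f s \<otimes> f t) [^] n) = (f s \<otimes> f t) \<otimes> (f s \<otimes> f t) [^] n"
    using assms by (simp add: m_assoc)
  also have "\<dots> = (f s \<otimes> f t) [^] Suc n"
    using assms by (intro nat_pow_Suc2[symmetric]) simp
  finally show ?case using Suc by (simp add: letter_def)
qed simp

lemma perm_group_pow: "p [^]\<^bsub>perm_group A\<^esub> (n::nat) = p ^^ n"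
proof -
  interpret group "perm_group A" by (rule group_perm_group)
  show ?thesis by (induction n) (auto simp: nat_pow_def perm_group_def funpow_swap1 fun_eq_iff)
qed

lemma involution_permutes: "(\<And>x. f (f x) = x) \<Longrightarrow> f permutes UNIV"
  by (metis bij_imp_permutes involuntory_imp_bij UNIV_I)

text \<open>For a relation \<open>(s t)^n\<close> the two halves of the \<open>2 n\<close> letters
  meet a given reflection equally often, so its sign changes cancel.\<close>

lemma card_periodic_even:
  assumes "\<And>j::nat. Q (j + n) = Q j"
  shows "even (card {j. j < 2 * n \<and> Q j})"
proof -
  have "{j. j < 2 * n \<and> Q j} = {j. j < n \<and> Q j} \<union> (\<lambda>j. j + n) ` {j. j < n \<and> Q j}"
  proof (intro Set.set_eqI iffI)
    fix j assume j: "j \<in> {j. j < 2 * n \<and> Q j}"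
    show "j \<in> {j. j < n \<and> Q j} \<union> (\<lambda>j. j + n) ` {j. j < n \<and> Q j}"
    proof (cases "j < n")
      case False
      then have "j = (j - n) + n" "j - n < n" using j by auto
      then show ?thesis using j assms[of "j - n"] by (auto intro!: image_eqI[of _ _ "j - n"])
    qed (use j in auto)
  qed (auto simp: assms)
  moreover have "card ((\<lambda>j. j + n) ` {j. j < n \<and> Q j}) = card {j. j < n \<and> Q j}"
    by (intro card_image) (auto simp: inj_on_def)
  moreover have "card ({j. j < n \<and> Q j} \<union> (\<lambda>j. j + n) ` {j. j < n \<and> Q j}) =
      card {j. j < n \<and> Q j} + card ((\<lambda>j. j + n) ` {j. j < n \<and> Q j})"
    by (intro card_Un_disjoint) auto
  ultimately show ?thesis by simp
qed

context coxeter_system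
begin

lemma in_carrier [simp, intro]: "s \<in> S \<Longrightarrow> s \<in> carrier W"
  using gens_closed by auto

lemma coxeter_hom:
  assumes "group K" "\<And>s. s \<in> S \<Longrightarrow> f s \<in> carrier K"
    and "\<And>s t n. s \<in> S \<Longrightarrow> t \<in> S \<Longrightarrow> m s t = enat n \<Longrightarrow> (f s \<otimes>\<^bsub>K\<^esub> f t) [^]\<^bsub>K\<^esub> n = \<one>\<^bsub>K\<^esub>"
  obtains \<phi> where "\<phi> \<in> hom W K" "\<And>s. s \<in> S \<Longrightarrow> \<phi> s = f s"
proof -
  interpret K: group K by fact
  have f: "f \<in> S \<rightarrow> carrier K" using assms(2) by auto
  have "ev K f r = \<one>\<^bsub>K\<^esub>" if r: "r \<in> coxeter_relators S m" for r
  proof -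
    obtain s t where st: "s \<in> S" "t \<in> S" "m s t < \<infinity>"
      "r = concat (replicate (the_enat (m s t)) [(s, True), (t, True)])"
      using r unfolding coxeter_relators_def by blast
    then obtain n where "m s t = enat n" by (cases "m s t") auto
    with st show ?thesis
      using K.ev_coxeter_relator[of f s t n] assms(2,3) by simp
  qed
  then show ?thesis
    using presentation_hom[OF presentation is_group assms(1) f] that by blast
qed

lemma coxeter_relation:
  assumes "s \<in> S" "t \<in> S" "m s t = enat n"
  shows "(s \<otimes> t) [^] n = \<one>"
proof -
  let ?r = "concat (replicate n [(s, True), (t, True)])"
  have r: "?r \<in> words_over S"
    using assms(1,2) by (induction n) auto
  have "?r \<in> coxeter_relators S m"
    unfolding coxeter_relators_def using assms by (intro CollectI exI[of _ s] exI[of _ t]) simp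
  then have "word_eq S (coxeter_relators S m) ?r []"
    using word_eq.relator[of ?r "coxeter_relators S m" "[]" "[]" S] r by simp
  then have "ev W (\<lambda>x. x) ?r = \<one>"
    using has_presentationE(3)[OF presentation is_group r, of "[]"] by simp
  then show ?thesis
    using ev_coxeter_relator[of "\<lambda>x. x" s t n] assms by simp
qed

lemma involution [simp]: "s \<in> S \<Longrightarrow> s \<otimes> s = \<one>"
  using coxeter_relation[of s s 1] m_eq_1_iff[of s s] by (simp add: one_enat_def)

lemma inv_gen [simp]: "s \<in> S \<Longrightarrow> inv s = s"
  using inv_equality[of s s] by auto

lemma gen_cancel [simp]: "s \<in> S \<Longrightarrow> x \<in> carrier W \<Longrightarrow> s \<otimes> (s \<otimes> x) = x"
  "s \<in> S \<Longrightarrow> x \<in> carrier W \<Longrightarrow> x \<otimes> s \<otimes> s = x"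
  by (simp add: m_assoc[symmetric]) (simp add: m_assoc)

definition wprod :: "'a list \<Rightarrow> 'a" where
  "wprod xs = foldr (\<otimes>) xs \<one>"

lemma wprod_simps [simp]: "wprod [] = \<one>" "wprod (x # xs) = x \<otimes> wprod xs"
  by (simp_all add: wprod_def)

lemma wprod_closed [simp]: "set xs \<subseteq> S \<Longrightarrow> wprod xs \<in> carrier W"
  by (induction xs) auto

lemma wprod_append: "set xs \<subseteq> S \<Longrightarrow> set ys \<subseteq> S \<Longrightarrow> wprod (xs @ ys) = wprod xs \<otimes> wprod ys"
  by (induction xs) (auto simp: m_assoc)

lemma generate_wprod:
  assumes "K \<subseteq> S"
  shows "generate W K = wprod ` lists K"
proof
  have K: "K \<subseteq> carrier W" using assms by auto
  show "generate W K \<subseteq> wprod ` lists K"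
  proof
    fix g assume "g \<in> generate W K"
    with K show "g \<in> wprod ` lists K"
    proof (induction rule: generate_left_induct)
      case one
      show ?case by (rule image_eqI[of _ _ "[]"]) auto
    next
      case (gen x g)
      then obtain xs where "xs \<in> lists K" "g = wprod xs" by auto
      then show ?case using gen(1) by (intro image_eqI[of _ _ "x # xs"]) auto
    next
      case (inv x g)
      then obtain xs where "xs \<in> lists K" "g = wprod xs" by auto
      then show ?case using inv(1) assms by (intro image_eqI[of _ _ "x # xs"]) auto
    qed
  qed
  have "wprod xs \<in> generate W K" if "xs \<in> lists K" for xs
    using that by (induction xs) (auto intro: generate.intros)
  then show "wprod ` lists K \<subseteq> generate W K" by auto
qed

lemma carrier_wprod: "w \<in> carrier W \<Longrightarrow> \<exists>xs. set xs \<subseteq> S \<and> w = wprod xs"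
  using generate_wprod[of S] generates by (auto simp: image_iff in_lists_conv_set subset_iff)

text \<open>The sign of a generator under this action records when the reflection it meets is the generator
  itself, so that the sign of \<open>w\<close> at \<open>r\<close> is the parity of the number of letters of a word for \<open>w\<close>
  whose removal turns it into a word for \<open>w \<otimes> r\<close>.\<close>

definition reflect :: "'a \<Rightarrow> 'a \<times> bool \<Rightarrow> 'a \<times> bool" where
  "reflect s = (\<lambda>(r, b). if r \<in> carrier W then (s \<otimes> r \<otimes> s, b \<noteq> (r = s)) else (r, b))"

lemma conj_eq_iff:
  assumes "s \<in> S" "x \<in> carrier W" "y \<in> carrier W"
  shows "s \<otimes> x \<otimes> s = y \<longleftrightarrow> x = s \<otimes> y \<otimes> s"
proof -
  have "s \<otimes> (s \<otimes> z \<otimes> s) \<otimes> s = z" if "z \<in> carrier W" for z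
    using that assms(1) by (simp add: m_assoc)
  then show ?thesis using assms by metis
qed

lemma reflect_reflect: "s \<in> S \<Longrightarrow> reflect s (reflect s p) = p"
  using conj_eq_iff[of s "fst p" s] conj_eq_iff[of s "fst p" "s \<otimes> fst p \<otimes> s"]
  by (cases p) (auto simp: reflect_def)

lemma pow_mult_swap:
  assumes "s \<in> S" "t \<in> S"
  shows "(s \<otimes> t) [^] (k::nat) \<otimes> s = s \<otimes> (t \<otimes> s) [^] k"
proof (induction k)
  case (Suc k)
  have "(s \<otimes> t) [^] Suc k \<otimes> s = (s \<otimes> t) [^] k \<otimes> s \<otimes> (t \<otimes> s)"
    using assms by (simp add: m_assoc)
  also have "\<dots> = s \<otimes> (t \<otimes> s) [^] Suc k"
    using assms by (simp add: Suc m_assoc)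
  finally show ?case .
qed (use assms in simp)

lemma pow_mult_inverse:
  assumes "s \<in> S" "t \<in> S"
  shows "(s \<otimes> t) [^] (k::nat) \<otimes> (t \<otimes> s) [^] k = \<one>"
proof -
  have "inv (s \<otimes> t) = t \<otimes> s"
    using assms by (simp add: inv_mult_group)
  then have "(t \<otimes> s) [^] k = inv ((s \<otimes> t) [^] k)"
    using assms by (metis in_carrier m_closed nat_pow_inv)
  then show ?thesis using assms by simp
qed

text \<open>The letters act from the right end of the word. Step \<open>j\<close> changes the sign
  exactly if \<open>r\<close> is the reflection \<open>(t s)^j t\<close>, because the preceding
  letters conjugate this reflection to the letter of that step.\<close>

lemma reflect_funpow:
  assumes s: "s \<in> S" and t: "t \<in> S" and r: "r \<in> carrier W"
  shows "((reflect s \<circ> reflect t) ^^ k) (r, b) =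
    ((s \<otimes> t) [^] k \<otimes> r \<otimes> (t \<otimes> s) [^] k, b \<noteq> odd (card {j. j < 2 * k \<and> r = (t \<otimes> s) [^] j \<otimes> t}))"
proof (induction k)
  case 0
  then show ?case using r by simp
next
  case (Suc k)
  let ?Q = "\<lambda>j. r = (t \<otimes> s) [^] j \<otimes> t"
  define r' where "r' = (s \<otimes> t) [^] k \<otimes> r \<otimes> (t \<otimes> s) [^] k"
  have st: "s \<in> carrier W" "t \<in> carrier W" using s t by auto
  have r': "r' \<in> carrier W" using r st by (simp add: r'_def)
  have card_Suc: "odd (card {j. j < Suc n \<and> ?Q j}) = (odd (card {j. j < n \<and> ?Q j}) \<noteq> ?Q n)" for n
  proof -
    have "{j. j < Suc n \<and> ?Q j} = (if ?Q n then insert n {j. j < n \<and> ?Q j} else {j. j < n \<and> ?Q j})"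
      by (auto simp: less_Suc_eq)
    then show ?thesis by auto
  qed
  have conj: "r' = x \<longleftrightarrow> r = (t \<otimes> s) [^] k \<otimes> x \<otimes> (s \<otimes> t) [^] k" if "x \<in> carrier W" for x
  proof -
    have 1: "(t \<otimes> s) [^] k \<otimes> ((s \<otimes> t) [^] k \<otimes> z) = z" "(s \<otimes> t) [^] k \<otimes> ((t \<otimes> s) [^] k \<otimes> z) = z"
      if "z \<in> carrier W" for z
      using that st pow_mult_inverse[OF s t, of k] pow_mult_inverse[OF t s, of k]
      by (simp_all flip: m_assoc)
    show ?thesis
      unfolding r'_def using 1 that st r pow_mult_inverse[OF s t, of k] pow_mult_inverse[OF t s, of k]
      by (auto simp: m_assoc)
  qed
  have Q1: "r' = t \<longleftrightarrow> ?Q (2 * k)"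
  proof -
    have "(t \<otimes> s) [^] k \<otimes> t \<otimes> (s \<otimes> t) [^] k = (t \<otimes> s) [^] k \<otimes> ((t \<otimes> s) [^] k \<otimes> t)"
      using st by (simp add: m_assoc pow_mult_swap[OF t s, symmetric])
    also have "\<dots> = (t \<otimes> s) [^] (2 * k) \<otimes> t"
      using st by (simp add: mult_2 nat_pow_mult[symmetric] m_assoc)
    finally show ?thesis using conj[OF st(2)] by simp
  qed
  have Q2: "t \<otimes> r' \<otimes> t = s \<longleftrightarrow> ?Q (Suc (2 * k))"
  proof -
    have "(t \<otimes> s) [^] k \<otimes> (t \<otimes> s \<otimes> t) \<otimes> (s \<otimes> t) [^] k = (t \<otimes> s) [^] k \<otimes> (t \<otimes> s) \<otimes> ((t \<otimes> s) [^] k \<otimes> t)"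
      using st by (simp add: m_assoc pow_mult_swap[OF t s, symmetric])
    also have "\<dots> = (t \<otimes> s) [^] (Suc k + k) \<otimes> t"
      using st nat_pow_mult[of "t \<otimes> s" "Suc k" k, symmetric] by (simp add: m_assoc del: add_Suc)
    also have "Suc k + k = Suc (2 * k)" by simp
    finally show ?thesis
      using conj_eq_iff[OF t r' st(1)] conj[of "t \<otimes> s \<otimes> t"] st by simp
  qed
  have "((reflect s \<circ> reflect t) ^^ Suc k) (r, b) = reflect s (reflect t (r', b \<noteq> odd (card {j. j < 2 * k \<and> ?Q j})))"
    by (simp only: funpow.simps o_apply Suc r'_def)
  also have "\<dots> = (s \<otimes> (t \<otimes> r' \<otimes> t) \<otimes> s, b \<noteq> odd (card {j. j < 2 * Suc k \<and> ?Q j}))"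
    using r' st card_Suc[of "2 * k"] card_Suc[of "Suc (2 * k)"]
    by (simp add: reflect_def Q1 Q2) blast
  also have "s \<otimes> (t \<otimes> r' \<otimes> t) \<otimes> s = (s \<otimes> t) [^] Suc k \<otimes> r \<otimes> (t \<otimes> s) [^] Suc k"
    unfolding r'_def nat_pow_Suc2[OF m_closed[OF st]] using st r by (simp add: m_assoc)
  finally show ?case .
qed

lemma reflect_hom:
  obtains \<rho> where "\<rho> \<in> hom W (perm_group UNIV)" "\<And>s. s \<in> S \<Longrightarrow> \<rho> s = reflect s"
proof (rule coxeter_hom[OF group_perm_group, of reflect UNIV])
  fix s t n assume st: "s \<in> S" "t \<in> S" "m s t = enat n"
  have 1: "(s \<otimes> t) [^] n = \<one>" "(t \<otimes> s) [^] n = \<one>"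
    using coxeter_relation[of s t n] coxeter_relation[of t s n] st m_sym by auto
  have "(t \<otimes> s) [^] (j + n) = (t \<otimes> s) [^] j" for j
    using 1 st by (simp flip: nat_pow_mult)
  then have "even (card {j. j < 2 * n \<and> r = (t \<otimes> s) [^] j \<otimes> t})" for r
    by (intro card_periodic_even) auto
  then have "((reflect s \<circ> reflect t) ^^ n) (r, b) = (r, b)" for r b
  proof (cases "r \<in> carrier W")
    case False
    then show ?thesis by (induction n) (auto simp: reflect_def)
  qed (simp add: reflect_funpow[OF st(1,2)] 1)
  then show "(reflect s \<otimes>\<^bsub>perm_group UNIV\<^esub> reflect t) [^]\<^bsub>perm_group UNIV\<^esub> n = \<one>\<^bsub>perm_group UNIV\<^esub>"
    by (auto simp: perm_group_pow fun_eq_iff)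
qed (auto intro: involution_permutes reflect_reflect that)

definition del :: "nat \<Rightarrow> 'b list \<Rightarrow> 'b list" where
  "del i xs = take i xs @ drop (Suc i) xs"

lemma del_simps [simp]: "del 0 (x # xs) = xs" "del (Suc i) (x # xs) = x # del i xs"
  by (simp_all add: del_def)

lemma set_del: "set (del i xs) \<subseteq> set xs"
  by (auto simp: del_def dest: in_set_takeD in_set_dropD)

lemma length_del: "i < length xs \<Longrightarrow> length (del i xs) < length xs"
  by (simp add: del_def)

definition len :: "'a \<Rightarrow> nat" where
  "len w = (LEAST n. \<exists>xs. set xs \<subseteq> S \<and> w = wprod xs \<and> length xs = n)"

lemma len_le: "set xs \<subseteq> S \<Longrightarrow> len (wprod xs) \<le> length xs"
  unfolding len_def by (rule Least_le) auto

lemma reduced_word: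
  assumes "w \<in> carrier W"
  obtains xs where "set xs \<subseteq> S" "w = wprod xs" "length xs = len w"
proof -
  have "\<exists>n xs. set xs \<subseteq> S \<and> w = wprod xs \<and> length xs = n"
    using carrier_wprod[OF assms] by blast
  from LeastI_ex[OF this] show ?thesis
    unfolding len_def[symmetric] using that by blast
qed

text \<open>If \<open>w\<close> changes the sign at \<open>s\<close>, then a letter can be deleted
  from any word for \<open>w\<close>, so \<open>w \<otimes> s\<close> is shorter. Otherwise
  \<open>w \<otimes> s\<close> changes it, since \<open>s\<close> flips the sign at itself, and the
  same argument for \<open>w \<otimes> s\<close> shows that \<open>w\<close> is shorter.\<close>

lemma exchange_dichotomy:
  assumes "w \<in> carrier W" "s \<in> S"
  shows "(len w < len (w \<otimes> s)) \<or> (len (w \<otimes> s) < len w \<and>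
    (\<forall>xs. set xs \<subseteq> S \<and> w = wprod xs \<longrightarrow> (\<exists>i<length xs. w \<otimes> s = wprod (del i xs))))"
proof -
  obtain \<rho> where \<rho>: "\<rho> \<in> hom W (perm_group UNIV)" "\<And>s. s \<in> S \<Longrightarrow> \<rho> s = reflect s"
    using reflect_hom by blast
  note \<rho>_simps = hom_perm_group_simps[OF is_group \<rho>(1)]
  \<comment> \<open>\<open>c\<close> is the change of sign at \<open>r\<close>. Only one implication
    is carried through the induction: a change of sign yields a deletable letter.\<close>
  have main: "\<exists>c. (\<forall>b. \<rho> (wprod xs) (r, b) = (wprod xs \<otimes> r \<otimes> inv (wprod xs), b \<noteq> c)) \<and>
      (c \<longrightarrow> (\<exists>i<length xs. wprod xs \<otimes> r = wprod (del i xs)))"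
    if "set xs \<subseteq> S" "r \<in> carrier W" for xs r
    using that(1)
  proof (induction xs)
    case Nil
    show ?case using that \<rho>_simps(2)[OF one_closed] by (intro exI[of _ False]) auto
  next
    case (Cons x xs)
    then obtain c where c: "\<And>b. \<rho> (wprod xs) (r, b) = (wprod xs \<otimes> r \<otimes> inv (wprod xs), b \<noteq> c)"
      "c \<Longrightarrow> \<exists>i<length xs. wprod xs \<otimes> r = wprod (del i xs)" by auto
    have x: "x \<in> S" and xs: "set xs \<subseteq> S" using Cons.prems by auto
    define r' where "r' = wprod xs \<otimes> r \<otimes> inv (wprod xs)"
    have r': "r' \<in> carrier W" using xs that by (simp add: r'_def)
    have "\<rho> (wprod (x # xs)) (r, b) = (wprod (x # xs) \<otimes> r \<otimes> inv (wprod (x # xs)), b \<noteq> (c \<noteq> (r' = x)))" for b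
    proof -
      have "\<rho> (wprod (x # xs)) (r, b) = reflect x (r', b \<noteq> c)"
        using x xs by (simp add: \<rho>_simps(1) \<rho>(2) c(1) r'_def)
      also have "\<dots> = (x \<otimes> r' \<otimes> x, b \<noteq> (c \<noteq> (r' = x)))"
        using r' by (auto simp: reflect_def)
      also have "x \<otimes> r' \<otimes> x = wprod (x # xs) \<otimes> r \<otimes> inv (wprod (x # xs))"
        using x xs that by (simp add: r'_def inv_mult_group m_assoc)
      finally show ?thesis .
    qed
    moreover have "\<exists>i<length (x # xs). wprod (x # xs) \<otimes> r = wprod (del i (x # xs))" if c': "c \<noteq> (r' = x)"
    proof (cases c)
      case True
      from c(2)[OF this] obtain i where i: "i < length xs" "wprod xs \<otimes> r = wprod (del i xs)" by auto
      then show ?thesis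
        using x xs that \<open>r \<in> carrier W\<close> by (intro exI[of _ "Suc i"]) (simp add: m_assoc)
    next
      case False
      then have "x = r'" using c' by simp
      then have "x \<otimes> wprod xs = wprod xs \<otimes> r"
        using xs \<open>r \<in> carrier W\<close> by (simp add: r'_def m_assoc)
      moreover have "wprod (x # xs) \<otimes> r = x \<otimes> (wprod xs \<otimes> r)"
        using x xs \<open>r \<in> carrier W\<close> by (simp add: m_assoc)
      ultimately have "wprod (x # xs) \<otimes> r = wprod xs"
        using gen_cancel(1)[OF x wprod_closed[OF xs]] by simp
      then show ?thesis by (intro exI[of _ 0]) simp
    qed
    ultimately show ?case by blast
  qed
  have flip_less: "len (v \<otimes> s) < len v" if v: "v \<in> carrier W" "snd (\<rho> v (s, False))" for v
  proof -
    obtain xs where xs: "set xs \<subseteq> S" "v = wprod xs" "length xs = len v"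
      using reduced_word[OF v(1)] by blast
    then obtain i where "i < length xs" "v \<otimes> s = wprod (del i xs)"
      using main[OF xs(1), of s] assms(2) v(2) by auto
    then show ?thesis
      using length_del[of i xs] len_le[OF subset_trans[OF set_del xs(1)], of i] xs(3) by simp
  qed
  show ?thesis
  proof (cases "snd (\<rho> w (s, False))")
    case True
    have "\<exists>i<length xs. w \<otimes> s = wprod (del i xs)" if "set xs \<subseteq> S" "w = wprod xs" for xs
      using main[OF that(1), of s] assms(2) that(2) True by auto
    then show ?thesis using flip_less[OF assms(1) True] by blast
  next
    case False
    obtain xs where xs: "set xs \<subseteq> S" "w = wprod xs"
      using carrier_wprod[OF assms(1)] by blast
    have "\<rho> (w \<otimes> s) (s, False) = \<rho> w (s, True)"
      using assms by (simp add: \<rho>_simps(1) \<rho>(2) reflect_def)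
    then have "snd (\<rho> (w \<otimes> s) (s, False))"
      using main[OF xs(1), of s] assms(2) xs False by auto
    from flip_less[OF _ this] show ?thesis
      using assms by simp
  qed
qed

lemma len_less_iff: "w \<in> carrier W \<Longrightarrow> s \<in> S \<Longrightarrow> \<not> len w < len (w \<otimes> s) \<longleftrightarrow> len (w \<otimes> s) < len w"
  using exchange_dichotomy by fastforce

lemma len_mult_le: "w \<in> carrier W \<Longrightarrow> s \<in> S \<Longrightarrow> len (w \<otimes> s) \<le> Suc (len w)"
proof -
  assume ws: "w \<in> carrier W" "s \<in> S"
  obtain xs where xs: "set xs \<subseteq> S" "w = wprod xs" "length xs = len w"
    using reduced_word[OF ws(1)] by blast
  then show ?thesis using len_le[of "xs @ [s]"] ws by (simp add: wprod_append)
qed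

subsection \<open>The geometric representation\<close>

text \<open>The Tits form on the basis of simple roots indexed by \<open>S\<close>. Vectors are
  coordinate functions, \<open>pairing s\<close> is the form against the root of \<open>s\<close>,
  and \<open>georefl s\<close> is the reflection in this root.\<close>

definition cform :: "'a \<Rightarrow> 'a \<Rightarrow> real" where
  "cform s t = (case m s t of enat n \<Rightarrow> - cos (pi / n) | \<infinity> \<Rightarrow> - 1)"

definition pairing :: "'a \<Rightarrow> ('a \<Rightarrow> real) \<Rightarrow> real" where
  "pairing s v = (\<Sum>x\<in>S. v x * cform s x)"

definition georefl :: "'a \<Rightarrow> ('a \<Rightarrow> real) \<Rightarrow> ('a \<Rightarrow> real)" where
  "georefl s v = v(s := v s - 2 * pairing s v)"

lemma cform_sym: "s \<in> S \<Longrightarrow> t \<in> S \<Longrightarrow> cform s t = cform t s"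
  using m_sym[of s t] by (simp add: cform_def)

lemma cform_self [simp]: "s \<in> S \<Longrightarrow> cform s s = 1"
  using m_eq_1_iff[of s s] by (simp add: cform_def one_enat_def)

lemma pairing_update:
  assumes "finite S" "s \<in> S" "t \<in> S" "s \<noteq> t" "\<And>x. x \<noteq> s \<Longrightarrow> x \<noteq> t \<Longrightarrow> v' x = v x"
  shows "pairing r v' = pairing r v + (v' s - v s) * cform r s + (v' t - v t) * cform r t"
proof -
  have "pairing r v' - pairing r v = (\<Sum>x\<in>S. (v' x - v x) * cform r x)"
    by (simp add: pairing_def left_diff_distrib sum_subtractf)
  also have "\<dots> = (\<Sum>x\<in>{s, t}. (v' x - v x) * cform r x)"
    using assms by (intro sum.mono_neutral_right) auto
  finally show ?thesis using assms(4) by simp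
qed

lemma pairing_georefl:
  assumes "finite S" "s \<in> S"
  shows "pairing r (georefl s v) = pairing r v - 2 * pairing s v * cform r s"
proof -
  have "pairing r (georefl s v) - pairing r v = (\<Sum>x\<in>S. (georefl s v x - v x) * cform r x)"
    by (simp add: pairing_def left_diff_distrib sum_subtractf)
  also have "\<dots> = (\<Sum>x\<in>{s}. (georefl s v x - v x) * cform r x)"
    using assms by (intro sum.mono_neutral_right) (auto simp: georefl_def)
  finally show ?thesis by (simp add: georefl_def)
qed

lemma georefl_georefl: "finite S \<Longrightarrow> s \<in> S \<Longrightarrow> georefl s (georefl s v) = v"
  using pairing_georefl[of s s v] by (auto simp: georefl_def fun_eq_iff)

lemma georefl_funpow_outside:
  "x \<noteq> s \<Longrightarrow> x \<noteq> t \<Longrightarrow> ((georefl s \<circ> georefl t) ^^ k) v x = v x"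
  by (induction k) (auto simp: georefl_def)

text \<open>On the plane spanned by the two roots, \<open>georefl s \<circ> georefl t\<close> is the rotation by twice the
  angle \<open>pi / n\<close>; \<open>\<zeta>\<close> is the orthogonal projection to this plane in a complex coordinate.\<close>

lemma georefl_relation:
  assumes fin: "finite S" and s: "s \<in> S" and t: "t \<in> S" and m: "m s t = enat n"
  shows "(georefl s \<circ> georefl t) ^^ n = id"
proof (cases "s = t")
  case True
  then show ?thesis
    using m m_eq_1_iff[OF s t] georefl_georefl[OF fin s] by (auto simp: one_enat_def fun_eq_iff)
next
  case False
  define \<theta> where "\<theta> = pi / n"
  define c where "c = cos \<theta>"
  define d where "d = sin \<theta>"
  have "n \<noteq> 0" "n \<noteq> 1"
    using m m_nonzero[OF s t] m_eq_1_iff[OF s t] False by (auto simp: zero_enat_def one_enat_def)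
  then have n: "n \<ge> 2" by simp
  have "0 < \<theta>" "\<theta> < pi" using n by (auto simp: \<theta>_def field_simps)
  then have d: "d > 0" unfolding d_def by (rule sin_gt_zero)
  have dc: "d * d = 1 - c * c"
    using sin_cos_squared_add[of \<theta>] by (simp add: c_def d_def power2_eq_square)
  have st: "cform s t = - c" "cform t s = - c"
    using m cform_sym[OF s t] by (simp_all add: cform_def c_def \<theta>_def)
  define g where "g = georefl s \<circ> georefl t"
  \<comment> \<open>With \<open>\<alpha>\<close> and \<open>\<beta>\<close> the roots of
    \<open>s\<close> and \<open>t\<close>, an orthonormal basis of their plane is
    \<open>\<alpha>\<close>, \<open>(\<beta> + c \<alpha>) / d\<close>. The real part is the pairing
    with the first vector and the imaginary part the negated pairing with the second.\<close>
  define \<zeta> where "\<zeta> v = Complex (pairing s v) (- (pairing t v + c * pairing s v) / d)" for v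
  define z where "z = cis (- 2 * \<theta>)"
  have step: "\<zeta> (g v) = z * \<zeta> v" for v
  proof -
    define p where "p = pairing s v"
    define q where "q = pairing t v"
    have p': "pairing s (g v) = - p - 2 * c * q"
      using s t fin by (simp add: g_def pairing_georefl st p_def q_def)
    have q': "pairing t (g v) = - q + 2 * c * p + 4 * c * c * q"
      using s t fin by (simp add: g_def pairing_georefl st p_def q_def algebra_simps)
    have z: "Re z = 2 * c * c - 1" "Im z = - 2 * d * c"
      using cos_double_cos[of \<theta>] sin_double[of \<theta>] by (simp_all add: z_def c_def d_def power2_eq_square)
    have \<zeta>_v: "Re (\<zeta> v) = p" "Im (\<zeta> v) = - (q + c * p) / d"
      by (simp_all add: \<zeta>_def p_def q_def)
    have re: "Re (\<zeta> (g v)) = Re (z * \<zeta> v)"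
    proof -
      have "Re (z * \<zeta> v) = (2 * c * c - 1) * p - 2 * c * (q + c * p)"
        using d by (simp add: z \<zeta>_v) (simp add: algebra_simps)
      also have "\<dots> = - p - 2 * c * q" by (simp add: algebra_simps)
      finally show ?thesis by (simp add: \<zeta>_def p')
    qed
    have "Im (z * \<zeta> v) * d = - 2 * (d * d) * c * p - (2 * c * c - 1) * (q + c * p)"
      using d by (simp add: z \<zeta>_v) (simp add: field_simps)
    also have "\<dots> = - (- q + 2 * c * p + 4 * c * c * q + c * (- p - 2 * c * q))"
      unfolding dc by (simp add: algebra_simps)
    also have "\<dots> = Im (\<zeta> (g v)) * d"
      using d by (simp add: \<zeta>_def p' q')
    finally have "Im (\<zeta> (g v)) = Im (z * \<zeta> v)"
      using d by simp
    with re show ?thesis by (rule complex_eqI)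
  qed
  have pow: "\<zeta> ((g ^^ k) v) = z ^ k * \<zeta> v" for k v
  proof (induction k)
    case (Suc k)
    then show ?case using step[of "(g ^^ k) v"] by (simp only: funpow.simps o_apply power_Suc mult.assoc)
  qed simp
  have "z ^ n = 1"
  proof -
    have "real n * (- 2 * \<theta>) = - (2 * pi)" using n by (simp add: \<theta>_def)
    then have "z ^ n = cis (- (2 * pi))" unfolding z_def DeMoivre by (rule arg_cong)
    then show ?thesis by (simp add: complex_eq_iff)
  qed
  then have \<zeta>: "\<zeta> ((g ^^ n) v) = \<zeta> v" for v using pow by simp
  \<comment> \<open>The power changes only the coordinates at \<open>s\<close> and \<open>t\<close>
    and preserves both pairings. The form on the plane has determinant
    \<open>1 - c * c = d * d > 0\<close>, so the change is zero.\<close>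
  have "(g ^^ n) v = v" for v
  proof -
    define v' where "v' = (g ^^ n) v"
    define a where "a = v' s - v s"
    define b where "b = v' t - v t"
    have out: "v' x = v x" if "x \<noteq> s" "x \<noteq> t" for x
      using georefl_funpow_outside[OF that] by (simp add: v'_def g_def)
    have "pairing s v' = pairing s v" "pairing t v' = pairing t v"
      using \<zeta>[of v] d by (auto simp: \<zeta>_def v'_def)
    moreover have "pairing r v' = pairing r v + a * cform r s + b * cform r t" for r
      unfolding a_def b_def by (rule pairing_update[OF fin s t False]) (rule out)
    ultimately have "a - b * c = 0" "b - a * c = 0"
      using s t st by simp_all
    then have "a = b * c" "b = a * c" by simp_all
    then have "a * (1 - c * c) = 0" by (simp add: algebra_simps)
    then have "a = 0" using d dc by (metis mult_eq_0_iff less_irrefl)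
    with \<open>b = a * c\<close> have "b = 0" by simp
    have "v' x = v x" for x
      using out[of x] \<open>a = 0\<close> \<open>b = 0\<close> by (cases "x = s"; cases "x = t") (auto simp: a_def b_def)
    then show ?thesis by (auto simp: v'_def)
  qed
  then show ?thesis by (auto simp: g_def[symmetric])
qed

text \<open>With form value -1 the sum of the two roots is orthogonal to both, and
  \<open>s \<otimes> t\<close> acts on their plane as a shear: its \<open>j\<close>-th power adds
  \<open>2 j\<close> times this sum to the root of \<open>s\<close>.\<close>

lemma infinite_order:
  assumes fin: "finite S" and s: "s \<in> S" and t: "t \<in> S" and m: "m s t = \<infinity>" and "k > 0"
  shows "(s \<otimes> t) [^] (k::nat) \<noteq> \<one>"
proof
  assume one: "(s \<otimes> t) [^] k = \<one>"
  obtain \<rho> where \<rho>: "\<rho> \<in> hom W (perm_group UNIV)" "\<And>s. s \<in> S \<Longrightarrow> \<rho> s = georefl s"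
    by (rule coxeter_hom[OF group_perm_group, of georefl UNIV])
      (auto simp: perm_group_pow georefl_relation[OF fin] intro!: involution_permutes georefl_georefl[OF fin])
  interpret \<rho>: group_hom W "perm_group UNIV" \<rho>
    using \<rho>(1) by (simp add: group_hom_def group_hom_axioms_def group_perm_group is_group)
  have st: "s \<noteq> t" using m m_eq_1_iff[OF s t] by (auto simp: one_enat_def)
  have c: "cform s t = - 1" "cform t s = - 1" using m m_sym[OF s t] by (simp_all add: cform_def)
  define e where "e a b = (\<lambda>x. if x = s then a else if x = t then b else 0 :: real)" for a b
  have pair: "pairing r (e a b) = a * cform r s + b * cform r t" for r a b
    using pairing_update[OF fin s t st, of "e a b" "\<lambda>_. 0" r] st by (simp add: e_def pairing_def)
  have step: "(georefl s \<circ> georefl t) (e a b) = e (3 * a - 2 * b) (2 * a - b)" for a b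
  proof -
    have "georefl t (e a b) = e a (2 * a - b)"
      using st t by (auto simp: georefl_def pair c fun_eq_iff) (auto simp: e_def)
    moreover have "georefl s (e a (2 * a - b)) = e (3 * a - 2 * b) (2 * a - b)"
      using st s by (auto simp: georefl_def pair c fun_eq_iff) (auto simp: e_def)
    ultimately show ?thesis by simp
  qed
  have pow: "((georefl s \<circ> georefl t) ^^ j) (e 1 0) = e (2 * real j + 1) (2 * real j)" for j
  proof (induction j)
    case (Suc j)
    have "((georefl s \<circ> georefl t) ^^ Suc j) (e 1 0) = (georefl s \<circ> georefl t) (e (2 * real j + 1) (2 * real j))"
      by (simp only: funpow.simps o_apply Suc)
    then show ?case unfolding step by (simp only: of_nat_Suc) (simp add: algebra_simps)
  qed simp
  have "(georefl s \<circ> georefl t) ^^ k = \<rho> ((s \<otimes> t) [^] k)"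
    using s t by (simp add: \<rho>.hom_nat_pow \<rho>(2) perm_group_pow)
  then have "(georefl s \<circ> georefl t) ^^ k = id"
    using \<rho>.hom_one by (simp add: one)
  then have "e (2 * real k + 1) (2 * real k) = e 1 0"
    using pow[of k] by simp
  then have "2 * real k = 0"
    using st by (auto simp: e_def fun_eq_iff split: if_splits dest: spec[of _ t])
  then show False using \<open>k > 0\<close> by simp
qed

subsection \<open>Cosets of dihedral special subgroups\<close>

text \<open>Minimality is required among words in \<open>s\<close> and \<open>t\<close> only. That
  such words are also shortest in \<open>W\<close> is not assumed but comes out of
  \<open>dihedral_len_add\<close>.\<close>

definition dihedral_reduced :: "'a \<Rightarrow> 'a \<Rightarrow> 'a list \<Rightarrow> bool" where
  "dihedral_reduced s t xs \<longleftrightarrow> set xs \<subseteq> {s, t} \<and>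
    (\<forall>ys. set ys \<subseteq> {s, t} \<and> wprod ys = wprod xs \<longrightarrow> length xs \<le> length ys)"

lemma dihedral_reduced_exists:
  assumes "s \<in> S" "t \<in> S" "u \<in> generate W {s, t}"
  obtains xs where "dihedral_reduced s t xs" "u = wprod xs"
proof -
  have "{s, t} \<subseteq> S" using assms by simp
  from generate_wprod[OF this] obtain xs where "xs \<in> lists {s, t}" "u = wprod xs"
    using assms(3) by blast
  then have xs: "set xs \<subseteq> {s, t}" "u = wprod xs"
    by auto
  let ?P = "\<lambda>xs. set xs \<subseteq> {s, t} \<and> u = wprod xs"
  have P: "?P xs" using xs by simp
  from arg_min_natI[of ?P, OF P, of length] arg_min_nat_le[of ?P _ length]
  have "?P (arg_min length ?P)" "\<And>ys. ?P ys \<Longrightarrow> length (arg_min length ?P) \<le> length ys" by auto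
  then show ?thesis
    by (intro that[of "arg_min length ?P"]) (auto simp: dihedral_reduced_def)
qed

lemma dihedral_reduced_butlast:
  assumes "s \<in> S" "t \<in> S" "dihedral_reduced s t (xs @ [x])"
  shows "dihedral_reduced s t xs"
  unfolding dihedral_reduced_def
proof (intro conjI allI impI)
  have x: "set xs \<subseteq> {s, t}" "x \<in> {s, t}"
    using assms by (auto simp: dihedral_reduced_def)
  then show "set xs \<subseteq> {s, t}" by simp
  fix ys assume ys: "set ys \<subseteq> {s, t} \<and> wprod ys = wprod xs"
  have S: "set ys \<subseteq> S" "set xs \<subseteq> S" "x \<in> S" using ys x assms by auto
  then have "wprod (ys @ [x]) = wprod (xs @ [x])" using ys by (simp add: wprod_append)
  then have "length (xs @ [x]) \<le> length (ys @ [x])"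
    using assms(3) ys x unfolding dihedral_reduced_def by (metis Un_subset_iff empty_set empty_subsetI insert_subset list.simps(15) set_append)
  then show "length xs \<le> length ys" by simp
qed

text \<open>If a further letter of the dihedral word shortened the product, the exchange condition
  would delete a letter. Deleting it from the word for \<open>w\<close> gives a shorter element of
  the same coset, deleting it from the dihedral word contradicts that this word is reduced.\<close>

lemma dihedral_len_add:
  assumes s: "s \<in> S" and t: "t \<in> S" and w: "w \<in> carrier W"
    and min: "\<And>u. u \<in> generate W {s, t} \<Longrightarrow> len w \<le> len (w \<otimes> u)"
    and "dihedral_reduced s t xs"
  shows "len (w \<otimes> wprod xs) = len w + length xs"
  using assms(5)
proof (induction xs rule: rev_induct)
  case Nil
  then show ?case using w by simp
next
  case (snoc x ys)
  have red: "dihedral_reduced s t ys" by (rule dihedral_reduced_butlast[OF s t snoc.prems])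
  have ys: "set ys \<subseteq> {s, t}" "x \<in> {s, t}" using snoc.prems by (auto simp: dihedral_reduced_def)
  then have S: "set ys \<subseteq> S" "x \<in> S" using s t by auto
  have D: "subgroup (generate W {s, t}) W"
    using s t by (intro generate_is_subgroup) auto
  have inD: "wprod zs \<in> generate W {s, t}" if "set zs \<subseteq> {s, t}" for zs
    using that generate_wprod[of "{s, t}"] s t by (auto simp: in_lists_conv_set)
  have IH: "len (w \<otimes> wprod ys) = len w + length ys" by (rule snoc.IH[OF red])
  let ?v = "w \<otimes> wprod ys"
  have v: "?v \<in> carrier W" using w S by simp
  have eq: "w \<otimes> wprod (ys @ [x]) = ?v \<otimes> x"
    using w S by (simp add: wprod_append m_assoc)
  have "\<not> len (?v \<otimes> x) < len ?v"
  proof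
    assume less: "len (?v \<otimes> x) < len ?v"
    obtain zs where zs: "set zs \<subseteq> S" "w = wprod zs" "length zs = len w"
      using reduced_word[OF w] by blast
    have zsys: "set (zs @ ys) \<subseteq> S" "?v = wprod (zs @ ys)"
      using zs S by (auto simp: wprod_append)
    have "\<forall>xs. set xs \<subseteq> S \<and> ?v = wprod xs \<longrightarrow> (\<exists>i<length xs. ?v \<otimes> x = wprod (del i xs))"
      using exchange_dichotomy[OF v S(2)] less less_asym by blast
    then obtain i where i: "i < length (zs @ ys)" "?v \<otimes> x = wprod (del i (zs @ ys))"
      using zsys by blast
    show False
    proof (cases "i < length zs")
      case True
      then have "del i (zs @ ys) = del i zs @ ys" by (simp add: del_def)
      moreover have dz: "set (del i zs) \<subseteq> S" using set_del[of i zs] zs(1) by blast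
      ultimately have *: "?v \<otimes> x = wprod (del i zs) \<otimes> wprod ys"
        using i(2) S by (simp add: wprod_append)
      have "wprod (del i zs) = w \<otimes> (wprod ys \<otimes> x \<otimes> inv (wprod ys))"
      proof -
        have "wprod (del i zs) = wprod (del i zs) \<otimes> wprod ys \<otimes> inv (wprod ys)"
          using dz S by (simp add: m_assoc)
        also have "\<dots> = w \<otimes> (wprod ys \<otimes> x \<otimes> inv (wprod ys))"
          using *[symmetric] w S by (simp add: m_assoc)
        finally show ?thesis .
      qed
      moreover have "wprod ys \<otimes> x \<otimes> inv (wprod ys) \<in> generate W {s, t}"
        using inD[OF ys(1)] inD[of "[x]"] ys(2) S
        by (intro subgroup.m_closed[OF D] subgroup.m_inv_closed[OF D]) auto
      ultimately have "len w \<le> len (wprod (del i zs))"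
        using min by simp
      also have "\<dots> \<le> length (del i zs)" by (rule len_le[OF dz])
      also have "\<dots> < len w" using length_del[OF True] zs by simp
      finally show False by simp
    next
      case False
      define j where "j = i - length zs"
      have j: "j < length ys" using i(1) False by (simp add: j_def)
      have "del i (zs @ ys) = zs @ del j ys"
        using False by (simp add: del_def j_def Suc_diff_le)
      moreover have dy: "set (del j ys) \<subseteq> {s, t}" "set (del j ys) \<subseteq> S"
        using set_del[of j ys] ys(1) S(1) by blast+
      ultimately have "w \<otimes> wprod (ys @ [x]) = w \<otimes> wprod (del j ys)"
        using i(2) zs eq by (simp add: wprod_append)
      then have "wprod (del j ys) = wprod (ys @ [x])"
        using w S dy by simp
      then have "length (ys @ [x]) \<le> length (del j ys)"
        using snoc.prems dy unfolding dihedral_reduced_def by blast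
      then show False using length_del[OF j] by simp
    qed
  qed
  then have "len (?v \<otimes> x) > len ?v"
    using len_less_iff[OF v S(2)] by blast
  then show ?case
    using len_mult_le[OF v S(2)] IH eq by simp
qed

lemma dihedral_min_coset:
  assumes s: "s \<in> S" and t: "t \<in> S" and w: "w \<in> carrier W"
  obtains w' u where "w' \<in> carrier W" "u \<in> generate W {s, t}" "w = w' \<otimes> u"
    "\<And>u. u \<in> generate W {s, t} \<Longrightarrow> len w' \<le> len (w' \<otimes> u)"
proof -
  have sub: "{s, t} \<subseteq> carrier W" using s t by auto
  have D: "subgroup (generate W {s, t}) W"
    by (rule generate_is_subgroup[OF sub])
  define P where "P u \<longleftrightarrow> u \<in> generate W {s, t}" for u
  define u where "u = arg_min (\<lambda>u. len (w \<otimes> u)) P"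
  have u: "P u" "\<And>v. P v \<Longrightarrow> len (w \<otimes> u) \<le> len (w \<otimes> v)"
    using arg_min_natI[of P \<one> "\<lambda>u. len (w \<otimes> u)"] arg_min_nat_le[of P _ "\<lambda>u. len (w \<otimes> u)"] generate.one
    unfolding u_def P_def by auto
  have uW: "u \<in> carrier W" using u(1) generate_in_carrier[OF sub] by (simp add: P_def)
  show ?thesis
  proof (rule that[of "w \<otimes> u" "inv u"])
    show "w = w \<otimes> u \<otimes> inv u" using w uW by (simp add: m_assoc)
    show "inv u \<in> generate W {s, t}"
      using subgroup.m_inv_closed[OF D] u(1) by (simp add: P_def)
    fix v assume v: "v \<in> generate W {s, t}"
    then have "P (u \<otimes> v)" using subgroup.m_closed[OF D] u(1) by (simp add: P_def)
    moreover have "v \<in> carrier W" using v generate_in_carrier[OF sub] by blast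
    ultimately show "len (w \<otimes> u) \<le> len (w \<otimes> u \<otimes> v)"
      using u(2)[of "u \<otimes> v"] w uW by (simp add: m_assoc)
  qed (use w uW in simp)
qed

text \<open>\<open>w\<close> is the shortest element of its coset: otherwise the dihedral part of
  \<open>w\<close> would end in \<open>s\<close> or \<open>t\<close>, and this letter would be a
  descent.\<close>

lemma dihedral_coset_longer:
  assumes s: "s \<in> S" and t: "t \<in> S" and w: "w \<in> carrier W"
    and "len w < len (w \<otimes> s)" "len w < len (w \<otimes> t)"
    and v: "v \<in> generate W {s, t}" "v \<noteq> \<one>"
  shows "len w < len (w \<otimes> v)"
proof -
  obtain w' u where w': "w' \<in> carrier W" "u \<in> generate W {s, t}" "w = w' \<otimes> u"
    "\<And>u. u \<in> generate W {s, t} \<Longrightarrow> len w' \<le> len (w' \<otimes> u)"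
    using dihedral_min_coset[OF s t w] by blast
  obtain xs where xs: "dihedral_reduced s t xs" "u = wprod xs"
    using dihedral_reduced_exists[OF s t w'(2)] by blast
  have "xs = []"
  proof (rule ccontr)
    assume "xs \<noteq> []"
    then obtain ys x where yx: "xs = ys @ [x]" by (cases xs rule: rev_cases) auto
    have x: "x \<in> {s, t}" "set ys \<subseteq> {s, t}" using xs yx by (auto simp: dihedral_reduced_def)
    then have S: "x \<in> S" "set ys \<subseteq> S" using s t by auto
    have "len w = len w' + length xs"
      using dihedral_len_add[OF s t w'(1,4) xs(1)] xs w' by simp
    moreover have "w \<otimes> x = w' \<otimes> wprod ys"
      using w' xs yx S by (simp add: wprod_append m_assoc)
    then have "len (w \<otimes> x) = len w' + length ys"
      using dihedral_len_add[OF s t w'(1,4) dihedral_reduced_butlast[OF s t]] xs yx by simp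
    ultimately show False using assms(4,5) x yx by auto
  qed
  then have "w = w'" using xs w' by simp
  obtain ys where ys: "dihedral_reduced s t ys" "v = wprod ys"
    using dihedral_reduced_exists[OF s t v(1)] by blast
  then have "ys \<noteq> []" using v(2) by auto
  then show ?thesis
    using dihedral_len_add[OF s t w'(1,4) ys(1)] ys \<open>w = w'\<close> by simp
qed

text \<open>The recursion fixes the last letter, since two alternating words for one element are
  compared by the descents in which they end.\<close>

fun alternate :: "'a \<Rightarrow> 'a \<Rightarrow> nat \<Rightarrow> 'a" where
  "alternate s t 0 = \<one>"
| "alternate s t (Suc k) = alternate t s k \<otimes> s"

lemma alternate_closed: "s \<in> S \<Longrightarrow> t \<in> S \<Longrightarrow> alternate s t k \<in> carrier W"
  by (induction s t k rule: alternate.induct) auto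

lemma alternate_quotient:
  "s \<in> S \<Longrightarrow> t \<in> S \<Longrightarrow> inv (alternate s t k) \<otimes> alternate t s k = (s \<otimes> t) [^] k"
proof (induction k arbitrary: s t)
  case (Suc k)
  have cl: "alternate s t k \<in> carrier W" "alternate t s k \<in> carrier W"
    using Suc.prems by (auto intro: alternate_closed)
  have "inv (alternate s t (Suc k)) \<otimes> alternate t s (Suc k) = s \<otimes> (inv (alternate t s k) \<otimes> alternate s t k) \<otimes> t"
    using Suc.prems cl by (simp add: inv_mult_group m_assoc)
  also have "\<dots> = s \<otimes> (t \<otimes> s) [^] k \<otimes> t"
    using Suc by simp
  also have "\<dots> = (s \<otimes> t) [^] Suc k"
    using Suc.prems pow_mult_swap[of s t k, symmetric] by (simp add: m_assoc)
  finally show ?case .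
qed simp

lemma dihedral_reduced_alternate:
  assumes "s \<in> S" "t \<in> S"
  shows "dihedral_reduced s t (xs @ [x]) \<Longrightarrow> x = s \<Longrightarrow> wprod (xs @ [x]) = alternate s t (Suc (length xs))"
    and "dihedral_reduced s t (xs @ [x]) \<Longrightarrow> x = t \<Longrightarrow> wprod (xs @ [x]) = alternate t s (Suc (length xs))"
proof (induction xs arbitrary: x rule: rev_induct)
  case Nil
  { case 1 then show ?case using assms by simp }
  { case 2 then show ?case using assms by simp }
next
  case (snoc y ys)
  have main: "y \<noteq> x \<and> set ys \<subseteq> S \<and> y \<in> {s, t} \<and> dihedral_reduced s t (ys @ [y])"
    if red: "dihedral_reduced s t ((ys @ [y]) @ [x])" for x
  proof (intro conjI notI)
    have set: "set ys \<subseteq> {s, t}" "y \<in> {s, t}" using red by (auto simp: dihedral_reduced_def)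
    then show "set ys \<subseteq> S" "y \<in> {s, t}" using assms by auto
    show "dihedral_reduced s t (ys @ [y])" by (rule dihedral_reduced_butlast[OF assms red])
    assume "y = x"
    have S: "set ys \<subseteq> S" "x \<in> S" using set assms \<open>y = x\<close> by auto
    then have "wprod ys = wprod ((ys @ [y]) @ [x])"
      using \<open>y = x\<close> by (simp add: wprod_append)
    then have "length ((ys @ [y]) @ [x]) \<le> length ys"
      using red set unfolding dihedral_reduced_def by blast
    then show False by simp
  qed
  {
    case 1
    note main1 = main[OF 1(1)]
    have "y = t" using main1 1(2) by auto
    then show ?case
      using snoc.IH(2)[of y] main1 1(2) assms wprod_append[of "ys @ [y]" "[x]"] by simp
  next
    case 2
    note main1 = main[OF 2(1)]
    have "y = s" using main1 2(2) by auto
    then show ?case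
      using snoc.IH(1)[of y] main1 2(2) assms wprod_append[of "ys @ [y]" "[x]"] by simp
  }
qed

text \<open>An element with both right descents \<open>s\<close> and \<open>t\<close> gives two alternating words, one ending in
  \<open>s\<close> and one in \<open>t\<close>, for the same element of the dihedral group.\<close>

lemma two_descents_finite:
  assumes fin: "finite S" and s: "s \<in> S" and t: "t \<in> S" and w: "w \<in> carrier W"
    and "len (w \<otimes> s) < len w" "len (w \<otimes> t) < len w"
  shows "m s t < \<infinity>"
proof (rule ccontr)
  assume "\<not> m s t < \<infinity>"
  then have m: "m s t = \<infinity>" by simp
  obtain w' u where w': "w' \<in> carrier W" "u \<in> generate W {s, t}" "w = w' \<otimes> u"
    "\<And>u. u \<in> generate W {s, t} \<Longrightarrow> len w' \<le> len (w' \<otimes> u)"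
    using dihedral_min_coset[OF s t w] by blast
  obtain xs where xs: "dihedral_reduced s t xs" "u = wprod xs"
    using dihedral_reduced_exists[OF s t w'(2)] by blast
  have sub: "{s, t} \<subseteq> carrier W" using s t by auto
  have D: "subgroup (generate W {s, t}) W" by (rule generate_is_subgroup[OF sub])
  have uW: "u \<in> carrier W" using w'(2) generate_in_carrier[OF sub] by blast
  have len_w: "len w = len w' + length xs"
    using dihedral_len_add[OF s t w'(1,4) xs(1)] xs w' by simp
  \<comment> \<open>For a descent \<open>x\<close>, a reduced word for \<open>u \<otimes> x\<close>
    is shorter than \<open>xs\<close>. Appending \<open>x\<close> gives a word for \<open>u\<close>
    as short as \<open>xs\<close>, hence a reduced one ending in \<open>x\<close>.\<close>
  have ends: "\<exists>ys. dihedral_reduced s t (ys @ [x]) \<and> u = wprod (ys @ [x]) \<and> Suc (length ys) = length xs"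
    if x: "x \<in> {s, t}" and less: "len (w \<otimes> x) < len w" for x
  proof -
    have xS: "x \<in> S" using x s t by auto
    have "x \<in> generate W {s, t}" using x by (auto intro: generate.incl)
    then have ux: "u \<otimes> x \<in> generate W {s, t}" using subgroup.m_closed[OF D w'(2)] by blast
    obtain ys where ys: "dihedral_reduced s t ys" "u \<otimes> x = wprod ys"
      using dihedral_reduced_exists[OF s t ux] by blast
    have ysS: "set ys \<subseteq> {s, t}" "set ys \<subseteq> S" using ys s t by (auto simp: dihedral_reduced_def)
    have "len (w \<otimes> x) = len w' + length ys"
      using dihedral_len_add[OF s t w'(1,4) ys(1)] ys w' uW xS by (simp add: m_assoc)
    then have l: "length ys < length xs" using less len_w by simp
    have u: "u = wprod (ys @ [x])"
      using ys(2) ysS xS uW by (simp add: wprod_append flip: ys(2))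
    have set: "set (ys @ [x]) \<subseteq> {s, t}" using ysS x by simp
    then have l': "length xs \<le> length (ys @ [x])"
      using xs u unfolding dihedral_reduced_def by metis
    then have "dihedral_reduced s t (ys @ [x])"
      using l set xs u unfolding dihedral_reduced_def by force
    then show ?thesis using u l l' by auto
  qed
  from ends[of s] assms(5) obtain ys where ys: "dihedral_reduced s t (ys @ [s])" "u = wprod (ys @ [s])"
    "Suc (length ys) = length xs" by auto
  from ends[of t] assms(6) obtain zs where zs: "dihedral_reduced s t (zs @ [t])" "u = wprod (zs @ [t])"
    "Suc (length zs) = length xs" by auto
  have "alternate s t (length xs) = alternate t s (length xs)"
    using dihedral_reduced_alternate(1)[OF s t ys(1)] dihedral_reduced_alternate(2)[OF s t zs(1)] ys zs by simp
  then have "(s \<otimes> t) [^] (length xs) = \<one>"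
    using alternate_quotient[OF s t, of "length xs"] alternate_closed[OF t s] by simp
  moreover have "length xs > 0" using ys(3) by linarith
  ultimately show False
    using infinite_order[OF fin s t m] by blast
qed

end

section \<open>Almost invariant sets against one-ended special subgroups\<close>

section \<open>Almost invariant sets\<close>

text \<open>For a finitely generated group this says that \<open>P\<close> has finite coboundary in
  the Cayley graph of right multiplications. Quantifying over all \<open>y\<close> avoids a choice
  of generators, which suits the passage from a subgroup of finite index to the whole group.\<close>

definition almost_invariant :: "('g, 'b) monoid_scheme \<Rightarrow> 'g set \<Rightarrow> bool" where
  "almost_invariant G P \<longleftrightarrow> (\<forall>y\<in>carrier G. finite {g \<in> carrier G. (g \<in> P) \<noteq> (g \<otimes>\<^bsub>G\<^esub> y \<in> P)})"

lemma (in group) finite_right_translate: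
  assumes "finite {g \<in> carrier G. Q g}" "y \<in> carrier G"
  shows "finite {g \<in> carrier G. Q (g \<otimes> y)}"
proof (rule finite_subset)
  show "{g \<in> carrier G. Q (g \<otimes> y)} \<subseteq> (\<lambda>g. g \<otimes> inv y) ` {g \<in> carrier G. Q g}"
  proof
    fix g assume "g \<in> {g \<in> carrier G. Q (g \<otimes> y)}"
    then show "g \<in> (\<lambda>g. g \<otimes> inv y) ` {g \<in> carrier G. Q g}"
      using assms(2) by (intro image_eqI[of _ _ "g \<otimes> y"]) (auto simp: m_assoc)
  qed
qed (use assms in simp)

lemma (in group) finite_left_translate:
  assumes "finite {g \<in> carrier G. Q g}" "y \<in> carrier G"
  shows "finite {g \<in> carrier G. Q (y \<otimes> g)}"
proof (rule finite_subset)
  show "{g \<in> carrier G. Q (y \<otimes> g)} \<subseteq> (\<lambda>g. inv y \<otimes> g) ` {g \<in> carrier G. Q g}"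
  proof
    fix g assume "g \<in> {g \<in> carrier G. Q (y \<otimes> g)}"
    then show "g \<in> (\<lambda>g. inv y \<otimes> g) ` {g \<in> carrier G. Q g}"
      using assms(2) by (intro image_eqI[of _ _ "y \<otimes> g"]) (auto simp: m_assoc[symmetric])
  qed
qed (use assms in simp)

lemma reduced_power:
  assumes "reduced w" "w \<noteq> []" "hd w \<noteq> flip (last w)"
  shows "reduced (concat (replicate n w)) \<and> (n > 0 \<longrightarrow> concat (replicate n w) \<noteq> [] \<and> hd (concat (replicate n w)) = hd w)"
proof (induction n)
  case (Suc n)
  then show ?case using assms by (cases n) (auto simp: reduced_append)
qed simp

lemma reduced_inverse: "reduced (rev (map flip w)) \<longleftrightarrow> reduced w"
proof (induction w)
  case (Cons a w)
  have "hd w = flip a \<longleftrightarrow> flip (hd w) = a" by (metis flip_flip)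
  with Cons show ?case
    by (cases w) (auto simp: reduced_append)
qed simp

lemma flip_neq: "b \<noteq> flip b"
  by (cases b) auto

text \<open>A letter on the right can reach the first letter of a reduced word only if nothing else
  is left. The two exceptional words are the finite boundary of the set of elements with a given
  first letter.\<close>

lemma hd_norm_snoc:
  "reduced w \<Longrightarrow> w \<noteq> [] \<Longrightarrow> w \<noteq> [flip b] \<Longrightarrow> norm_word (w @ [b]) \<noteq> [] \<and> hd (norm_word (w @ [b])) = hd w"
proof (induction w)
  case (Cons a w)
  show ?case
  proof (cases "w = []")
    case True
    then have "b \<noteq> flip a" using Cons.prems by auto
    then show ?thesis using True by (simp add: red_cons_def)
  next
    case False
    show ?thesis
    proof (cases "w = [flip b]")
      case True
      then show ?thesis by (simp add: red_cons_def)
    next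
      case False
      then have "norm_word (w @ [b]) \<noteq> [] \<and> hd (norm_word (w @ [b])) = hd w"
        using Cons \<open>w \<noteq> []\<close> by simp
      then show ?thesis using Cons.prems \<open>w \<noteq> []\<close> by (simp add: red_cons_def)
    qed
  qed
qed simp

lemma (in group) ev_power:
  assumes "f \<in> X \<rightarrow> carrier G" "w \<in> words_over X"
  shows "concat (replicate n w) \<in> words_over X" "ev G f (concat (replicate n w)) = ev G f w [^] n"
proof -
  have "concat (replicate n w) \<in> words_over X \<and> ev G f (concat (replicate n w)) = ev G f w [^] n"
  proof (induction n)
    case (Suc n)
    then show ?case
      using assms ev_append[OF assms(1)] ev_closed[OF assms] nat_pow_Suc2[OF ev_closed[OF assms], of n]
      by simp
  qed simp
  then show "concat (replicate n w) \<in> words_over X" "ev G f (concat (replicate n w)) = ev G f w [^] n"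
    by auto
qed

lemma (in group) ev_inverse:
  assumes "f \<in> X \<rightarrow> carrier G" "w \<in> words_over X"
  shows "rev (map flip w) \<in> words_over X \<and> ev G f (rev (map flip w)) = inv (ev G f w)"
  using assms(2)
proof (induction w)
  case (Cons a w)
  then have "fst a \<in> X" "w \<in> words_over X" by auto
  then show ?case
    using Cons.IH letter_flip[OF assms(1), of a] letter_closed[OF assms(1), of a] ev_closed[OF assms(1), of w]
      ev_append[OF assms(1), of "rev (map flip w)" "[flip a]"]
    by (simp add: inv_mult_group)
qed simp

text \<open>The elements whose reduced word starts with a given letter form an almost invariant set. After
  conjugating \<open>h\<close> to a cyclically reduced \<open>c\<close>, the positive powers of \<open>c\<close> start with the first
  letter of \<open>c\<close>, and the negative ones do not.\<close>

theorem free_group_split: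
  assumes "is_free_group G" "h \<in> carrier G" "h \<noteq> \<one>\<^bsub>G\<^esub>"
  obtains P where "P \<subseteq> carrier G" "almost_invariant G P"
    "infinite {n::nat. h [^]\<^bsub>G\<^esub> n \<in> P}" "infinite {n::nat. (inv\<^bsub>G\<^esub> h) [^]\<^bsub>G\<^esub> n \<notin> P}"
    "inj (\<lambda>n::nat. h [^]\<^bsub>G\<^esub> n)" "inj (\<lambda>n::nat. (inv\<^bsub>G\<^esub> h) [^]\<^bsub>G\<^esub> n)"
proof -
  interpret G: group G using assms(1) by (simp add: is_free_group_def)
  obtain X where pres: "has_presentation G X {}"
    using assms(1) by (auto simp: is_free_group_def)
  note X = has_presentationE(1,2)[OF pres G.is_group]
  have id: "(\<lambda>x. x) \<in> X \<rightarrow> carrier G" using X by auto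
  let ?ev = "ev G (\<lambda>x. x)" and ?letter = "letter G (\<lambda>x. x)"
  note ev_closed = G.ev_closed[OF id] and letter_closed = G.letter_closed[OF id]
  have ev_eq: "?ev v = ?ev w \<longleftrightarrow> norm_word v = norm_word w" if "v \<in> words_over X" "w \<in> words_over X" for v w
    using has_presentationE(3)[OF pres G.is_group that] word_eq_free_iff[OF that] by simp
  define nf where "nf g = norm_word (SOME w. w \<in> words_over X \<and> ?ev w = g)" for g
  have nf_ev: "nf (?ev w) = norm_word w" if "w \<in> words_over X" for w
  proof -
    define v where "v = (SOME v. v \<in> words_over X \<and> ?ev v = ?ev w)"
    have "v \<in> words_over X \<and> ?ev v = ?ev w"
      unfolding v_def by (rule someI[of _ w]) (use that in simp)
    then show ?thesis using ev_eq[of v w] that by (simp add: nf_def flip: v_def)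
  qed
  have nf: "nf g \<in> words_over X" "?ev (nf g) = g" "reduced (nf g)" if g: "g \<in> carrier G" for g
  proof -
    obtain w where w: "w \<in> words_over X" "g = ?ev w"
      using g X(2) G.ev_generate[OF X(1)] by auto
    then have "nf g = norm_word w" using nf_ev by simp
    then show "nf g \<in> words_over X" "?ev (nf g) = g" "reduced (nf g)"
      using w ev_eq[of "norm_word w" w] by (simp_all add: norm_word_closed reduced_norm_word norm_word_reduced)
  qed
  define P where "P b = {g \<in> carrier G. nf g \<noteq> [] \<and> hd (nf g) = b}" for b
  have ai_letter: "finite {g \<in> carrier G. (g \<in> P a) \<noteq> (g \<otimes>\<^bsub>G\<^esub> ?letter b \<in> P a)}" if b: "fst b \<in> X" for a b
  proof (rule finite_subset)
    show "{g \<in> carrier G. (g \<in> P a) \<noteq> (g \<otimes>\<^bsub>G\<^esub> ?letter b \<in> P a)} \<subseteq> {?ev [], ?ev [flip b]}"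
    proof (rule subsetI, rule ccontr)
      fix g assume g: "g \<in> {g \<in> carrier G. (g \<in> P a) \<noteq> (g \<otimes>\<^bsub>G\<^esub> ?letter b \<in> P a)}" "g \<notin> {?ev [], ?ev [flip b]}"
      then have gG: "g \<in> carrier G" by simp
      have ne: "nf g \<noteq> []" "nf g \<noteq> [flip b]"
        using g(2) nf(2)[OF gG] by (metis insertCI)+
      have "g \<otimes>\<^bsub>G\<^esub> ?letter b = ?ev (nf g @ [b])"
        using G.ev_append[OF id nf(1)[OF gG], of "[b]"] nf(2)[OF gG] b letter_closed[OF b] by simp
      then have "nf (g \<otimes>\<^bsub>G\<^esub> ?letter b) = norm_word (nf g @ [b])"
        using nf_ev[of "nf g @ [b]"] nf(1)[OF gG] b by simp
      then show False
        using g(1) hd_norm_snoc[OF nf(3)[OF gG] ne] ne letter_closed[OF b] by (auto simp: P_def)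
    qed
  qed simp
  have ai_word: "finite {g \<in> carrier G. (g \<in> P a) \<noteq> (g \<otimes>\<^bsub>G\<^esub> ?ev w \<in> P a)}" if "w \<in> words_over X" for a w
    using that
  proof (induction w)
    case Nil
    have "{g \<in> carrier G. (g \<in> P a) \<noteq> (g \<otimes>\<^bsub>G\<^esub> ?ev [] \<in> P a)} = {}" by auto
    then show ?case by (metis finite.emptyI)
  next
    case (Cons b w)
    then have b: "fst b \<in> X" and w: "w \<in> words_over X" by auto
    let ?A = "{g \<in> carrier G. (g \<in> P a) \<noteq> (g \<otimes>\<^bsub>G\<^esub> ?letter b \<in> P a)}"
    let ?B = "{g \<in> carrier G. (g \<otimes>\<^bsub>G\<^esub> ?letter b \<in> P a) \<noteq> (g \<otimes>\<^bsub>G\<^esub> ?letter b \<otimes>\<^bsub>G\<^esub> ?ev w \<in> P a)}"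
    have "finite ?B"
      by (rule G.finite_right_translate[OF Cons.IH[OF w] letter_closed[OF b]])
    moreover have "{g \<in> carrier G. (g \<in> P a) \<noteq> (g \<otimes>\<^bsub>G\<^esub> ?ev (b # w) \<in> P a)} \<subseteq> ?A \<union> ?B"
      using letter_closed[OF b] ev_closed[OF w] by (auto simp: G.m_assoc)
    ultimately show ?case
      using ai_letter[OF b, of a] by (meson finite_UnI finite_subset)
  qed
  have ai: "finite {g \<in> carrier G. (g \<in> P a) \<noteq> (g \<otimes>\<^bsub>G\<^esub> y \<in> P a)}" if "y \<in> carrier G" for a y
    using ai_word[OF nf(1)[OF that], of a] nf(2)[OF that] by simp

  define conj where "conj a = inv\<^bsub>G\<^esub> a \<otimes>\<^bsub>G\<^esub> h \<otimes>\<^bsub>G\<^esub> a" for a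
  \<comment> \<open>A conjugate of minimal length is cyclically reduced: otherwise conjugation by
    its first letter would strip both ends.\<close>
  define a where "a = arg_min (\<lambda>a. length (nf (conj a))) (\<lambda>a. a \<in> carrier G)"
  have a: "a \<in> carrier G" "\<And>a'. a' \<in> carrier G \<Longrightarrow> length (nf (conj a)) \<le> length (nf (conj a'))"
    using arg_min_natI[of "\<lambda>a. a \<in> carrier G" "\<one>\<^bsub>G\<^esub>" "\<lambda>a. length (nf (conj a))"]
      arg_min_nat_le[of "\<lambda>a. a \<in> carrier G" _ "\<lambda>a. length (nf (conj a))"]
    unfolding a_def by auto
  define c where "c = conj a"
  have c: "c \<in> carrier G" using a assms by (simp add: c_def conj_def)
  have hc: "h = a \<otimes>\<^bsub>G\<^esub> c \<otimes>\<^bsub>G\<^esub> inv\<^bsub>G\<^esub> a"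
  proof -
    have "a \<otimes>\<^bsub>G\<^esub> c \<otimes>\<^bsub>G\<^esub> inv\<^bsub>G\<^esub> a = (a \<otimes>\<^bsub>G\<^esub> inv\<^bsub>G\<^esub> a) \<otimes>\<^bsub>G\<^esub> h \<otimes>\<^bsub>G\<^esub> (a \<otimes>\<^bsub>G\<^esub> inv\<^bsub>G\<^esub> a)"
      using a(1) assms(2) by (simp only: c_def conj_def G.m_assoc G.m_closed G.inv_closed)
    then show ?thesis using a(1) assms(2) by simp
  qed
  define w where "w = nf c"
  note w = nf[OF c, folded w_def]
  have "w \<noteq> []"
    using w(2) hc a(1) assms(3) by auto
  define b where "b = hd w"
  have cyc: "last w \<noteq> flip b"
  proof
    assume last: "last w = flip b"
    have "tl w \<noteq> []"
      using last \<open>w \<noteq> []\<close> flip_neq[of b] by (cases w) (auto simp: b_def)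
    then obtain v where v: "w = b # v @ [flip b]"
      using \<open>w \<noteq> []\<close> last unfolding b_def
      by (metis append_butlast_last_id last_tl list.collapse)
    have bX: "fst b \<in> X" and vX: "v \<in> words_over X" using w(1) v by auto
    let ?l = "?letter b"
    have "?ev w = ?l \<otimes>\<^bsub>G\<^esub> (?ev v \<otimes>\<^bsub>G\<^esub> inv\<^bsub>G\<^esub> ?l)"
      using G.ev_append[OF id vX, of "[flip b]"] bX G.letter_flip[OF id bX] letter_closed[OF bX]
      by (simp add: v)
    then have "inv\<^bsub>G\<^esub> ?l \<otimes>\<^bsub>G\<^esub> c \<otimes>\<^bsub>G\<^esub> ?l = ?ev v"
      using w(2) letter_closed[OF bX] ev_closed[OF vX]
      by (metis G.inv_closed G.inv_inv G.inv_solve_left' G.inv_solve_right' G.m_assoc G.m_closed)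
    moreover have "conj (a \<otimes>\<^bsub>G\<^esub> ?l) = inv\<^bsub>G\<^esub> ?l \<otimes>\<^bsub>G\<^esub> c \<otimes>\<^bsub>G\<^esub> ?l"
      using a(1) assms(2) letter_closed[OF bX] by (simp add: c_def conj_def G.inv_mult_group G.m_assoc)
    moreover have "reduced v" using w(3) v by (simp add: reduced_append)
    ultimately have "nf (conj (a \<otimes>\<^bsub>G\<^esub> ?l)) = v"
      using nf_ev[OF vX] norm_word_reduced by simp
    then have "length w \<le> length v"
      using a(2)[of "a \<otimes>\<^bsub>G\<^esub> ?l"] a(1) letter_closed[OF bX] by (simp add: w_def c_def)
    then show False using v by simp
  qed
  then have cyc': "hd w \<noteq> flip (last w)" unfolding b_def by (metis flip_flip)
  let ?w = "rev (map flip w)"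
  have w': "?w \<in> words_over X" "?ev ?w = inv\<^bsub>G\<^esub> c" "reduced ?w" "?w \<noteq> []" "hd ?w = flip (last w)" "last ?w = flip b"
    using G.ev_inverse[OF id w(1)] w \<open>w \<noteq> []\<close>
    by (auto simp: reduced_inverse hd_rev last_rev last_map hd_map b_def)
  have nf_pow: "nf (c [^]\<^bsub>G\<^esub> n) = concat (replicate n w)" for n :: nat
    using G.ev_power[OF id w(1), of n] nf_ev reduced_power[OF w(3) \<open>w \<noteq> []\<close> cyc', of n] w(2)
    by (metis norm_word_reduced)
  have nf_pow': "nf (inv\<^bsub>G\<^esub> c [^]\<^bsub>G\<^esub> n) = concat (replicate n ?w)" for n :: nat
  proof -
    have "hd ?w \<noteq> flip (last ?w)" using w'(5,6) cyc' by (simp add: b_def)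
    then show ?thesis
      using G.ev_power[OF id w'(1), of n] nf_ev reduced_power[OF w'(3,4), of n] w'(2)
      by (metis norm_word_reduced)
  qed
  have len_conc: "length (concat (replicate n u)) = n * length u" for n and u :: "'a word"
    by (induction n) auto
  have inj: "inj (\<lambda>n::nat. c [^]\<^bsub>G\<^esub> n)" "inj (\<lambda>n::nat. inv\<^bsub>G\<^esub> c [^]\<^bsub>G\<^esub> n)"
  proof -
    have 1: "length (nf (c [^]\<^bsub>G\<^esub> n)) = n * length w" "length (nf (inv\<^bsub>G\<^esub> c [^]\<^bsub>G\<^esub> n)) = n * length w" for n :: nat
      by (simp_all only: nf_pow nf_pow' len_conc length_rev length_map)
    have "length w > 0" using \<open>w \<noteq> []\<close> by simp
    then show "inj (\<lambda>n::nat. c [^]\<^bsub>G\<^esub> n)" "inj (\<lambda>n::nat. inv\<^bsub>G\<^esub> c [^]\<^bsub>G\<^esub> n)"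
      unfolding inj_def using 1 by (metis mult_right_cancel less_irrefl)+
  qed
  have pow_P: "c [^]\<^bsub>G\<^esub> n \<in> P b" "inv\<^bsub>G\<^esub> c [^]\<^bsub>G\<^esub> n \<notin> P b" if "n > 0" for n :: nat
  proof -
    show "c [^]\<^bsub>G\<^esub> n \<in> P b"
      using reduced_power[OF w(3) \<open>w \<noteq> []\<close> cyc', of n] that c by (simp add: P_def nf_pow b_def)
    have "hd ?w \<noteq> flip (last ?w)" using w'(5,6) cyc' by (simp add: b_def)
    then have "hd (concat (replicate n ?w)) = flip (last w)"
      using reduced_power[OF w'(3,4), of n] that w'(5) by simp
    then show "inv\<^bsub>G\<^esub> c [^]\<^bsub>G\<^esub> n \<notin> P b"
      using cyc' by (simp add: P_def nf_pow' b_def)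
  qed
  have pow_h: "h [^]\<^bsub>G\<^esub> n = a \<otimes>\<^bsub>G\<^esub> c [^]\<^bsub>G\<^esub> n \<otimes>\<^bsub>G\<^esub> inv\<^bsub>G\<^esub> a"
    "inv\<^bsub>G\<^esub> h [^]\<^bsub>G\<^esub> n = a \<otimes>\<^bsub>G\<^esub> inv\<^bsub>G\<^esub> c [^]\<^bsub>G\<^esub> n \<otimes>\<^bsub>G\<^esub> inv\<^bsub>G\<^esub> a" for n :: nat
  proof -
    have *: "(a \<otimes>\<^bsub>G\<^esub> d \<otimes>\<^bsub>G\<^esub> inv\<^bsub>G\<^esub> a) [^]\<^bsub>G\<^esub> n = a \<otimes>\<^bsub>G\<^esub> d [^]\<^bsub>G\<^esub> n \<otimes>\<^bsub>G\<^esub> inv\<^bsub>G\<^esub> a" if d: "d \<in> carrier G" for d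
    proof (induction n)
      case (Suc n)
      have "a \<otimes>\<^bsub>G\<^esub> d [^]\<^bsub>G\<^esub> n \<otimes>\<^bsub>G\<^esub> inv\<^bsub>G\<^esub> a \<otimes>\<^bsub>G\<^esub> (a \<otimes>\<^bsub>G\<^esub> d \<otimes>\<^bsub>G\<^esub> inv\<^bsub>G\<^esub> a) =
          a \<otimes>\<^bsub>G\<^esub> d [^]\<^bsub>G\<^esub> n \<otimes>\<^bsub>G\<^esub> (inv\<^bsub>G\<^esub> a \<otimes>\<^bsub>G\<^esub> a) \<otimes>\<^bsub>G\<^esub> d \<otimes>\<^bsub>G\<^esub> inv\<^bsub>G\<^esub> a"
        using a(1) d by (simp only: G.m_assoc G.m_closed G.inv_closed G.nat_pow_closed)
      then show ?case using Suc a(1) d by (simp add: G.m_assoc)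
    qed (use a(1) in simp)
    show "h [^]\<^bsub>G\<^esub> n = a \<otimes>\<^bsub>G\<^esub> c [^]\<^bsub>G\<^esub> n \<otimes>\<^bsub>G\<^esub> inv\<^bsub>G\<^esub> a"
      using *[OF c] hc by simp
    have "inv\<^bsub>G\<^esub> h = a \<otimes>\<^bsub>G\<^esub> inv\<^bsub>G\<^esub> c \<otimes>\<^bsub>G\<^esub> inv\<^bsub>G\<^esub> a"
      unfolding hc using a(1) c by (simp add: G.inv_mult_group G.m_assoc)
    then show "inv\<^bsub>G\<^esub> h [^]\<^bsub>G\<^esub> n = a \<otimes>\<^bsub>G\<^esub> inv\<^bsub>G\<^esub> c [^]\<^bsub>G\<^esub> n \<otimes>\<^bsub>G\<^esub> inv\<^bsub>G\<^esub> a"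
      using *[of "inv\<^bsub>G\<^esub> c"] c by simp
  qed
  \<comment> \<open>Translating the set by \<open>a\<close> on the left undoes the conjugation up to
    a factor \<open>inv a\<close> on the right. By almost invariance this factor matters only on the
    finite set \<open>D\<close>.\<close>
  define P' where "P' = {g \<in> carrier G. inv\<^bsub>G\<^esub> a \<otimes>\<^bsub>G\<^esub> g \<in> P b}"
  define D where "D = {g \<in> carrier G. (g \<in> P b) \<noteq> (g \<otimes>\<^bsub>G\<^esub> inv\<^bsub>G\<^esub> a \<in> P b)}"
  have D: "finite D" unfolding D_def using ai[of "inv\<^bsub>G\<^esub> a" b] a(1) by simp
  have conj_P': "a \<otimes>\<^bsub>G\<^esub> d \<otimes>\<^bsub>G\<^esub> inv\<^bsub>G\<^esub> a \<in> P' \<longleftrightarrow> d \<in> P b" if "d \<in> carrier G" "d \<notin> D" for d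
  proof -
    have "inv\<^bsub>G\<^esub> a \<otimes>\<^bsub>G\<^esub> (a \<otimes>\<^bsub>G\<^esub> d \<otimes>\<^bsub>G\<^esub> inv\<^bsub>G\<^esub> a) = d \<otimes>\<^bsub>G\<^esub> inv\<^bsub>G\<^esub> a"
      using a(1) that(1) by (simp add: G.m_assoc[symmetric])
    then show ?thesis using that a(1) by (simp add: P'_def D_def)
  qed
  have conj_inj: "d = d'" if "a \<otimes>\<^bsub>G\<^esub> d \<otimes>\<^bsub>G\<^esub> inv\<^bsub>G\<^esub> a = a \<otimes>\<^bsub>G\<^esub> d' \<otimes>\<^bsub>G\<^esub> inv\<^bsub>G\<^esub> a" "d \<in> carrier G" "d' \<in> carrier G" for d d'
    using that a(1) by simp
  have inf: "infinite {n::nat. 0 < n \<and> f n \<notin> D}" if "inj f" for f :: "nat \<Rightarrow> 'a"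
  proof
    assume "finite {n::nat. 0 < n \<and> f n \<notin> D}"
    moreover have "finite (f -` D)" by (rule finite_vimageI[OF D that])
    ultimately have "finite ({0} \<union> {n::nat. 0 < n \<and> f n \<notin> D} \<union> f -` D)" by simp
    moreover have "{0} \<union> {n::nat. 0 < n \<and> f n \<notin> D} \<union> f -` D = UNIV" by auto
    ultimately show False using infinite_UNIV_nat by metis
  qed
  show ?thesis
  proof (rule that)
    show "P' \<subseteq> carrier G" by (auto simp: P'_def)
    show "almost_invariant G P'"
      unfolding almost_invariant_def
    proof
      fix y assume y: "y \<in> carrier G"
      have "finite {g \<in> carrier G. (inv\<^bsub>G\<^esub> a \<otimes>\<^bsub>G\<^esub> g \<in> P b) \<noteq> (inv\<^bsub>G\<^esub> a \<otimes>\<^bsub>G\<^esub> g \<otimes>\<^bsub>G\<^esub> y \<in> P b)}"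
        by (rule G.finite_left_translate[OF ai[OF y]]) (use a(1) in simp)
      then show "finite {g \<in> carrier G. (g \<in> P') \<noteq> (g \<otimes>\<^bsub>G\<^esub> y \<in> P')}"
        using y a(1) by (elim rev_finite_subset) (auto simp: P'_def G.m_assoc)
    qed
    show "infinite {n::nat. h [^]\<^bsub>G\<^esub> n \<in> P'}"
    proof (rule infinite_super[OF _ inf[OF inj(1)]])
      show "{n::nat. 0 < n \<and> c [^]\<^bsub>G\<^esub> n \<notin> D} \<subseteq> {n::nat. h [^]\<^bsub>G\<^esub> n \<in> P'}"
        using conj_P' pow_P(1) c by (auto simp: pow_h)
    qed
    show "infinite {n::nat. inv\<^bsub>G\<^esub> h [^]\<^bsub>G\<^esub> n \<notin> P'}"
    proof (rule infinite_super[OF _ inf[OF inj(2)]])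
      show "{n::nat. 0 < n \<and> inv\<^bsub>G\<^esub> c [^]\<^bsub>G\<^esub> n \<notin> D} \<subseteq> {n::nat. inv\<^bsub>G\<^esub> h [^]\<^bsub>G\<^esub> n \<notin> P'}"
        using conj_P' pow_P(2) c by (auto simp: pow_h)
    qed
    show "inj (\<lambda>n::nat. h [^]\<^bsub>G\<^esub> n)" "inj (\<lambda>n::nat. inv\<^bsub>G\<^esub> h [^]\<^bsub>G\<^esub> n)"
      using inj conj_inj c unfolding inj_def pow_h by (metis G.nat_pow_closed G.inv_closed)+
  qed
qed

text \<open>Constancy on right cosets makes the quotient \<open>w \<otimes> inv (rep w)\<close>
  equivariant for left multiplication by \<open>C\<close>. The value 1 on \<open>C\<close> itself
  makes this quotient the identity map on \<open>C\<close>.\<close>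

lemma (in group) right_transversal:
  assumes C: "subgroup C G"
  shows "\<exists>rep. (\<forall>w\<in>carrier G. rep w \<in> carrier G \<and> w \<otimes> inv (rep w) \<in> C) \<and>
    (\<forall>c\<in>C. \<forall>w\<in>carrier G. rep (c \<otimes> w) = rep w) \<and> (\<forall>c\<in>C. rep c = \<one>) \<and>
    (finite (rcosets C) \<longrightarrow> finite (rep ` carrier G))"
proof -
  interpret C: subgroup C G by fact
  define rep where "rep w = (if C #> w = C then \<one> else SOME r. r \<in> C #> w)" for w
  have rep: "rep w \<in> C #> w" if "w \<in> carrier G" for w
  proof -
    have "(SOME r. r \<in> C #> w) \<in> C #> w"
      using rcos_self[OF that C] by (rule someI)
    moreover have "\<one> \<in> C #> w" if "C #> w = C" using that by simp
    ultimately show ?thesis by (simp add: rep_def)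
  qed
  have closed: "rep w \<in> carrier G" if "w \<in> carrier G" for w
    using rep[OF that] r_coset_subset_G[OF C.subset that] by blast
  have quot: "w \<otimes> inv (rep w) \<in> C" if w: "w \<in> carrier G" for w
  proof -
    obtain f where f: "f \<in> C" "rep w = f \<otimes> w" using rep[OF w] by (auto simp: r_coset_def)
    then have fG: "f \<in> carrier G" by simp
    have "w \<otimes> inv (rep w) = w \<otimes> (inv w \<otimes> inv f)" using fG w f by (simp add: inv_mult_group)
    also have "\<dots> = inv f" using fG w by (simp add: m_assoc[symmetric])
    finally show ?thesis using f by simp
  qed
  have const: "rep (c \<otimes> w) = rep w" if c: "c \<in> C" and w: "w \<in> carrier G" for c w
  proof -
    have "C #> (c \<otimes> w) = C #> c #> w"
      using coset_mult_assoc[OF C.subset C.mem_carrier[OF c] w] by simp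
    also have "C #> c = C" using coset_join2[OF C.mem_carrier[OF c] C c] .
    finally show ?thesis by (simp add: rep_def)
  qed
  have one: "rep c = \<one>" if "c \<in> C" for c
    using coset_join2[OF C.mem_carrier[OF that] C that] by (simp add: rep_def)
  have fin: "finite (rep ` carrier G)" if "finite (rcosets C)"
  proof -
    have "rep ` carrier G \<subseteq> (\<lambda>A. if A = C then \<one> else SOME r. r \<in> A) ` (rcosets C)"
    proof (rule image_subsetI)
      fix w assume "w \<in> carrier G"
      then have "C #> w \<in> rcosets C" by (intro rcosetsI C.subset)
      then show "rep w \<in> (\<lambda>A. if A = C then \<one> else SOME r. r \<in> A) ` (rcosets C)"
        unfolding rep_def by (rule image_eqI[rotated]) simp
    qed
    then show ?thesis using that by (meson finite_imageI finite_subset)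
  qed
  show ?thesis using closed quot const one fin by (intro exI[of _ rep]) simp
qed

text \<open>\<open>B\<close> tests the \<open>F\<close>-component \<open>d w\<close> of
  \<open>w = d w \<otimes> rep w\<close>. Right multiplication by \<open>s\<close> multiplies this
  component by \<open>d (r \<otimes> s)\<close> with \<open>r = rep w\<close>. There are finitely
  many such factors, so the boundary of \<open>B\<close> lies in finitely many translates of finite
  sets.\<close>

lemma (in group) almost_invariant_extend:
  assumes F: "subgroup F G" "finite (rcosets F)" and P: "P \<subseteq> F" "almost_invariant (G\<lparr>carrier := F\<rparr>) P"
  obtains B where "almost_invariant G B" "B \<inter> F = P"
proof -
  interpret F: subgroup F G by fact
  obtain rep where "\<forall>w\<in>carrier G. rep w \<in> carrier G \<and> w \<otimes> inv (rep w) \<in> F"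
    "\<forall>c\<in>F. \<forall>w\<in>carrier G. rep (c \<otimes> w) = rep w" and rep_one: "\<forall>c\<in>F. rep c = \<one>"
    and fin: "finite (rep ` carrier G)"
    using right_transversal[OF F(1)] F(2) by metis
  then have rep: "\<And>w. w \<in> carrier G \<Longrightarrow> rep w \<in> carrier G"
    "\<And>w. w \<in> carrier G \<Longrightarrow> w \<otimes> inv (rep w) \<in> F"
    "\<And>c w. c \<in> F \<Longrightarrow> w \<in> carrier G \<Longrightarrow> rep (c \<otimes> w) = rep w"
    by simp_all
  define d where "d w = w \<otimes> inv (rep w)" for w
  have d: "d w \<in> F" "w = d w \<otimes> rep w" if "w \<in> carrier G" for w
    using rep(1,2)[OF that] that by (simp_all add: d_def m_assoc)
  define B where "B = {w \<in> carrier G. d w \<in> P}"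
  show ?thesis
  proof (rule that)
    have "d w = w" if "w \<in> F" for w
      using that rep_one by (simp add: d_def)
    then show "B \<inter> F = P" using P(1) by (auto simp: B_def)
    show "almost_invariant G B" unfolding almost_invariant_def
    proof
      fix s assume s: "s \<in> carrier G"
      define D where "D r = {g \<in> F. (g \<in> P) \<noteq> (g \<otimes> d (r \<otimes> s) \<in> P)}" for r
      have "finite (D r)" if "r \<in> rep ` carrier G" for r
      proof -
        have "d (r \<otimes> s) \<in> F" using that rep(1) s by (intro d(1)) auto
        then show ?thesis using P(2) by (simp add: almost_invariant_def D_def)
      qed
      then have "finite (\<Union>r\<in>rep ` carrier G. (\<lambda>g. g \<otimes> r) ` D r)" using fin by blast
      moreover have "{g \<in> carrier G. (g \<in> B) \<noteq> (g \<otimes> s \<in> B)} \<subseteq> (\<Union>r\<in>rep ` carrier G. (\<lambda>g. g \<otimes> r) ` D r)"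
      proof
        fix w assume "w \<in> {g \<in> carrier G. (g \<in> B) \<noteq> (g \<otimes> s \<in> B)}"
        then have w: "w \<in> carrier G" and ne: "(d w \<in> P) \<noteq> (d (w \<otimes> s) \<in> P)" using s by (auto simp: B_def)
        let ?r = "rep w"
        have r: "?r \<in> carrier G" "?r \<otimes> s \<in> carrier G" using rep(1)[OF w] s by simp_all
        have ws: "w \<otimes> s = d w \<otimes> (?r \<otimes> s)"
          using d[OF w] r s w by (metis F.mem_carrier m_assoc)
        have rep_ws: "rep (w \<otimes> s) = rep (?r \<otimes> s)"
          unfolding ws by (rule rep(3)[OF d(1)[OF w] r(2)])
        have "d (w \<otimes> s) = d w \<otimes> (?r \<otimes> s) \<otimes> inv (rep (?r \<otimes> s))"
          unfolding d_def[of "w \<otimes> s"] rep_ws by (simp only: ws)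
        then have "d (w \<otimes> s) = d w \<otimes> d (?r \<otimes> s)"
          using d(1)[OF w] r s rep(1)[of "?r \<otimes> s"] by (simp add: d_def[of "?r \<otimes> s"] m_assoc)
        then have "d w \<in> D ?r" using ne d(1)[OF w] by (simp add: D_def)
        then have "d w \<otimes> ?r \<in> (\<lambda>g. g \<otimes> ?r) ` D ?r" by (rule imageI)
        then show "w \<in> (\<Union>r\<in>rep ` carrier G. (\<lambda>g. g \<otimes> r) ` D r)" using d(2)[OF w] w by auto
      qed
      ultimately show "finite {g \<in> carrier G. (g \<in> B) \<noteq> (g \<otimes> s \<in> B)}" by (rule rev_finite_subset)
    qed
  qed
qed

text \<open>Pigeonhole: two different elements of \<open>U\<close> lie in one coset of
  \<open>F\<close>, and their quotient lies in both subgroups.\<close>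

lemma (in group) finite_index_meets:
  assumes F: "subgroup F G" "finite (rcosets F)" and U: "subgroup U G" "infinite U"
  obtains h where "h \<in> U" "h \<in> F" "h \<noteq> \<one>"
proof -
  have "finite ((\<lambda>u. F #> u) ` U)"
    by (rule finite_subset[OF _ F(2)]) (use subgroup.subset[OF U(1)] in \<open>auto simp: RCOSETS_def\<close>)
  then obtain u v where uv: "u \<in> U" "v \<in> U" "u \<noteq> v" "F #> u = F #> v"
    using U(2) by (metis finite_imageD inj_onI)
  then have G: "u \<in> carrier G" "v \<in> carrier G" using subgroup.subset[OF U(1)] by auto
  have "u \<in> F #> v" using rcos_self[OF G(1) F(1)] uv(4) by simp
  then obtain f where f: "f \<in> F" "u = f \<otimes> v" by (auto simp: r_coset_def)
  then have fG: "f \<in> carrier G" using subgroup.mem_carrier[OF F(1)] by blast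
  then have "f = u \<otimes> inv v" using f G by (simp add: m_assoc)
  then have "f \<in> U" using uv U(1) by (simp add: subgroup.m_closed subgroup.m_inv_closed)
  moreover have "f \<noteq> \<one>" using f(2) uv(3) G by auto
  ultimately show ?thesis using f(1) that by blast
qed

text \<open>One nontrivial \<open>h\<close> in \<open>U\<close> and \<open>F\<close> suffices: all
  its powers stay in \<open>U\<close>, infinitely many positive ones lie in \<open>B\<close> and
  infinitely many negative ones do not.\<close>

theorem virtually_free_split:
  assumes "virtually_free G" "subgroup U G" "infinite U"
  obtains B where "almost_invariant G B" "infinite (U \<inter> B)" "infinite (U - B)"
proof -
  interpret G: group G using assms(1) by (simp add: virtually_free_def)
  obtain F where F: "subgroup F G" "finite (rcosets\<^bsub>G\<^esub> F)" "is_free_group (G\<lparr>carrier := F\<rparr>)"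
    using assms(1) by (auto simp: virtually_free_def)
  obtain h where h: "h \<in> U" "h \<in> F" "h \<noteq> \<one>\<^bsub>G\<^esub>"
    using G.finite_index_meets[OF F(1,2) assms(2,3)] by blast
  obtain P where P: "P \<subseteq> F" "almost_invariant (G\<lparr>carrier := F\<rparr>) P"
    and inf: "infinite {n::nat. h [^]\<^bsub>G\<^esub> n \<in> P}" "infinite {n::nat. (inv\<^bsub>G\<^esub> h) [^]\<^bsub>G\<^esub> n \<notin> P}"
    and inj: "inj (\<lambda>n::nat. h [^]\<^bsub>G\<^esub> n)" "inj (\<lambda>n::nat. (inv\<^bsub>G\<^esub> h) [^]\<^bsub>G\<^esub> n)"
    using free_group_split[OF F(3), of h] h G.m_inv_consistent[OF F(1) h(2)]
    by (auto simp: G.nat_pow_consistent[symmetric])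
  obtain B where B: "almost_invariant G B" "B \<inter> F = P"
    using G.almost_invariant_extend[OF F(1,2) P] by blast
  have pow: "g [^]\<^bsub>G\<^esub> n \<in> V" if "subgroup V G" "g \<in> V" for g V and n :: nat
    using that by (induction n) (auto intro: subgroup.m_closed subgroup.one_closed)
  have hi: "inv\<^bsub>G\<^esub> h \<in> U" "inv\<^bsub>G\<^esub> h \<in> F"
    using h assms(2) F(1) by (auto intro: subgroup.m_inv_closed)
  show ?thesis
  proof (rule that[OF B(1)])
    have "infinite ((\<lambda>n::nat. h [^]\<^bsub>G\<^esub> n) ` {n. h [^]\<^bsub>G\<^esub> n \<in> P})"
      using inf(1) inj(1) by (metis finite_imageD inj_on_subset subset_UNIV)
    then show "infinite (U \<inter> B)"
      by (rule infinite_super[rotated]) (use pow[OF assms(2) h(1)] B(2) in auto)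
    have "infinite ((\<lambda>n::nat. inv\<^bsub>G\<^esub> h [^]\<^bsub>G\<^esub> n) ` {n. inv\<^bsub>G\<^esub> h [^]\<^bsub>G\<^esub> n \<notin> P})"
      using inf(2) inj(2) by (metis finite_imageD inj_on_subset subset_UNIV)
    then show "infinite (U - B)"
      by (rule infinite_super[rotated]) (use pow[OF assms(2) hi(1)] pow[OF F(1) hi(2)] B(2) in auto)
  qed
qed

section \<open>One-ended special subgroups\<close>

lemma mod_shift_neq:
  assumes "(i::nat) < j" "j < i + n"
  shows "(k + i) mod n \<noteq> (k + j) mod n"
proof
  assume "(k + i) mod n = (k + j) mod n"
  then have "n dvd (k + j) - (k + i)"
    using assms by (metis add_left_mono less_imp_le mod_eq_dvd_iff_nat)
  then have "n dvd j - i" by simp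
  then show False using assms by (auto dest!: dvd_imp_le)
qed

context coxeter_system
begin

text \<open>The edges with labels in \<open>K\<close> of the Cayley graph with a ball removed.
  Length is measured in \<open>W\<close>, also when the walk stays in the special subgroup on
  \<open>K\<close>.\<close>

definition moves :: "'a set \<Rightarrow> nat \<Rightarrow> ('a \<times> 'a) set" where
  "moves K r = {(x, x \<otimes> a) | x a. x \<in> carrier W \<and> a \<in> K \<and> r \<le> len x \<and> r \<le> len (x \<otimes> a)}"

text \<open>In contrast to \<open>alternate\<close>, the initial letter is fixed, so that increasing
  the length walks around a coset one edge at a time.\<close>

fun zigzag :: "'a \<Rightarrow> 'a \<Rightarrow> nat \<Rightarrow> 'a" where
  "zigzag s t 0 = \<one>"
| "zigzag s t (Suc j) = zigzag s t j \<otimes> (if even j then s else t)"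

lemma zigzag_even: "s \<in> S \<Longrightarrow> t \<in> S \<Longrightarrow> zigzag s t (2 * i) = (s \<otimes> t) [^] i"
  by (induction i) (auto simp: m_assoc)

text \<open>The sign homomorphism, realized on two points with every generator acting by
  \<open>Not\<close>, separates odd words from the identity.\<close>

lemma zigzag_odd_neq_one:
  assumes "s \<in> S" "t \<in> S" "odd j"
  shows "zigzag s t j \<noteq> \<one>"
proof
  assume one: "zigzag s t j = \<one>"
  have pow: "(Not \<circ> Not) ^^ n = id" for n
    by (induction n) (auto simp: fun_eq_iff)
  obtain \<rho> where \<rho>: "\<rho> \<in> hom W (perm_group (UNIV :: bool set))" "\<And>s. s \<in> S \<Longrightarrow> \<rho> s = Not"
    by (rule coxeter_hom[OF group_perm_group, of "\<lambda>_. Not" UNIV])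
      (auto simp: perm_group_pow pow intro!: involution_permutes)
  interpret \<rho>: group_hom W "perm_group (UNIV :: bool set)" \<rho>
    using \<rho>(1) by (simp add: group_hom_def group_hom_axioms_def group_perm_group is_group)
  have "zigzag s t j \<in> carrier W \<and> \<rho> (zigzag s t j) b = (odd j \<noteq> b)" for b j
  proof (induction j arbitrary: b)
    case (Suc j)
    then show ?case using assms \<rho>(2) by auto
  qed (use \<rho>.hom_one in simp)
  then have "\<rho> (zigzag s t j) False = True" using assms(3) by simp
  then show False using \<rho>.hom_one by (simp add: one)
qed

text \<open>Going around the coset \<open>w\<langle>s, t\<rangle>\<close> leads from \<open>w \<otimes> s\<close> to \<open>w \<otimes> t\<close> without
  passing through \<open>w\<close>.\<close>

lemma detour:
  assumes K: "K \<subseteq> S" and s: "s \<in> K" and t: "t \<in> K" and m: "m s t < \<infinity>" and w: "w \<in> carrier W"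
    and less: "len w < len (w \<otimes> s)" "len w < len (w \<otimes> t)"
  shows "(w \<otimes> s, w \<otimes> t) \<in> (moves K (Suc (len w)))\<^sup>*"
proof -
  have S: "s \<in> S" "t \<in> S" using K s t by auto
  have sub: "{s, t} \<subseteq> carrier W" using S by auto
  obtain n where n: "m s t = enat n" using m by (cases "m s t") auto
  \<comment> \<open>The order \<open>k\<close> of \<open>s \<otimes> t\<close> takes the place of
    the label \<open>n\<close>, which bounds it. By minimality of \<open>k\<close> the zigzags of
    length strictly between 0 and \<open>2 * k\<close> are nontrivial.\<close>
  define P where "P k \<longleftrightarrow> k > 0 \<and> (s \<otimes> t) [^] k = \<one>" for k :: nat
  have "P n" using coxeter_relation[OF S n] m_nonzero[OF S] n by (auto simp: P_def zero_enat_def)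
  define k where "k = (LEAST k. P k)"
  have k: "P k" unfolding k_def by (rule LeastI[of P, OF \<open>P n\<close>])
  have k_min: "\<not> P j" if "j < k" for j
    using that unfolding k_def by (rule not_less_Least)
  have zin: "zigzag s t j \<in> generate W {s, t}" for j
    by (induction j) (auto intro: generate.intros)
  have zW: "zigzag s t j \<in> carrier W" for j
    using zin generate_in_carrier[OF sub] by blast
  have longer: "Suc (len w) \<le> len (w \<otimes> zigzag s t j)" if "0 < j" "j < 2 * k" for j
  proof -
    have "zigzag s t j \<noteq> \<one>"
    proof (cases "even j")
      case True
      then obtain i where i: "j = 2 * i" by (elim evenE)
      then show ?thesis using zigzag_even[OF S, of i] k_min[of i] that by (auto simp: P_def)
    qed (use zigzag_odd_neq_one[OF S] in blast)
    then show ?thesis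
      using dihedral_coset_longer[OF S w less zin] by (simp add: Suc_le_eq)
  qed
  have path: "(w \<otimes> s, w \<otimes> zigzag s t (Suc j)) \<in> (moves K (Suc (len w)))\<^sup>*" if "Suc j < 2 * k" for j
    using that
  proof (induction j)
    case 0
    then show ?case using S by simp
  next
    case (Suc j)
    let ?x = "w \<otimes> zigzag s t (Suc j)" and ?a = "if even (Suc j) then s else t"
    have eq: "w \<otimes> zigzag s t (Suc (Suc j)) = ?x \<otimes> ?a"
      using w zW[of "Suc j"] S by (simp add: m_assoc del: zigzag.simps(2)) (simp add: m_assoc)
    have "(?x, ?x \<otimes> ?a) \<in> moves K (Suc (len w))"
      unfolding moves_def using longer[of "Suc j"] longer[of "Suc (Suc j)"] Suc.prems w zW[of "Suc j"] s t
      unfolding eq by (intro CollectI exI[of _ ?x] exI[of _ ?a]) auto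
    then show ?case
      unfolding eq using Suc.IH Suc.prems by (meson Suc_lessD rtrancl.rtrancl_into_rtrancl)
  qed
  have "zigzag s t (2 * k - 1) \<otimes> t = \<one>"
  proof -
    have "Suc (2 * k - 1) = 2 * k" "odd (2 * k - 1)" using k by (auto simp: P_def)
    then have "zigzag s t (2 * k) = zigzag s t (2 * k - 1) \<otimes> t"
      using zigzag.simps(2)[of s t "2 * k - 1"] by simp
    then show ?thesis using zigzag_even[OF S, of k] k by (simp add: P_def)
  qed
  then have "zigzag s t (2 * k - 1) = t"
    using zW[of "2 * k - 1"] S inv_equality[of "zigzag s t (2 * k - 1)" t] by simp
  moreover have "2 * k - 1 = Suc (2 * k - 2)" "Suc (2 * k - 2) < 2 * k" using k by (auto simp: P_def)
  ultimately show ?thesis using path[of "2 * k - 2"] by simp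
qed

definition ascents :: "'a set \<Rightarrow> 'a \<Rightarrow> 'a set" where
  "ascents K w = {s \<in> K. len w < len (w \<otimes> s)}"

definition ascents_connected :: "'a set \<Rightarrow> bool" where
  "ascents_connected K \<longleftrightarrow> (\<forall>w\<in>generate W K. \<forall>s\<in>ascents K w. \<forall>t\<in>ascents K w.
     (s, t) \<in> {(a, b). a \<in> ascents K w \<and> b \<in> ascents K w \<and> m a b < \<infinity>}\<^sup>*)"

lemma ascents_detour:
  assumes K: "K \<subseteq> S" and "ascents_connected K" and w: "w \<in> generate W K"
    and "s \<in> ascents K w" "t \<in> ascents K w"
  shows "(w \<otimes> s, w \<otimes> t) \<in> (moves K (Suc (len w)))\<^sup>*"
proof -
  have wW: "w \<in> carrier W" using w K gens_closed generate_in_carrier[of K] by auto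
  have "(s, t) \<in> {(a, b). a \<in> ascents K w \<and> b \<in> ascents K w \<and> m a b < \<infinity>}\<^sup>*"
    using assms by (auto simp: ascents_connected_def)
  then show ?thesis
  proof (induction rule: rtrancl_induct)
    case (step y z)
    then have "(w \<otimes> y, w \<otimes> z) \<in> (moves K (Suc (len w)))\<^sup>*"
      by (intro detour[OF K _ _ _ wW]) (auto simp: ascents_def)
    then show ?case using step.IH by (rule rtrancl_trans[rotated])
  qed simp
qed

text \<open>The vertices of length exactly \<open>r\<close> on a path of vertices of length at least
  \<open>r\<close> are avoided by detours.\<close>

lemma moves_connected:
  assumes K: "K \<subseteq> S" and conn: "ascents_connected K"
    and "x \<in> generate W K" "y \<in> generate W K" "r \<le> len x" "r \<le> len y"
  shows "(x, y) \<in> (moves K r)\<^sup>*"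
  using assms(3-6)
proof (induction r arbitrary: x y)
  case 0
  have sub: "K \<subseteq> carrier W" using K gens_closed by auto
  have D: "subgroup (generate W K) W" by (rule generate_is_subgroup[OF sub])
  have x: "x \<in> carrier W" "y \<in> carrier W" using 0 generate_in_carrier[OF sub] by auto
  have "inv x \<otimes> y \<in> generate W K"
    using 0 subgroup.m_closed[OF D subgroup.m_inv_closed[OF D]] by blast
  then obtain xs where xs: "xs \<in> lists K" "inv x \<otimes> y = wprod xs"
    using generate_wprod[OF K] by auto
  have "(z, z \<otimes> wprod xs) \<in> (moves K 0)\<^sup>*" if "xs \<in> lists K" "z \<in> carrier W" for z xs
    using that
  proof (induction xs arbitrary: z)
    case (Cons a xs)
    have a: "a \<in> S" "a \<in> K" "set xs \<subseteq> S" using Cons K by auto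
    have "(z, z \<otimes> a) \<in> moves K 0" using Cons a by (auto simp: moves_def)
    moreover have "(z \<otimes> a, z \<otimes> a \<otimes> wprod xs) \<in> (moves K 0)\<^sup>*" using Cons a by auto
    ultimately show ?case using Cons.prems a by (simp add: m_assoc)
  qed simp
  from this[OF xs(1) x(1)] show ?case
    using x by (simp flip: xs(2) add: m_assoc[symmetric])
next
  case (Suc r)
  have sub: "K \<subseteq> carrier W" using K gens_closed by auto
  let ?E = "(moves K (Suc r))\<^sup>*"
  have "(x, y) \<in> (moves K r)\<^sup>*" using Suc by simp
  \<comment> \<open>Invariant along the old path: a vertex longer than \<open>r\<close> is already
    reached by the new moves, and for a vertex of length \<open>r\<close> all its ascents lead to
    reached vertices. Neighbours differ in length, so a vertex of length \<open>r\<close> is entered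
    from one of these, and a detour joins it to the others.\<close>
  then have "y \<in> generate W K \<and> (Suc r \<le> len y \<longrightarrow> (x, y) \<in> ?E) \<and>
      (len y = r \<longrightarrow> (\<forall>s\<in>ascents K y. (x, y \<otimes> s) \<in> ?E))"
  proof (induction rule: rtrancl_induct)
    case base
    then show ?case using Suc.prems by simp
  next
    case (step y z)
    then obtain a where a: "a \<in> K" "z = y \<otimes> a" "r \<le> len y" "r \<le> len z" and y: "y \<in> carrier W"
      by (auto simp: moves_def)
    have aS: "a \<in> S" using a K by auto
    have z: "z \<in> generate W K" using step a by (auto intro: generate.intros)
    have za: "z \<otimes> a = y" using a aS y by simp
    show ?case
    proof (intro conjI impI ballI)
      show "z \<in> generate W K" by fact
      assume "Suc r \<le> len z"
      show "(x, z) \<in> ?E"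
      proof (cases "Suc r \<le> len y")
        case True
        then have "(y, z) \<in> moves K (Suc r)" using a y \<open>Suc r \<le> len z\<close> by (auto simp: moves_def)
        then show ?thesis using step.IH True by (meson rtrancl.rtrancl_into_rtrancl)
      next
        case False
        then have "len y = r" using a by simp
        moreover have "a \<in> ascents K y" using a \<open>Suc r \<le> len z\<close> \<open>len y = r\<close> by (simp add: ascents_def)
        ultimately show ?thesis using step.IH a by blast
      qed
    next
      fix s assume z': "len z = r" and s: "s \<in> ascents K z"
      have "len y \<noteq> len z"
        using len_less_iff[OF y aS] a(2) by (metis less_irrefl)
      then have y': "Suc r \<le> len y" using a z' by simp
      then have "a \<in> ascents K z" using a z' za by (simp add: ascents_def)
      from ascents_detour[OF K conn z this s] have "(y, z \<otimes> s) \<in> ?E" using za z' by simp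
      then show "(x, z \<otimes> s) \<in> ?E" using step.IH y' by (meson rtrancl_trans)
    qed
  qed
  then show ?case using Suc.prems by simp
qed

lemma finite_ball:
  assumes "finite S"
  shows "finite {w \<in> carrier W. len w < r}"
proof (rule finite_subset)
  show "{w \<in> carrier W. len w < r} \<subseteq> wprod ` {xs. set xs \<subseteq> S \<and> length xs \<le> r}"
  proof
    fix w assume w: "w \<in> {w \<in> carrier W. len w < r}"
    then obtain xs where "set xs \<subseteq> S" "w = wprod xs" "length xs = len w"
      using reduced_word[of w] by blast
    then show "w \<in> wprod ` {xs. set xs \<subseteq> S \<and> length xs \<le> r}" using w by (intro image_eqI) auto
  qed
qed (use finite_lists_length_le[OF assms] in simp)

text \<open>Only the finitely many elements of \<open>D\<close> have an edge with label in
  \<open>K\<close> along which membership in \<open>B\<close> changes. Outside a ball around them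
  membership is constant along moves, hence on the whole connected remainder.\<close>

lemma one_ended:
  assumes fin: "finite S" and K: "K \<subseteq> S" and conn: "ascents_connected K" and B: "almost_invariant W B"
  shows "finite (generate W K \<inter> B) \<or> finite (generate W K - B)"
proof -
  have sub: "K \<subseteq> carrier W" using K gens_closed by auto
  define D where "D = (\<Union>s\<in>K. {g \<in> carrier W. (g \<in> B) \<noteq> (g \<otimes> s \<in> B)})"
  have "finite D" using B K fin sub unfolding D_def almost_invariant_def by (auto dest: finite_subset)
  define r where "r = Suc (Max (insert 0 (len ` D)))"
  have r: "len g < r" if "g \<in> D" for g
    using that \<open>finite D\<close> by (auto simp: r_def less_Suc_eq_le intro: Max_ge)
  have const: "x \<in> B \<longleftrightarrow> y \<in> B" if "(x, y) \<in> (moves K r)\<^sup>*" for x y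
    using that
  proof (induction rule: rtrancl_induct)
    case (step y z)
    then obtain a where a: "a \<in> K" "z = y \<otimes> a" "r \<le> len y" "y \<in> carrier W" by (auto simp: moves_def)
    then have "y \<notin> D" using r[of y] by auto
    then show ?case using step.IH a by (auto simp: D_def)
  qed simp
  let ?ball = "{w \<in> carrier W. len w < r}"
  have ball: "finite ?ball" by (rule finite_ball[OF fin])
  have gen: "generate W K \<subseteq> carrier W" using generate_incl[OF sub] .
  have same: "x \<in> B \<longleftrightarrow> y \<in> B" if "x \<in> generate W K - ?ball" "y \<in> generate W K - ?ball" for x y
    using that gen by (intro const moves_connected[OF K conn]) auto
  show ?thesis
  proof (cases "\<exists>x\<in>generate W K - ?ball. x \<in> B")
    case True
    then have "generate W K - B \<subseteq> ?ball" using same by blast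
    then show ?thesis using ball finite_subset by blast
  next
    case False
    then have "generate W K \<inter> B \<subseteq> ?ball" using gen by blast
    then show ?thesis using ball finite_subset by blast
  qed
qed

theorem virtually_free_special_finite:
  assumes "virtually_free W" and fin: "finite S" and K: "K \<subseteq> S" and conn: "ascents_connected K"
  shows "finite (generate W K)"
proof (rule ccontr)
  assume inf: "infinite (generate W K)"
  have sub: "K \<subseteq> carrier W" using K gens_closed by auto
  obtain B where "almost_invariant W B" "infinite (generate W K \<inter> B)" "infinite (generate W K - B)"
    using virtually_free_split[OF assms(1) generate_is_subgroup[OF sub] inf] by blast
  then show False using one_ended[OF fin K conn] by blast
qed

lemma complete_ascents_connected:
  assumes "K \<subseteq> S" "\<And>s t. s \<in> K \<Longrightarrow> t \<in> K \<Longrightarrow> m s t < \<infinity>"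
  shows "ascents_connected K"
  unfolding ascents_connected_def
proof (intro ballI)
  fix w s t assume "s \<in> ascents K w" "t \<in> ascents K w"
  then have "(s, t) \<in> {(a, b). a \<in> ascents K w \<and> b \<in> ascents K w \<and> m a b < \<infinity>}"
    using assms(2) by (auto simp: ascents_def)
  then show "(s, t) \<in> {(a, b). a \<in> ascents K w \<and> b \<in> ascents K w \<and> m a b < \<infinity>}\<^sup>*" by blast
qed

lemma induced_edge_iff:
  assumes "A \<subseteq> S" "s \<in> A" "t \<in> A" "s \<noteq> t"
  shows "{s, t} \<in> ledges (induced_lgraph (presentation_diagram S m) A) \<longleftrightarrow> m s t < \<infinity>"
proof
  assume "{s, t} \<in> ledges (induced_lgraph (presentation_diagram S m) A)"
  then obtain s' t' where "{s, t} = {s', t'}" "s' \<in> S" "t' \<in> S" "m s' t' < \<infinity>"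
    by (auto simp: induced_lgraph_def presentation_diagram_def)
  then show "m s t < \<infinity>" using m_sym[of s t] by (auto simp: doubleton_eq_iff)
next
  assume "m s t < \<infinity>"
  then show "{s, t} \<in> ledges (induced_lgraph (presentation_diagram S m) A)"
    using assms by (auto simp: induced_lgraph_def presentation_diagram_def)
qed

lemma m_self: "s \<in> S \<Longrightarrow> m s s < \<infinity>"
  using m_eq_1_iff[of s s] by (simp add: one_enat_def)

lemma complete_imp_finite_labels:
  assumes "K \<subseteq> S" "complete_lgraph (induced_lgraph (presentation_diagram S m) K)" "s \<in> K" "t \<in> K"
  shows "m s t < \<infinity>"
proof (cases "s = t")
  case False
  then have "{s, t} \<in> ledges (induced_lgraph (presentation_diagram S m) K)"
    using assms by (auto simp: complete_lgraph_def induced_lgraph_def)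
  then show ?thesis using induced_edge_iff[OF assms(1,3,4) False] by blast
qed (use assms m_self in auto)

text \<open>The right descents of \<open>w\<close> span a complete subgraph, hence are contained in two neighbouring
  vertices of the circuit, and the rest of the circuit is connected.\<close>

lemma circuit_ascents:
  assumes fin: "finite S" and A: "A \<subseteq> S" "card A > 3"
    and circ: "circuit_lgraph (induced_lgraph (presentation_diagram S m) A)"
  shows "ascents_connected A" "infinite (generate W A)"
proof -
  obtain n c where n: "n \<ge> 3" "bij_betw c {..<n} A"
    "ledges (induced_lgraph (presentation_diagram S m) A) = {{c i, c (Suc i mod n)} | i. i < n}"
    using circ by (auto simp: circuit_lgraph_def induced_lgraph_def)
  have "n = card A" using bij_betw_same_card[OF n(2)] by simp
  then have n4: "n \<ge> 4" using A(2) by simp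
  \<comment> \<open>Periodic indexing lets a window of \<open>n\<close> consecutive vertices start
    anywhere on the circuit.\<close>
  define d where "d k = c (k mod n)" for k
  have dA: "d k \<in> A" for k using n(2) n4 by (auto simp: d_def bij_betw_def)
  have d_eq: "d k = d l \<longleftrightarrow> k mod n = l mod n" for k l
    using n(2) n4 by (auto simp: d_def bij_betw_def inj_on_def)
  have window: "\<exists>j<n. a = d (k + j)" if a: "a \<in> A" for a k
  proof -
    obtain i where i: "i < n" "a = c i" using a n(2) by (auto simp: bij_betw_def)
    have "(k + (i + (n - k mod n)) mod n) mod n = (k mod n + (i + (n - k mod n))) mod n"
      by (simp add: mod_add_eq mod_add_left_eq mod_add_right_eq)
    also have "k mod n + (i + (n - k mod n)) = i + n"
    proof -
      have "k mod n < n" using n4 by simp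
      then show ?thesis by linarith
    qed
    also have "(i + n) mod n = i" using i by simp
    finally have "a = d (k + (i + (n - k mod n)) mod n)" using i by (simp add: d_def)
    moreover have "(i + (n - k mod n)) mod n < n" using n4 by simp
    ultimately show ?thesis by blast
  qed
  have adj: "m (d k) (d (Suc k)) < \<infinity>" "m (d (Suc k)) (d k) < \<infinity>" for k
  proof -
    have ne: "d k \<noteq> d (Suc k)" using mod_shift_neq[of 0 1 n k] n4 by (simp add: d_eq)
    have "{d k, d (Suc k)} \<in> ledges (induced_lgraph (presentation_diagram S m) A)"
      unfolding n(3) d_def using n4
      by (intro CollectI exI[of _ "k mod n"]) (simp add: mod_Suc_eq)
    then show "m (d k) (d (Suc k)) < \<infinity>"
      using induced_edge_iff[OF A(1) dA dA ne] by blast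
    then show "m (d (Suc k)) (d k) < \<infinity>"
      using m_sym[OF subsetD[OF A(1) dA] subsetD[OF A(1) dA], of k "Suc k"] by simp
  qed
  have nonadj: "m (d k) (d (k + j)) = \<infinity>" if j: "2 \<le> j" "j \<le> n - 2" for k j
  proof -
    have jn: "j + 2 \<le> n" using j n4 by linarith
    have ne: "d k \<noteq> d (k + j)" using mod_shift_neq[of 0 j n k] j(1) jn by (simp add: d_eq)
    have "{d k, d (k + j)} \<noteq> {c i, c (Suc i mod n)}" if i: "i < n" for i
    proof
      assume "{d k, d (k + j)} = {c i, c (Suc i mod n)}"
      then have "{d k, d (k + j)} = {d i, d (Suc i)}" using i by (simp add: d_def)
      then consider "d k = d i" "d (k + j) = d (Suc i)" | "d k = d (Suc i)" "d (k + j) = d i"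
        by (auto simp: doubleton_eq_iff)
      then show False
      proof cases
        case 1
        then have "(k + 1) mod n = (k + j) mod n" by (metis Suc_eq_plus1 d_eq mod_Suc_eq)
        then show False using mod_shift_neq[of 1 j n k] j(1) jn by simp
      next
        case 2
        then have "(k + 0) mod n = (k + Suc j) mod n" by (metis Nat.add_0_right add_Suc_right d_eq mod_Suc_eq)
        then show False using mod_shift_neq[of 0 "Suc j" n k] j(1) jn by simp
      qed
    qed
    then have "{d k, d (k + j)} \<notin> ledges (induced_lgraph (presentation_diagram S m) A)"
      unfolding n(3) by blast
    then show ?thesis using induced_edge_iff[OF A(1) dA dA ne] by simp
  qed
  have sub: "A \<subseteq> carrier W" using A(1) gens_closed by auto
  have desc: "m s t < \<infinity>" if "w \<in> generate W A" "s \<in> A - ascents A w" "t \<in> A - ascents A w" for w s t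
  proof -
    have w: "w \<in> carrier W" using that generate_in_carrier[OF sub] by blast
    have st: "s \<in> S" "t \<in> S" using that A(1) by auto
    then show ?thesis
      using that by (intro two_descents_finite[OF fin st w]) (auto simp: ascents_def len_less_iff[OF w])
  qed
  show "infinite (generate W A)"
  proof
    assume f: "finite (generate W A)"
    have ne: "len ` generate W A \<noteq> {}" using generate.one[of W A] by auto
    obtain w where w: "w \<in> generate W A" "len w = Max (len ` generate W A)"
      using Max_in[OF finite_imageI[OF f] ne] by auto
    have max: "len v \<le> len w" if "v \<in> generate W A" for v
      using that f w(2) by simp
    have "len (w \<otimes> s) \<le> len w" if "s \<in> A" for s
      by (rule max) (use that w(1) in \<open>auto intro: generate.intros\<close>)
    then have "ascents A w = {}"
      by (auto simp: ascents_def leD)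
    \<comment> \<open>A longest element has every vertex of the circuit as a descent, in particular
      the nonadjacent \<open>d 0\<close> and \<open>d 2\<close>.\<close>
    then have "m (d 0) (d (0 + 2)) < \<infinity>"
      using desc[OF w(1)] dA by blast
    then show False using nonadj[of 2 0] n4 by simp
  qed
  show "ascents_connected A" unfolding ascents_connected_def
  proof (intro ballI)
    fix w s t assume w: "w \<in> generate W A" and s: "s \<in> ascents A w" and t: "t \<in> ascents A w"
    define D where "D = A - ascents A w"
    have DD: "m a b \<noteq> \<infinity>" if "a \<in> D" "b \<in> D" for a b
      using desc[OF w, of a b] that by (auto simp: D_def)
    \<comment> \<open>Descents are pairwise adjacent or equal, and a circuit with
      \<open>n \<ge> 4\<close> has no triangle, so they lie on one edge. Without descents any
      \<open>k\<close> serves.\<close>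
    obtain k where k: "D \<subseteq> {d k, d (Suc k)}"
    proof (cases "D = {}")
      case False
      then obtain i where i: "d i \<in> D" using window[of _ 0] by (auto simp: D_def)
      have pos: "j \<in> {0, 1, n - 1}" if "j < n" "d (i + j) \<in> D" for j
        using DD[OF i that(2)] nonadj[of j i] that(1) by (cases "2 \<le> j \<and> j \<le> n - 2") auto
      have D_pos: "x \<in> {d i, d (Suc i), d (i + (n - 1))}" if "x \<in> D" for x
      proof -
        obtain j where "j < n" "x = d (i + j)" using window[of x i] \<open>x \<in> D\<close> by (auto simp: D_def)
        then show ?thesis using pos[of j] \<open>x \<in> D\<close> by auto
      qed
      show ?thesis
      proof (cases "d (Suc i) \<in> D")
        case True
        have "d (i + (n - 1)) \<notin> D"
          using nonadj[of "n - 2" "Suc i"] DD[OF True, of "d (i + (n - 1))"] n4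
          by (auto simp: numeral_2_eq_2 Suc_diff_Suc)
        then have "D \<subseteq> {d i, d (Suc i)}" using D_pos by blast
        then show ?thesis by (rule that)
      next
        case False
        have eq: "d (Suc (i + (n - 1))) = d i" using n4 by (simp add: d_eq)
        have "D \<subseteq> {d (i + (n - 1)), d i}" using D_pos False by blast
        then show ?thesis by (intro that[of "i + (n - 1)"]) (simp only: eq)
      qed
    qed (use that in auto)
    define R where "R = {(a, b). a \<in> ascents A w \<and> b \<in> ascents A w \<and> m a b < \<infinity>}"
    have "sym R"
      using m_sym A(1) by (auto simp: R_def sym_def ascents_def subset_iff)
    have asc: "d (k + j) \<in> ascents A w" if "2 \<le> j" "j < n" for j
    proof -
      have "d (k + j) \<noteq> d k" "d (k + j) \<noteq> d (Suc k)"
        using mod_shift_neq[of 0 j n k] mod_shift_neq[of 1 j n k] that by (simp_all add: d_eq eq_commute)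
      then show ?thesis using k dA[of "k + j"] by (auto simp: D_def)
    qed
    \<comment> \<open>The arc from \<open>d (k + 2)\<close> to \<open>d (k + (n - 1))\<close>
      consists of ascents. If \<open>d k\<close> or \<open>d (k + 1)\<close> is an ascent too, it is
      attached to an end of this arc.\<close>
    have chain: "(d (k + 2), d (k + (2 + j))) \<in> R\<^sup>*" if "2 + j < n" for j
      using that
    proof (induction j)
      case (Suc j)
      then have "(d (k + (2 + j)), d (k + (2 + Suc j))) \<in> R"
        using asc[of "2 + j"] asc[of "2 + Suc j"] adj[of "k + (2 + j)"] by (simp add: R_def)
      moreover have "(d (k + 2), d (k + (2 + j))) \<in> R\<^sup>*" using Suc by simp
      ultimately show ?case by (rule rtrancl.rtrancl_into_rtrancl[rotated])
    qed simp
    have all: "(d (k + 2), a) \<in> R\<^sup>*" if a: "a \<in> ascents A w" for a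
    proof -
      obtain j where j: "j < n" "a = d (k + j)" using window[of a k] a by (auto simp: ascents_def)
      consider "2 \<le> j" | "j = 0" | "j = 1" by linarith
      then show ?thesis
      proof cases
        case 1
        then obtain i where "j = 2 + i" using le_Suc_ex by blast
        then show ?thesis using chain[of i] j by (simp only:)
      next
        case 2
        have "Suc (k + (2 + (n - 3))) = k + n" using n4 by linarith
        then have "d (Suc (k + (2 + (n - 3)))) = d k" by (simp only: d_eq mod_add_self2)
        then have "(d (k + (2 + (n - 3))), a) \<in> R"
          using asc[of "2 + (n - 3)"] adj(1)[of "k + (2 + (n - 3))"] a 2 j n4 by (simp add: R_def)
        moreover have "(d (k + 2), d (k + (2 + (n - 3)))) \<in> R\<^sup>*" using chain[of "n - 3"] n4 by simp
        ultimately show ?thesis by (rule rtrancl.rtrancl_into_rtrancl[rotated])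
      next
        case 3
        then have "(d (k + 2), a) \<in> R"
          using asc[of 2] adj(2)[of "Suc k"] a j n4 by (simp add: R_def numeral_2_eq_2)
        then show ?thesis by blast
      qed
    qed
    have "(s, d (k + 2)) \<in> R\<^sup>*"
      using all[OF s] sym_rtrancl[OF \<open>sym R\<close>] by (meson symD)
    then show "(s, t) \<in> {(a, b). a \<in> ascents A w \<and> b \<in> ascents A w \<and> m a b < \<infinity>}\<^sup>*"
      using all[OF t] unfolding R_def by (rule rtrancl_trans)
  qed
qed

theorem virtually_free_imp_diagram:
  assumes "virtually_free W" "finite S"
  shows "\<forall>K\<subseteq>S. complete_lgraph (induced_lgraph (presentation_diagram S m) K) \<longrightarrow> finite (generate W K)"
    and "\<not> (\<exists>A\<subseteq>S. card A > 3 \<and> circuit_lgraph (induced_lgraph (presentation_diagram S m) A))"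
proof -
  show "\<forall>K\<subseteq>S. complete_lgraph (induced_lgraph (presentation_diagram S m) K) \<longrightarrow> finite (generate W K)"
  proof (intro allI impI)
    fix K assume K: "K \<subseteq> S" "complete_lgraph (induced_lgraph (presentation_diagram S m) K)"
    show "finite (generate W K)"
      using complete_imp_finite_labels[OF K] complete_ascents_connected[OF K(1)]
      by (intro virtually_free_special_finite[OF assms K(1)]) blast
  qed
  show "\<not> (\<exists>A\<subseteq>S. card A > 3 \<and> circuit_lgraph (induced_lgraph (presentation_diagram S m) A))"
  proof
    assume "\<exists>A\<subseteq>S. card A > 3 \<and> circuit_lgraph (induced_lgraph (presentation_diagram S m) A)"
    then obtain A where A: "A \<subseteq> S" "card A > 3"
      "circuit_lgraph (induced_lgraph (presentation_diagram S m) A)" by blast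
    note circuit_ascents[OF assms(2) A]
    then show False using virtually_free_special_finite[OF assms A(1)] by blast
  qed
qed

end

section \<open>Chordal diagrams and trees of cliques\<close>

section \<open>Chordal graphs\<close>

definition chordless_cycle :: "('a \<Rightarrow> 'a \<Rightarrow> bool) \<Rightarrow> (nat \<Rightarrow> 'a) \<Rightarrow> nat \<Rightarrow> bool" where
  "chordless_cycle adj c n \<longleftrightarrow> n \<ge> 4 \<and> inj_on c {..<n} \<and>
    (\<forall>i<n. \<forall>j<n. adj (c i) (c j) \<longleftrightarrow> j = Suc i mod n \<or> i = Suc j mod n)"

definition chordal_on :: "('a \<Rightarrow> 'a \<Rightarrow> bool) \<Rightarrow> 'a set \<Rightarrow> bool" where
  "chordal_on adj V \<longleftrightarrow> \<not> (\<exists>c n. chordless_cycle adj c n \<and> c ` {..<n} \<subseteq> V)"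

definition clique :: "('a \<Rightarrow> 'a \<Rightarrow> bool) \<Rightarrow> 'a set \<Rightarrow> bool" where
  "clique adj K \<longleftrightarrow> (\<forall>x\<in>K. \<forall>y\<in>K. x \<noteq> y \<longrightarrow> adj x y)"

text \<open>A shortest path from \<open>z\<close> to \<open>z'\<close> has no chords, and
  \<open>u\<close> is adjacent to its ends but not to its interior, which lies in \<open>Q\<close>.
  As \<open>z\<close> and \<open>z'\<close> are distinct and not adjacent, the path has at least two
  edges, so adding \<open>u\<close> gives a cycle of at least four vertices.\<close>

lemma shortest_path_closes_cycle:
  assumes symp: "symp adj" and irrefl: "irreflp adj"
    and conn: "(z, z') \<in> {(a, b). a \<in> insert z (insert z' Q) \<and> b \<in> insert z (insert z' Q) \<and> adj a b}\<^sup>*"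
    and z: "z \<noteq> z'" "\<not> adj z z'" and u: "adj u z" "adj u z'" "u \<notin> insert z (insert z' Q)" "\<And>q. q \<in> Q \<Longrightarrow> \<not> adj u q"
  obtains c n where "chordless_cycle adj c n" "c ` {..<n} \<subseteq> insert u (insert z (insert z' Q))"
proof -
  note sym = sympD[OF symp] and irr = irreflpD[OF irrefl]
  define R where "R = {(a, b). a \<in> insert z (insert z' Q) \<and> b \<in> insert z (insert z' Q) \<and> adj a b}"
  define k where "k = (LEAST k. (z, z') \<in> R ^^ k)"
  have "\<exists>k. (z, z') \<in> R ^^ k"
    using conn unfolding R_def[symmetric] by (rule rtrancl_imp_relpow)
  then have k: "(z, z') \<in> R ^^ k" unfolding k_def by (rule LeastI_ex)
  have k_min: "k \<le> l" if "(z, z') \<in> R ^^ l" for l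
    unfolding k_def using that by (rule Least_le)
  obtain f where f: "f 0 = z" "f k = z'" "\<And>i. i < k \<Longrightarrow> (f i, f (Suc i)) \<in> R"
    using k unfolding relpow_fun_conv by blast
  have seg: "(f i, f j) \<in> R ^^ (j - i)" if "i \<le> j" "j \<le> k" for i j
    unfolding relpow_fun_conv
    by (rule exI[of _ "\<lambda>l. f (i + l)"]) (use that f(3) in auto)
  have ne: "f i \<noteq> f j" if "i < j" "j \<le> k" for i j
  proof
    assume eq: "f i = f j"
    have "(z, z') \<in> R ^^ (i + (k - j))"
      unfolding relpow_add using seg[of 0 i] seg[of j k] that eq f by auto
    from k_min[OF this] show False using that by simp
  qed
  have no_chord: "j = Suc i" if "i < j" "j \<le> k" "adj (f i) (f j)" for i j
  proof -
    have in_set: "f l \<in> insert z (insert z' Q)" if "l \<le> k" for l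
      using f(3)[of l] f(2) that by (cases "l = k") (auto simp: R_def)
    have "(f i, f j) \<in> R" using that in_set[of i] in_set[of j] by (auto simp: R_def)
    then have "(z, f j) \<in> R ^^ Suc i" using seg[of 0 i] that f(1) by auto
    then have "(z, z') \<in> R ^^ (Suc i + (k - j))"
      unfolding relpow_add using seg[of j k] that f(2) by auto
    from k_min[OF this] show ?thesis using that by simp
  qed
  have "k \<noteq> 0" using f z by (metis)
  moreover have "k \<noteq> 1" using f z f(3)[of 0] by (auto simp: R_def)
  ultimately have k2: "k \<ge> 2" by simp
  have inQ: "f i \<in> Q" if "0 < i" "i < k" for i
    using f(3)[OF that(2)] ne[of 0 i] ne[of i k] f(1,2) that by (auto simp: R_def)
  define c where "c i = (if i \<le> k then f i else u)" for i
  have in_all: "c i \<in> insert u (insert z (insert z' Q))" for i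
    using inQ[of i] f by (cases "i = 0"; cases "i = k") (auto simp: c_def)
  have fu: "f i \<noteq> u" if "i \<le> k" for i
    using inQ[of i] f u(3) that by (cases "i = 0"; cases "i = k") auto
  have adj_f: "adj (f i) (f j) \<longleftrightarrow> j = Suc i \<or> i = Suc j" if "i \<le> k" "j \<le> k" for i j
  proof
    assume a: "adj (f i) (f j)"
    show "j = Suc i \<or> i = Suc j"
      using no_chord[of i j] no_chord[of j i] a sym[OF a] irr that by (cases i j rule: linorder_cases) auto
  next
    assume "j = Suc i \<or> i = Suc j"
    then show "adj (f i) (f j)" using f(3)[of i] f(3)[of j] that sym by (auto simp: R_def)
  qed
  have adj_u: "adj u (f i) \<longleftrightarrow> i = 0 \<or> i = k" if "i \<le> k" for i
    using inQ[of i] u f that by (cases "i = 0"; cases "i = k") auto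
  have "chordless_cycle adj c (k + 2)"
    unfolding chordless_cycle_def
  proof (intro conjI allI impI)
    show "4 \<le> k + 2" using k2 by simp
    show "inj_on c {..<k + 2}"
    proof (rule linorder_inj_onI')
      fix i j assume "i \<in> {..<k + 2}" "j \<in> {..<k + 2}" "i < j"
      then show "c i \<noteq> c j" using ne[of i j] fu[of i] by (cases "j \<le> k") (auto simp: c_def)
    qed
    fix i j assume "i < k + 2" "j < k + 2"
    then consider "i \<le> k" "j \<le> k" | "i = k + 1" "j \<le> k" | "i \<le> k" "j = k + 1" | "i = k + 1" "j = k + 1"
      by linarith
    then show "adj (c i) (c j) \<longleftrightarrow> j = Suc i mod (k + 2) \<or> i = Suc j mod (k + 2)"
    proof cases
      case 1
      then show ?thesis using adj_f[of i j] by (simp add: c_def)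
    next
      case 2
      then show ?thesis using adj_u[of j] by (auto simp: c_def)
    next
      case 3
      then show ?thesis using adj_u[of i] sym by (auto simp: c_def)
    next
      case 4
      then show ?thesis using irr by (auto simp: c_def)
    qed
  qed
  then show ?thesis using in_all by (intro that) auto
qed

text \<open>Take a connected set \<open>Q\<close> that is maximal among those not dominating \<open>V\<close>, let \<open>Z\<close> be its
  neighbourhood and \<open>U\<close> the rest. By maximality every vertex of \<open>Z\<close> is adjacent to all of \<open>U\<close>, and
  since a shortest path through \<open>Q\<close> and a vertex of \<open>U\<close> close up to a chordless cycle, \<open>Z\<close> is a
  clique. So a simplicial vertex of \<open>U\<close> is simplicial in \<open>V\<close>.\<close>

lemma simplicial_vertex:
  assumes symp: "symp adj" and irrefl: "irreflp adj"
    and "finite V" "V \<noteq> {}" "chordal_on adj V"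
  shows "\<exists>v\<in>V. clique adj {x \<in> V. adj v x}"
  using assms(3-5)
proof (induction "card V" arbitrary: V rule: less_induct)
  case less
  note sym = sympD[OF symp] and irr = irreflpD[OF irrefl]
  note fin = \<open>finite V\<close>
  define nb where "nb Q = {v \<in> V - Q. \<exists>q\<in>Q. adj q v}" for Q
  define conn where "conn Q \<longleftrightarrow> (\<forall>x\<in>Q. \<forall>y\<in>Q. (x, y) \<in> {(a, b). a \<in> Q \<and> b \<in> Q \<and> adj a b}\<^sup>*)" for Q
  define good where "good Q \<longleftrightarrow> Q \<subseteq> V \<and> Q \<noteq> {} \<and> conn Q \<and> Q \<union> nb Q \<noteq> V" for Q
  show ?case
  proof (cases "\<exists>Q. good Q")
    case False
    \<comment> \<open>Here every single vertex dominates \<open>V\<close>, so \<open>V\<close> is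
      complete and any vertex is simplicial.\<close>
    obtain v where v: "v \<in> V" using \<open>V \<noteq> {}\<close> by blast
    have all: "adj x y" if "x \<in> V" "y \<in> V" "x \<noteq> y" for x y
    proof -
      have "conn {x}" by (simp add: conn_def)
      then have "{x} \<union> nb {x} = V" using False that by (auto simp: good_def)
      then show ?thesis using that by (auto simp: nb_def)
    qed
    then have "clique adj {x \<in> V. adj v x}" by (auto simp: clique_def)
    then show ?thesis using v by blast
  next
    case True
    then obtain Q0 where Q0: "good Q0" by blast
    have "card Q < Suc (card V)" if "good Q" for Q
      using that fin by (auto simp: good_def less_Suc_eq_le intro: card_mono)
    then have "\<exists>Q. good Q \<and> (\<forall>Q'. good Q' \<longrightarrow> card Q' \<le> card Q)"
      by (intro ex_has_greatest_nat[of good Q0 card "Suc (card V)", OF Q0]) blast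
    then obtain Q where Q: "good Q" and max: "\<And>Q'. good Q' \<Longrightarrow> card Q' \<le> card Q" by blast
    have QV: "Q \<subseteq> V" "Q \<noteq> {}" "conn Q" using Q by (auto simp: good_def)
    have finQ: "finite Q" using QV(1) fin finite_subset by blast
    define U where "U = V - Q - nb Q"
    have nbV: "nb Q \<subseteq> V" by (auto simp: nb_def)
    have U: "U \<noteq> {}" "U \<subseteq> V" using Q QV nbV by (auto simp: U_def good_def)
    have U_Q: "\<not> adj u q" "\<not> adj q u" if "u \<in> U" "q \<in> Q" for u q
      using that sym by (auto simp: U_def nb_def)
    \<comment> \<open>Otherwise \<open>insert z Q\<close> would be a larger connected set that still
      does not dominate \<open>u\<close>.\<close>
    have ZU: "adj z u" if z: "z \<in> nb Q" and u: "u \<in> U" for z u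
    proof (rule ccontr)
      assume na: "\<not> adj z u"
      have zQ: "z \<in> V" "z \<notin> Q" using z by (auto simp: nb_def)
      obtain q where q: "q \<in> Q" "adj q z" using z by (auto simp: nb_def)
      let ?R = "{(a, b). a \<in> insert z Q \<and> b \<in> insert z Q \<and> adj a b}"
      have inQ: "(x, y) \<in> ?R\<^sup>*" if "x \<in> Q" "y \<in> Q" for x y
      proof -
        have "{(a, b). a \<in> Q \<and> b \<in> Q \<and> adj a b} \<subseteq> ?R" by auto
        from rtrancl_mono[OF this] show ?thesis using QV(3) that unfolding conn_def by blast
      qed
      have qz: "(q, z) \<in> ?R" "(z, q) \<in> ?R" using q sym by auto
      have "(x, y) \<in> ?R\<^sup>*" if "x \<in> insert z Q" "y \<in> insert z Q" for x y
      proof -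
        have "(x, q) \<in> ?R\<^sup>*" using that(1) inQ[of x q] q(1) qz(2) by auto
        moreover have "(q, y) \<in> ?R\<^sup>*" using that(2) inQ[of q y] q(1) qz(1) by auto
        ultimately show ?thesis by (rule rtrancl_trans)
      qed
      then have "conn (insert z Q)" by (simp add: conn_def)
      moreover have "u \<notin> insert z Q \<union> nb (insert z Q)"
        using u z na U_Q[OF u] by (auto simp: U_def nb_def)
      ultimately have "good (insert z Q)" using zQ QV U u by (auto simp: good_def)
      from max[OF this] show False using zQ finQ by simp
    qed
    have ZZ: "adj z z'" if z: "z \<in> nb Q" "z' \<in> nb Q" "z \<noteq> z'" for z z'
    proof (rule ccontr)
      assume na: "\<not> adj z z'"
      obtain u where u: "u \<in> U" using U by blast
      let ?R = "{(a, b). a \<in> insert z (insert z' Q) \<and> b \<in> insert z (insert z' Q) \<and> adj a b}"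
      obtain q q' where q: "q \<in> Q" "adj q z" "q' \<in> Q" "adj q' z'" using z by (auto simp: nb_def)
      have "(q, q') \<in> {(a, b). a \<in> Q \<and> b \<in> Q \<and> adj a b}\<^sup>*" using QV(3) q by (auto simp: conn_def)
      moreover have "{(a, b). a \<in> Q \<and> b \<in> Q \<and> adj a b} \<subseteq> ?R" by auto
      ultimately have "(q, q') \<in> ?R\<^sup>*" using rtrancl_mono by blast
      moreover have "(z, q) \<in> ?R" "(q', z') \<in> ?R" using q sym by auto
      ultimately have path: "(z, z') \<in> ?R\<^sup>*"
        by (meson converse_rtrancl_into_rtrancl rtrancl.rtrancl_into_rtrancl)
      have uz: "adj u z" "adj u z'" using ZU[THEN sym] z u by blast+
      have uQ: "u \<notin> insert z (insert z' Q)" using u z by (auto simp: U_def)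
      obtain c n where c: "chordless_cycle adj c n" "c ` {..<n} \<subseteq> insert u (insert z (insert z' Q))"
        using shortest_path_closes_cycle[OF symp irrefl path z(3) na uz uQ U_Q(1)[OF u]] by blast
      have "insert u (insert z (insert z' Q)) \<subseteq> V" using u z QV U by (auto simp: nb_def)
      with c(2) have "c ` {..<n} \<subseteq> V" by (rule subset_trans)
      with c(1) show False using \<open>chordal_on adj V\<close> by (auto simp: chordal_on_def)
    qed
    have "card U < card V"
      using QV U fin by (intro psubset_card_mono) (auto simp: U_def)
    moreover have "finite U" using U fin finite_subset by blast
    moreover have "chordal_on adj U"
      using \<open>chordal_on adj V\<close> U(2) unfolding chordal_on_def by (meson subset_trans)
    ultimately obtain v where v: "v \<in> U" "clique adj {x \<in> U. adj v x}"
      using less.hyps[of U] U(1) by blast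
    have "clique adj {x \<in> V. adj v x}"
      unfolding clique_def
    proof (intro ballI impI)
      fix x y assume xy: "x \<in> {x \<in> V. adj v x}" "y \<in> {x \<in> V. adj v x}" "x \<noteq> y"
      have "x \<in> U \<or> x \<in> nb Q" "y \<in> U \<or> y \<in> nb Q" using xy U_Q(1)[OF v(1)] by (auto simp: U_def)
      then consider "x \<in> U" "y \<in> U" | "x \<in> nb Q" "y \<in> U" | "x \<in> U" "y \<in> nb Q" | "x \<in> nb Q" "y \<in> nb Q"
        by blast
      then show "adj x y"
      proof cases
        case 1
        then show ?thesis using v(2) xy by (simp add: clique_def)
      next
        case 2
        then show ?thesis by (rule ZU)
      next
        case 3
        then show ?thesis by (intro sym[OF ZU])
      next
        case 4
        then show ?thesis using xy(3) by (rule ZZ)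
      qed
    qed
    then show ?thesis using v U by blast
  qed
qed

text \<open>A simplicial vertex is placed last. Its earlier neighbours are then all its neighbours
  in \<open>V\<close>, and the others are ordered by induction.\<close>

lemma elimination_ordering:
  assumes symp: "symp adj" and irrefl: "irreflp adj"
    and "finite V" "chordal_on adj V"
  shows "\<exists>c. bij_betw c {..<card V} V \<and> (\<forall>i<card V. clique adj {c j | j. j < i \<and> adj (c i) (c j)})"
  using assms(3,4)
proof (induction "card V" arbitrary: V)
  case 0
  then show ?case by (auto simp: bij_betw_def)
next
  case (Suc n)
  then obtain v where v: "v \<in> V" "clique adj {x \<in> V. adj v x}"
    using simplicial_vertex[OF symp irrefl] by (metis card.empty nat.distinct(1))
  have n: "n = card (V - {v})" using Suc.hyps(2) v(1) Suc.prems(1) by simp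
  have "chordal_on adj (V - {v})"
    using Suc.prems(2) unfolding chordal_on_def by (meson Diff_subset subset_trans)
  then obtain c where c: "bij_betw c {..<n} (V - {v})"
    "\<And>i. i < n \<Longrightarrow> clique adj {c j | j. j < i \<and> adj (c i) (c j)}"
    using Suc.hyps(1)[OF n] Suc.prems(1) n by auto
  define c' where "c' = c(n := v)"
  have "bij_betw c' {..<n} (V - {v})"
    using c(1) by (subst bij_betw_cong[of _ _ c]) (auto simp: c'_def)
  then have "bij_betw c' ({..<n} \<union> {n}) ((V - {v}) \<union> {c' n})"
    by (intro notIn_Un_bij_betw) (auto simp: c'_def)
  moreover have "{..<n} \<union> {n} = {..<card V}" "(V - {v}) \<union> {c' n} = V"
    using Suc.hyps(2) v(1) by (auto simp: c'_def)
  ultimately have "bij_betw c' {..<card V} V" by simp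
  moreover have "clique adj {c' j | j. j < i \<and> adj (c' i) (c' j)}" if "i < card V" for i
  proof (cases "i = n")
    case True
    have "{c' j | j. j < i \<and> adj (c' i) (c' j)} \<subseteq> {x \<in> V. adj v x}"
      using True c(1) by (auto simp: c'_def bij_betw_def)
    then show ?thesis using v(2) unfolding clique_def by blast
  next
    case False
    then have "i < n" using that Suc.hyps(2) by simp
    moreover have "{c' j | j. j < i \<and> adj (c' i) (c' j)} = {c j | j. j < i \<and> adj (c i) (c j)}"
    proof -
      have "c' i = c i" "\<And>j. j < i \<Longrightarrow> c' j = c j" using \<open>i < n\<close> by (auto simp: c'_def)
      then show ?thesis by (intro Collect_cong ex_cong1) auto
    qed
    ultimately show ?thesis using c(2) by simp
  qed
  ultimately show ?case by blast
qed

section \<open>Paths in graphs of groups\<close>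

text \<open>An oriented edge has the shape of a letter, with reversal as inversion, so paths inherit
  the facts about reduced words.\<close>

lemma no_backtracking_iff: "no_backtracking p \<longleftrightarrow> reduced p"
proof
  assume "reduced p"
  then show "no_backtracking p" by (auto simp: no_backtracking_def reduced_append)
next
  assume "no_backtracking p"
  then show "reduced p"
  proof (induction p)
    case (Cons a p)
    have "no_backtracking p"
      using Cons.prems unfolding no_backtracking_def by (metis append_Cons)
    moreover have "hd p \<noteq> flip a" if "p \<noteq> []"
    proof
      assume "hd p = flip a"
      then have "a # p = [] @ [(fst a, snd a), (fst a, \<not> snd a)] @ tl p"
        using that by (cases p; cases a) auto
      then show False using Cons.prems unfolding no_backtracking_def by blast
    qed
    ultimately show ?case using Cons.IH by simp
  qed simp
qed

lemma step_flip [simp]: "step_from \<Psi> (flip d) = step_to \<Psi> d" "step_to \<Psi> (flip d) = step_from \<Psi> d"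
  by (cases d; simp)+

lemma edge_path_ends: "edge_path \<Psi> T u p v \<Longrightarrow> u \<in> gverts \<Psi> \<and> v \<in> gverts \<Psi>"
  by (induction p arbitrary: u) auto

lemma edge_path_append_iff:
  "edge_path \<Psi> T u (p @ q) w \<longleftrightarrow> (\<exists>v. edge_path \<Psi> T u p v \<and> edge_path \<Psi> T v q w)"
proof (induction p arbitrary: u)
  case Nil
  then show ?case using edge_path_ends[of \<Psi> T u q w] by auto
qed auto

lemma edge_path_rev: "edge_path \<Psi> T u p v \<Longrightarrow> edge_path \<Psi> T v (rev (map flip p)) u"
proof (induction p arbitrary: u)
  case (Cons d p)
  then have "edge_path \<Psi> T v (rev (map flip p)) (step_to \<Psi> d)" by simp
  moreover have "edge_path \<Psi> T (step_to \<Psi> d) [flip d] u"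
    using Cons.prems edge_path_ends[of \<Psi> T "step_to \<Psi> d" p v] by auto
  ultimately show ?case by (auto simp: edge_path_append_iff)
qed simp

lemma edge_path_last:
  "edge_path \<Psi> T u p v \<Longrightarrow> p \<noteq> [] \<Longrightarrow> step_to \<Psi> (last p) = v"
  by (induction p arbitrary: u) (auto split: if_splits)

lemma edge_path_edges: "edge_path \<Psi> T u p v \<Longrightarrow> d \<in> set p \<Longrightarrow> fst d \<in> T"
  by (induction p arbitrary: u) auto

text \<open>Edge \<open>i\<close> joins vertex \<open>i + 1\<close> to a vertex of index at most
  \<open>i\<close>. In a closed reduced path let \<open>M\<close> be the largest edge index. No
  other edge of the path touches vertex \<open>M + 1\<close>, so passing through it would be
  backtracking; the path starts and ends there. Removing its two outer edges leaves a shorter closed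
  reduced path, which is empty by induction, and then the two outer edges backtrack.\<close>

lemma parent_tree:
  assumes inj: "inj fv" and inje: "inj fe"
    and V: "gverts \<Psi> = fv ` {..n}"
    and src: "\<And>i. i < n \<Longrightarrow> gsrc \<Psi> (fe i) = fv (Suc i)"
    and tgt: "\<And>i. i < n \<Longrightarrow> gtgt \<Psi> (fe i) = fv (par i)"
    and par: "\<And>i. i < n \<Longrightarrow> par i \<le> i"
  shows "connected_edges \<Psi> (fe ` {..<n})" "acyclic_edges \<Psi> (fe ` {..<n})"
proof -
  let ?T = "fe ` {..<n}"
  have root: "\<exists>p. edge_path \<Psi> ?T (fv k) p (fv 0)" if "k \<le> n" for k
    using that
  proof (induction k rule: less_induct)
    case (less k)
    show ?case
    proof (cases k)
      case 0
      have "edge_path \<Psi> ?T (fv k) [] (fv 0)" using 0 V by simp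
      then show ?thesis by blast
    next
      case (Suc i)
      then have i: "i < n" "par i < k" "par i \<le> n" using less.prems par[of i] by auto
      then obtain p where "edge_path \<Psi> ?T (fv (par i)) p (fv 0)" using less.IH by blast
      then have "edge_path \<Psi> ?T (fv k) ((fe i, True) # p) (fv 0)"
        using i src tgt V Suc less.prems by simp
      then show ?thesis by blast
    qed
  qed
  show "connected_edges \<Psi> ?T"
    unfolding connected_edges_def V
  proof (intro ballI)
    fix u v assume "u \<in> fv ` {..n}" "v \<in> fv ` {..n}"
    then obtain k l where "u = fv k" "k \<le> n" "v = fv l" "l \<le> n" by auto
    then obtain p q where "edge_path \<Psi> ?T u p (fv 0)" "edge_path \<Psi> ?T v q (fv 0)"
      using root[of k] root[of l] by blast
    then have "edge_path \<Psi> ?T u (p @ rev (map flip q)) v"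
      using edge_path_rev[of \<Psi> ?T v q "fv 0"] unfolding edge_path_append_iff by blast
    then show "\<exists>p. edge_path \<Psi> ?T u p v" by blast
  qed
  show "acyclic_edges \<Psi> ?T" unfolding acyclic_edges_def
  proof (intro allI impI)
    fix u p assume "edge_path \<Psi> ?T u p u \<and> no_backtracking p"
    then have "edge_path \<Psi> ?T u p u" "reduced p" by (auto simp: no_backtracking_iff)
    then show "p = []"
    proof (induction "length p" arbitrary: p u rule: less_induct)
      case less
      show ?case
      proof (rule ccontr)
        assume ne: "p \<noteq> []"
        have edges: "\<exists>i<n. fst d = fe i" if "d \<in> set p" for d
          using edge_path_edges[OF less.prems(1) that] by auto
        define I where "I = {i. i < n \<and> (\<exists>d\<in>set p. fst d = fe i)}"
        have "finite I" by (simp add: I_def)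
        moreover have "I \<noteq> {}" using ne edges[OF hd_in_set[OF ne]] hd_in_set[OF ne] unfolding I_def by blast
        ultimately have M: "Max I \<in> I" "\<And>i. i \<in> I \<Longrightarrow> i \<le> Max I" by auto
        define M where "M = Max I"
        have Mn: "M < n" using M(1) by (simp add: I_def M_def)
        have idx: "\<exists>i b. i \<le> M \<and> i < n \<and> d = (fe i, b)" if "d \<in> set p" for d
        proof -
          obtain i where i: "i < n" "fst d = fe i" using edges[OF \<open>d \<in> set p\<close>] by blast
          then have "i \<in> I" using that unfolding I_def by blast
          then show ?thesis using M(2) i by (cases d) (auto simp: M_def)
        qed
        have into: "d = (fe M, False)" if "d \<in> set p" "step_to \<Psi> d = fv (Suc M)" for d
        proof -
          obtain i b where i: "i \<le> M" "i < n" "d = (fe i, b)" using idx[OF \<open>d \<in> set p\<close>] by blast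
          then have "fv (if b then par i else Suc i) = fv (Suc M)"
            using that(2) src[OF i(2)] tgt[OF i(2)] by (cases b) auto
          then show ?thesis using i par[OF i(2)] by (auto simp: inj_eq[OF inj] split: if_splits)
        qed
        have out: "d = (fe M, True)" if "d \<in> set p" "step_from \<Psi> d = fv (Suc M)" for d
        proof -
          obtain i b where i: "i \<le> M" "i < n" "d = (fe i, b)" using idx[OF \<open>d \<in> set p\<close>] by blast
          then have "fv (if b then Suc i else par i) = fv (Suc M)"
            using that(2) src[OF i(2)] tgt[OF i(2)] by (cases b) auto
          then show ?thesis using i par[OF i(2)] by (auto simp: inj_eq[OF inj] split: if_splits)
        qed
        have u: "u = fv (Suc M)"
        proof -
          obtain d where d: "d \<in> set p" "fst d = fe M" using M(1) unfolding I_def M_def by blast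
          then obtain xs ys where p: "p = xs @ d # ys" by (meson split_list)
          then have path: "edge_path \<Psi> ?T u xs (step_from \<Psi> d)" "edge_path \<Psi> ?T (step_to \<Psi> d) ys u"
            using less.prems(1) by (auto simp: edge_path_append_iff)
          show ?thesis
          proof (cases "snd d")
            case True
            then have d': "d = (fe M, True)" using d by (cases d) auto
            have "xs = []"
            proof (rule ccontr)
              assume "xs \<noteq> []"
              then have "last xs = (fe M, False)"
                using into[of "last xs"] edge_path_last[OF path(1)] d' src[OF Mn] p by simp
              then show False using less.prems(2) p d' \<open>xs \<noteq> []\<close> by (auto simp: reduced_append)
            qed
            then show ?thesis using path(1) d' src[OF Mn] by simp
          next
            case False
            then have d': "d = (fe M, False)" using d by (cases d) auto
            have "ys = []"
            proof (rule ccontr)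
              assume y: "ys \<noteq> []"
              then have "step_from \<Psi> (hd ys) = fv (Suc M)"
                using path(2) d' src[OF Mn] by (cases ys) auto
              then have "hd ys = (fe M, True)" using out[of "hd ys"] p y by simp
              then show False using less.prems(2) p d' y by (auto simp: reduced_append)
            qed
            then show ?thesis using path(2) d' src[OF Mn] by simp
          qed
        qed
        have hd: "hd p = (fe M, True)"
          using out[of "hd p"] less.prems(1) ne u by (cases p) auto
        have last: "last p = (fe M, False)"
          using into[of "last p"] edge_path_last[OF less.prems(1) ne] ne u by simp
        then have "tl p \<noteq> []" using hd ne by (cases p) auto
        then obtain q where q: "p = (fe M, True) # q @ [(fe M, False)]"
          using hd last ne by (metis append_butlast_last_id last_tl list.collapse)
        then have "edge_path \<Psi> ?T (fv (par M)) q (fv (par M))"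
          using less.prems(1) tgt[OF Mn] by (auto simp: edge_path_append_iff)
        moreover have "reduced q" using less.prems(2) q by (simp add: reduced_append)
        ultimately have "q = []" using less.hyps[of q] q by simp
        then show False using less.prems(2) q by simp
      qed
    qed
  qed
qed

section \<open>Decompositions of chordal presentation diagrams\<close>

text \<open>Serves to rename the vertices and edges of a finite tree on natural numbers into the
  prescribed infinite types.\<close>

lemma infinite_type_embedding: "\<exists>f :: nat \<Rightarrow> 'v::infinite. inj f"
  using infinite_countable_subset[of "UNIV :: 'v set"] infinite_UNIV by blast

context coxeter_system
begin

definition adjacent :: "'a \<Rightarrow> 'a \<Rightarrow> bool" where
  "adjacent s t \<longleftrightarrow> s \<in> S \<and> t \<in> S \<and> s \<noteq> t \<and> m s t < \<infinity>"

lemma symp_adjacent: "symp adjacent" and irreflp_adjacent: "irreflp adjacent"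
  using m_sym by (auto simp: adjacent_def symp_def irreflp_def)

lemma chordal_presentation_diagram:
  assumes "finite S"
    and no: "\<not> (\<exists>A\<subseteq>S. card A > 3 \<and> circuit_lgraph (induced_lgraph (presentation_diagram S m) A))"
  shows "chordal_on adjacent S"
  unfolding chordal_on_def
proof
  assume "\<exists>c n. chordless_cycle adjacent c n \<and> c ` {..<n} \<subseteq> S"
  then obtain c n where n: "n \<ge> 4" "inj_on c {..<n}" "c ` {..<n} \<subseteq> S"
    and adj: "\<And>i j. i < n \<Longrightarrow> j < n \<Longrightarrow> adjacent (c i) (c j) \<longleftrightarrow> j = Suc i mod n \<or> i = Suc j mod n"
    unfolding chordless_cycle_def by blast
  define A where "A = c ` {..<n}"
  let ?E = "ledges (induced_lgraph (presentation_diagram S m) A)"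
  have "?E = {{c i, c (Suc i mod n)} | i. i < n}"
  proof (intro equalityI subsetI)
    fix e assume "e \<in> ?E"
    then obtain s t where st: "e = {s, t}" "adjacent s t" "e \<subseteq> A"
      by (auto simp: induced_lgraph_def presentation_diagram_def adjacent_def)
    then obtain i j where "s = c i" "t = c j" "i < n" "j < n" by (auto simp: A_def)
    then show "e \<in> {{c i, c (Suc i mod n)} | i. i < n}" using st adj[of i j] by (auto simp: insert_commute)
  next
    fix e assume "e \<in> {{c i, c (Suc i mod n)} | i. i < n}"
    then obtain i where i: "i < n" "e = {c i, c (Suc i mod n)}" by blast
    moreover have "Suc i mod n < n" using n by simp
    ultimately have "adjacent (c i) (c (Suc i mod n))" using adj[of i "Suc i mod n"] by simp
    then show "e \<in> ?E"
      using i \<open>Suc i mod n < n\<close> by (auto simp: induced_lgraph_def presentation_diagram_def adjacent_def A_def)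
  qed
  moreover have "bij_betw c {..<n} (lverts (induced_lgraph (presentation_diagram S m) A))"
    using n by (simp add: bij_betw_def A_def induced_lgraph_def)
  ultimately have "circuit_lgraph (induced_lgraph (presentation_diagram S m) A)"
    unfolding circuit_lgraph_def using n(1) by (intro exI[of _ n] conjI exI[of _ c]) auto
  moreover have "A \<subseteq> S" "card A > 3" using n by (auto simp: A_def card_image)
  ultimately show False using no by blast
qed

text \<open>Both generators of a Coxeter relation lie in a common bag, so the relation holds in the
  fundamental group of the tree of bags. This yields a homomorphism \<open>\<kappa>\<close> from
  \<open>W\<close>, inverse to the map \<open>h\<close> induced by the inclusions.\<close>

theorem diagram_imp_visual_decomposition:
  assumes fin: "finite S"
    and complete: "\<And>K. K \<subseteq> S \<Longrightarrow> complete_lgraph (induced_lgraph (presentation_diagram S m) K) \<Longrightarrow>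
      finite (generate W K)"
    and no: "\<not> (\<exists>A\<subseteq>S. card A > 3 \<and> circuit_lgraph (induced_lgraph (presentation_diagram S m) A))"
  shows "\<exists>\<Psi> :: ('v::infinite, 'e::infinite, 'a) gog.
    visual_decomposition W S \<Psi> \<and> (\<forall>v\<in>gverts \<Psi>. finite (carrier (vgroup \<Psi> v)))"
proof -
  define n where "n = card S"
  obtain c where c: "bij_betw c {..<n} S"
    and cl: "\<And>i. i < n \<Longrightarrow> clique adjacent {c j | j. j < i \<and> adjacent (c i) (c j)}"
    using elimination_ordering[OF symp_adjacent irreflp_adjacent fin chordal_presentation_diagram[OF fin no]]
    unfolding n_def by blast
  have cS: "c i \<in> S" if "i < n" for i using c that by (auto simp: bij_betw_def)
  have c_eq: "c i = c j \<longleftrightarrow> i = j" if "i < n" "j < n" for i j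
    using c that by (auto simp: bij_betw_def inj_on_def)
  define J where "J i = {j. j < i \<and> adjacent (c i) (c j)}" for i
  define nbr where "nbr i = c ` J i" for i
  \<comment> \<open>Bag \<open>Suc i\<close> belongs to the vertex \<open>c i\<close>. The empty bag
    0 is the root: vertices without earlier neighbours hang from it by trivial edge groups, and it
    is the whole graph if \<open>S\<close> is empty.\<close>
  define bag where "bag k = (case k of 0 \<Rightarrow> {} | Suc i \<Rightarrow> insert (c i) (nbr i))" for k
  define par where "par i = (if J i = {} then 0 else Suc (Max (J i)))" for i
  have finJ: "finite (J i)" for i by (simp add: J_def)
  have par_le: "par i \<le> i" for i
    using Max_in[OF finJ, of i] by (auto simp: par_def J_def Suc_le_eq)
  have nbr_bag: "nbr i \<subseteq> bag (Suc i)" for i by (auto simp: bag_def)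
  have nbr_clique: "clique adjacent (nbr i)" if "i < n" for i
    using cl[OF that] by (auto simp: nbr_def J_def clique_def)
  \<comment> \<open>The parent of \<open>c i\<close> is the bag of its latest earlier neighbour
    \<open>c l\<close>. As the earlier neighbours form a clique, all others are earlier neighbours
    of \<open>c l\<close> and lie in that bag.\<close>
  have nbr_par: "nbr i \<subseteq> bag (par i)" if i: "i < n" for i
  proof
    fix x assume "x \<in> nbr i"
    then obtain j where j: "x = c j" "j \<in> J i" by (auto simp: nbr_def)
    define l where "l = Max (J i)"
    have "J i \<noteq> {}" using j by auto
    then have l: "l \<in> J i" "j \<le> l" "par i = Suc l" using j finJ[of i] by (auto simp: l_def par_def)
    show "x \<in> bag (par i)"
    proof (cases "j = l")
      case False
      then have "j < l" using l by simp
      moreover have "l < n" "j < n" using l(1) j(2) i by (auto simp: J_def)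
      moreover have "adjacent (c l) (c j)"
        using nbr_clique[OF i] l(1) j(2) c_eq[OF \<open>l < n\<close> \<open>j < n\<close>] False
        by (auto simp: clique_def nbr_def)
      ultimately show ?thesis using j(1) l(3) by (auto simp: bag_def nbr_def J_def)
    qed (use j l in \<open>auto simp: bag_def\<close>)
  qed
  have nbr_S: "nbr i \<subseteq> S" if "i < n" for i
    using that cS by (auto simp: nbr_def J_def)
  have bag_S: "bag k \<subseteq> S" if "k \<le> n" for k
    using that cS nbr_S by (auto simp: bag_def split: nat.splits)
  have bag_clique: "clique adjacent (bag k)" if k: "k \<le> n" for k
  proof (cases k)
    case (Suc i)
    have "adjacent (c i) x \<and> adjacent x (c i)" if "x \<in> nbr i" for x
      using that sympD[OF symp_adjacent] by (auto simp: nbr_def J_def)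
    then show ?thesis
      using nbr_clique[of i] k Suc by (auto simp: bag_def clique_def)
  qed (simp add: bag_def clique_def)
  have bag_finite: "finite (generate W (bag k))" if "k \<le> n" for k
  proof (rule complete[OF bag_S[OF that]])
    show "complete_lgraph (induced_lgraph (presentation_diagram S m) (bag k))"
      using bag_clique[OF that] induced_edge_iff[OF bag_S[OF that]]
      by (auto simp: complete_lgraph_def clique_def adjacent_def induced_lgraph_def)
  qed
  have par_n: "par i \<le> n" if "i < n" for i using par_le[of i] that by simp

  obtain fv :: "nat \<Rightarrow> 'v" where fv: "inj fv" using infinite_type_embedding by blast
  obtain fe :: "nat \<Rightarrow> 'e" where fe: "inj fe" using infinite_type_embedding by blast
  define iv where "iv = inv_into UNIV fv"
  define ie where "ie = inv_into UNIV fe"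
  have iv [simp]: "iv (fv k) = k" and ie [simp]: "ie (fe k) = k" for k
    using fv fe by (simp_all add: iv_def ie_def)
  define \<Psi> :: "('v, 'e, 'a) gog" where "\<Psi> =
    \<lparr>gverts = fv ` {..n}, gedges = fe ` {..<n},
     gsrc = (\<lambda>e. fv (Suc (ie e))), gtgt = (\<lambda>e. fv (par (ie e))),
     vgroup = (\<lambda>v. W\<lparr>carrier := generate W (bag (iv v))\<rparr>),
     egroup = (\<lambda>e. W\<lparr>carrier := generate W (nbr (ie e))\<rparr>),
     inj_src = (\<lambda>_ a. a), inj_tgt = (\<lambda>_ a. a)\<rparr>"
  have \<Psi>_simps [simp]: "gverts \<Psi> = fv ` {..n}" "gedges \<Psi> = fe ` {..<n}"
    "gsrc \<Psi> e = fv (Suc (ie e))" "gtgt \<Psi> e = fv (par (ie e))"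
    "vgroup \<Psi> v = W\<lparr>carrier := generate W (bag (iv v))\<rparr>"
    "egroup \<Psi> e = W\<lparr>carrier := generate W (nbr (ie e))\<rparr>"
    "inj_src \<Psi> e a = a" "inj_tgt \<Psi> e a = a" for e v a
    by (simp_all add: \<Psi>_def)
  let ?T = "fe ` {..<n}"
  have tree: "connected_edges \<Psi> ?T" "acyclic_edges \<Psi> ?T"
    by (rule parent_tree[OF fv fe, of \<Psi> n par]; simp add: par_le)+
  have sub: "subgroup (generate W K) W" if "K \<subseteq> S" for K
    using that gens_closed by (intro generate_is_subgroup) auto
  have grp: "group (W\<lparr>carrier := generate W K\<rparr>)" if "K \<subseteq> S" for K
    by (rule subgroup_imp_group[OF sub[OF that]])
  have mono: "generate W K \<subseteq> generate W L" if "K \<subseteq> L" for K L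
    using mono_generate[OF that] .
  have gog: "graph_of_groups \<Psi>"
    unfolding graph_of_groups_def
  proof (intro conjI ballI)
    show "gverts \<Psi> \<noteq> {}" by simp
    show "connected_edges \<Psi> (gedges \<Psi>)" using tree(1) by simp
    show "group (vgroup \<Psi> v)" if "v \<in> gverts \<Psi>" for v
      using that grp bag_S by auto
    fix e assume "e \<in> gedges \<Psi>"
    then obtain i where i: "i < n" "e = fe i" by auto
    show "gsrc \<Psi> e \<in> gverts \<Psi>" "gtgt \<Psi> e \<in> gverts \<Psi>" using i par_n by auto
    show "group (egroup \<Psi> e)" using i grp nbr_S by simp
    show "inj_src \<Psi> e \<in> hom (egroup \<Psi> e) (vgroup \<Psi> (gsrc \<Psi> e))"
      using i mono[OF nbr_bag[of i]] by (auto simp: hom_def)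
    show "inj_tgt \<Psi> e \<in> hom (egroup \<Psi> e) (vgroup \<Psi> (gtgt \<Psi> e))"
      using i mono[OF nbr_par[of i]] by (auto simp: hom_def)
    show "inj_on (inj_src \<Psi> e) (carrier (egroup \<Psi> e))" "inj_on (inj_tgt \<Psi> e) (carrier (egroup \<Psi> e))"
      by (auto simp: inj_on_def)
  qed

  define X where "X = gog_gens \<Psi>"
  define R where "R = gog_relators \<Psi> ?T"
  define P where "P = presented_group X R"
  interpret P: group P unfolding P_def by (rule group_presented_group)
  have pi1: "gog_pi1 \<Psi> ?T = P" by (simp add: gog_pi1_def P_def X_def R_def)
  define incl where "incl k g = word_class X R [(Inl (fv k, g), True)]" for k g
  have XI: "Inl (fv k, g) \<in> X \<longleftrightarrow> k \<le> n \<and> g \<in> generate W (bag k)" "Inr (fe i) \<in> X \<longleftrightarrow> i < n" for k g i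
    using fv fe by (auto simp: X_def gog_gens_def inj_eq)
  have relator_one: "word_class X R r = \<one>\<^bsub>P\<^esub>" if "r \<in> R" "r \<in> words_over X" for r
    using word_eq.relator[OF that(1), of "[]" "[]" X] that(2)
    by (simp add: P_def one_presented_group word_class_eq_iff)
  have cls: "word_class X R v \<otimes>\<^bsub>P\<^esub> word_class X R w = word_class X R (v @ w)"
    if "v \<in> words_over X" "w \<in> words_over X" for v w
    using presented_group_mult[OF that] by (simp add: P_def)
  have P_one: "\<one>\<^bsub>P\<^esub> = word_class X R []" by (simp add: P_def one_presented_group)
  have cls_closed: "word_class X R w \<in> carrier P" if "w \<in> words_over X" for w
    using that by (auto simp: P_def carrier_presented_group)
  have cls_inv: "word_class X R [(x, False)] = inv\<^bsub>P\<^esub> word_class X R [(x, True)]" if "x \<in> X" for x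
  proof -
    have "word_eq X R ([] @ [(x, False), (x, True)] @ []) ([] @ [])"
      using word_eq.cancel[of "[]" x False "[]" X R] that by simp
    then have "word_class X R [(x, False)] \<otimes>\<^bsub>P\<^esub> word_class X R [(x, True)] = \<one>\<^bsub>P\<^esub>"
      using that by (simp add: cls P_one word_class_eq_iff)
    then show ?thesis using that cls_closed by (intro P.inv_equality[symmetric]) auto
  qed
  have incl_closed: "incl k g \<in> carrier P" if "k \<le> n" "g \<in> generate W (bag k)" for k g
    using that by (auto simp: incl_def XI intro: cls_closed)
  have incl_mult: "incl k (x \<otimes> y) = incl k x \<otimes>\<^bsub>P\<^esub> incl k y"
    if k: "k \<le> n" and xy: "x \<in> generate W (bag k)" "y \<in> generate W (bag k)" for k x y
  proof -
    have xyc: "x \<otimes> y \<in> generate W (bag k)" using xy by (rule generate.eng)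
    let ?r = "[(Inl (fv k, x), True), (Inl (fv k, y), True), (Inl (fv k, x \<otimes> y), False)]"
    have "?r \<in> R"
      unfolding R_def gog_relators_def
      by (intro UnI1 CollectI exI[of _ "fv k"] exI[of _ x] exI[of _ y]) (use k xy in auto)
    moreover have w: "?r \<in> words_over X" using k xy xyc by (simp add: XI)
    ultimately have "word_class X R ?r = \<one>\<^bsub>P\<^esub>" by (rule relator_one)
    moreover have "word_class X R ?r = incl k x \<otimes>\<^bsub>P\<^esub> incl k y \<otimes>\<^bsub>P\<^esub> inv\<^bsub>P\<^esub> incl k (x \<otimes> y)"
      using w by (simp add: incl_def cls flip: cls_inv)
    ultimately show ?thesis
      using incl_closed[OF k xy(1)] incl_closed[OF k xy(2)] incl_closed[OF k xyc]
      by (metis P.inv_solve_right' P.l_one P.m_closed P.one_closed)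
  qed
  have incl_hom: "incl k \<in> hom (W\<lparr>carrier := generate W (bag k)\<rparr>) P" if "k \<le> n" for k
    by (rule homI) (auto simp: incl_closed incl_mult that)
  have edge_one: "word_class X R [(Inr (fe i), True)] = \<one>\<^bsub>P\<^esub>" if "i < n" for i
    by (rule relator_one) (use that in \<open>auto simp: R_def gog_relators_def XI\<close>)
  have incl_edge: "incl (Suc i) a = incl (par i) a" if i: "i < n" and a: "a \<in> generate W (nbr i)" for i a
  proof -
    have a': "a \<in> generate W (bag (Suc i))" "a \<in> generate W (bag (par i))"
      using mono[OF nbr_bag] mono[OF nbr_par[OF i]] a by auto
    let ?r = "[(Inr (fe i), True), (Inl (fv (par i), a), True), (Inr (fe i), False), (Inl (fv (Suc i), a), False)]"
    have "?r \<in> R"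
      unfolding R_def gog_relators_def
      by (intro UnI1 UnI2 CollectI exI[of _ "fe i"] exI[of _ a]) (use i a in auto)
    moreover have w: "?r \<in> words_over X" using i a' par_n[OF i] by (simp add: XI)
    ultimately have "word_class X R ?r = \<one>\<^bsub>P\<^esub>" by (rule relator_one)
    moreover have "word_class X R ?r = word_class X R [(Inr (fe i), True)] \<otimes>\<^bsub>P\<^esub> incl (par i) a
        \<otimes>\<^bsub>P\<^esub> inv\<^bsub>P\<^esub> word_class X R [(Inr (fe i), True)] \<otimes>\<^bsub>P\<^esub> inv\<^bsub>P\<^esub> incl (Suc i) a"
      using w by (simp add: incl_def cls flip: cls_inv)
    ultimately have "incl (par i) a \<otimes>\<^bsub>P\<^esub> inv\<^bsub>P\<^esub> incl (Suc i) a = \<one>\<^bsub>P\<^esub>"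
      using edge_one[OF i] incl_closed[OF par_n[OF i] a'(2)] by simp
    then show ?thesis
      using incl_closed[OF par_n[OF i] a'(2)] incl_closed[of "Suc i" a] a'(1) i
      by (metis P.inv_closed P.inv_equality P.inv_inv Suc_le_eq)
  qed
  define idx where "idx s = inv_into {..<n} c s" for s
  have idx: "idx (c i) = i" if "i < n" for i
    using c that by (auto simp: idx_def bij_betw_def)
  define f where "f s = incl (Suc (idx s)) s" for s
  \<comment> \<open>A generator in a bag is either its newest vertex or lies in the edge group to
    the parent. Descending through parents ends at the one bag where it is newest, so all bags give
    the same image.\<close>
  have incl_f: "incl k s = f s" if "k \<le> n" "s \<in> bag k" for k s
    using that
  proof (induction k rule: less_induct)
    case (less k)
    then obtain i where i: "k = Suc i" "i < n" by (cases k) (auto simp: bag_def)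
    show ?case
    proof (cases "s = c i")
      case True
      then show ?thesis using i idx by (simp add: f_def)
    next
      case False
      then have s: "s \<in> nbr i" using less.prems i by (simp add: bag_def)
      then have "incl k s = incl (par i) s"
        using incl_edge[OF i(2)] i(1) by (auto intro: generate.incl)
      also have "\<dots> = f s"
        using less.IH[of "par i"] i par_le[of i] par_n[OF i(2)] nbr_par[OF i(2)] s by auto
      finally show ?thesis .
    qed
  qed
  have bag_hom: "group_hom (W\<lparr>carrier := generate W (bag k)\<rparr>) P (incl k)" if "k \<le> n" for k
    using grp[OF bag_S[OF that]] incl_hom[OF that] by (simp add: group_hom_def group_hom_axioms_def P.is_group)
  \<comment> \<open>The bag of the later of two adjacent vertices contains the earlier one.\<close>
  have common_bag: "\<exists>k\<le>n. s \<in> bag k \<and> t \<in> bag k" if st: "s \<in> S" "t \<in> S" "m s t < \<infinity>" for s t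
  proof -
    obtain i j where ij: "s = c i" "i < n" "t = c j" "j < n"
      using c st by (auto simp: bij_betw_def)
    consider "i = j" | "j < i" "adjacent (c i) (c j)" | "i < j" "adjacent (c j) (c i)"
      using st ij m_sym[OF st(1,2)] by (cases i j rule: linorder_cases) (auto simp: adjacent_def c_eq)
    then show ?thesis
    proof cases
      case 1
      then show ?thesis using ij by (intro exI[of _ "Suc i"]) (auto simp: bag_def)
    next
      case 2
      then show ?thesis using ij by (intro exI[of _ "Suc i"]) (auto simp: bag_def nbr_def J_def)
    next
      case 3
      then show ?thesis using ij by (intro exI[of _ "Suc j"]) (auto simp: bag_def nbr_def J_def)
    qed
  qed
  have f_closed: "f s \<in> carrier P" if "s \<in> S" for s
    using common_bag[OF that that m_self[OF that]] incl_f incl_closed by (metis generate.incl)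
  have f_rel: "(f s \<otimes>\<^bsub>P\<^esub> f t) [^]\<^bsub>P\<^esub> l = \<one>\<^bsub>P\<^esub>"
    if st: "s \<in> S" "t \<in> S" "m s t = enat l" for s t l
  proof -
    obtain k where k: "k \<le> n" "s \<in> bag k" "t \<in> bag k" using common_bag[of s t] st by auto
    interpret k: group_hom "W\<lparr>carrier := generate W (bag k)\<rparr>" P "incl k" by (rule bag_hom[OF k(1)])
    have st': "s \<in> generate W (bag k)" "t \<in> generate W (bag k)" "s \<otimes> t \<in> generate W (bag k)"
      using k by (auto intro: generate.intros)
    have "(f s \<otimes>\<^bsub>P\<^esub> f t) [^]\<^bsub>P\<^esub> l = incl k (s \<otimes> t) [^]\<^bsub>P\<^esub> l"
      using k incl_f incl_mult st' by simp
    also have "\<dots> = incl k ((s \<otimes> t) [^] l)"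
      using k.hom_nat_pow[of "s \<otimes> t" l] st'(3) by (simp add: nat_pow_consistent[symmetric])
    also have "\<dots> = \<one>\<^bsub>P\<^esub>" using coxeter_relation[OF st] k.hom_one by simp
    finally show ?thesis .
  qed
  obtain \<kappa> where \<kappa>: "\<kappa> \<in> hom W P" "\<And>s. s \<in> S \<Longrightarrow> \<kappa> s = f s"
    using coxeter_hom[of P f, OF P.is_group f_closed f_rel] by blast
  have \<kappa>_incl: "\<kappa> g = incl k g" if k: "k \<le> n" and g: "g \<in> generate W (bag k)" for k g
  proof -
    interpret B: group "W\<lparr>carrier := generate W (bag k)\<rparr>" by (rule grp[OF bag_S[OF k]])
    have bW: "bag k \<subseteq> carrier W" using bag_S[OF k] gens_closed by blast
    have bB: "bag k \<subseteq> generate W (bag k)" by (auto intro: generate.incl)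
    have \<kappa>B: "\<kappa> \<in> hom (W\<lparr>carrier := generate W (bag k)\<rparr>) P"
      using subsetD[OF generate_incl[OF bW]]
      by (intro homI) (simp_all add: hom_in_carrier[OF \<kappa>(1)] hom_mult[OF \<kappa>(1)])
    have gB: "g \<in> generate (W\<lparr>carrier := generate W (bag k)\<rparr>) (bag k)"
      using g generate_consistent[OF bB sub[OF bag_S[OF k]]] by simp
    have eq: "\<kappa> x = incl k x" if "x \<in> bag k" for x
      using that \<kappa>(2)[of x] incl_f[OF k, of x] subsetD[OF bag_S[OF k]] by simp
    show ?thesis
      by (rule B.hom_eq_on_generate[OF _ P.is_group \<kappa>B incl_hom[OF k] eq gB]) (use bB in simp_all)
  qed
  define \<phi> :: "'v \<times> 'a + 'e \<Rightarrow> 'a" where "\<phi> = case_sum snd (\<lambda>_. \<one>)"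
  have gen_W: "g \<in> carrier W" if "g \<in> generate W (bag k)" "k \<le> n" for g k
    using that sub[OF bag_S[OF that(2)]] subgroup.subset by blast
  have \<phi>: "\<phi> \<in> X \<rightarrow> carrier W"
    using gen_W by (auto simp: \<phi>_def X_def gog_gens_def)
  have gen_W': "g \<in> carrier W" if "g \<in> generate W (nbr i)" "i < n" for g i
    using that sub[OF nbr_S[OF that(2)]] subgroup.subset by blast
  have rel: "ev W \<phi> r = \<one>" if r: "r \<in> R" for r
  proof -
    consider k x y where "k \<le> n" "x \<in> generate W (bag k)" "y \<in> generate W (bag k)"
        "r = [(Inl (fv k, x), True), (Inl (fv k, y), True), (Inl (fv k, x \<otimes> y), False)]"
      | i a where "i < n" "a \<in> generate W (nbr i)"
        "r = [(Inr (fe i), True), (Inl (fv (par i), a), True), (Inr (fe i), False), (Inl (fv (Suc i), a), False)]"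
      | i where "r = [(Inr (fe i), True)]"
      using r unfolding R_def gog_relators_def by auto
    then show ?thesis
    proof cases
      case 1
      then have "x \<in> carrier W" "y \<in> carrier W" using gen_W by auto
      then show ?thesis unfolding 1(4)
        by (simp add: letter_def \<phi>_def m_assoc[symmetric] inv_mult_group)
    next
      case 2
      then show ?thesis using gen_W'[of a i] by (simp add: letter_def \<phi>_def)
    next
      case 3
      then show ?thesis by (simp add: letter_def \<phi>_def)
    qed
  qed
  obtain h where h: "h \<in> hom P W" "\<And>w. w \<in> words_over X \<Longrightarrow> h (word_class X R w) = ev W \<phi> w"
    using presented_group_hom[OF is_group \<phi> rel] unfolding P_def by blast
  interpret h: group_hom P W h
    using h(1) by (simp add: group_hom_def group_hom_axioms_def is_group)
  interpret \<kappa>: group_hom W P \<kappa>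
    using \<kappa>(1) by (simp add: group_hom_def group_hom_axioms_def is_group)
  have h_incl: "h (incl k g) = g" if "k \<le> n" "g \<in> generate W (bag k)" for k g
    using that h(2)[of "[(Inl (fv k, g), True)]"] gen_W by (simp add: incl_def XI letter_def \<phi>_def)
  have \<kappa>h: "\<kappa> (h x) = x" if x: "x \<in> carrier P" for x
  proof -
    let ?g = "\<lambda>x. word_class X R [(x, True)]"
    have gens: "?g ` X \<subseteq> carrier P" by (auto intro: cls_closed)
    have "(\<kappa> \<circ> h) x = (\<lambda>x. x) x"
    proof (rule P.hom_eq_on_generate[OF gens P.is_group])
      show "\<kappa> \<circ> h \<in> hom P P" using h(1) \<kappa>(1) by (rule Group.hom_compose)
      show "(\<lambda>x. x) \<in> hom P P" by (auto simp: hom_def)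
      show "x \<in> generate P (?g ` X)" using x generate_presented_group[of X R] by (simp add: P_def)
      fix y assume "y \<in> ?g ` X"
      then obtain z where z: "z \<in> X" "y = ?g z" by blast
      then consider k g where "z = Inl (fv k, g)" "k \<le> n" "g \<in> generate W (bag k)" | i where "z = Inr (fe i)" "i < n"
        by (auto simp: X_def gog_gens_def)
      then show "(\<kappa> \<circ> h) y = y"
      proof cases
        case 1
        then have "y = incl k g" using z by (simp add: incl_def)
        then show ?thesis using 1 h_incl \<kappa>_incl by simp
      next
        case 2
        then have "y = \<one>\<^bsub>P\<^esub>" using z edge_one by simp
        then show ?thesis by simp
      qed
    qed
    then show ?thesis by simp
  qed
  have h\<kappa>: "h (\<kappa> w) = w" if "w \<in> carrier W" for w
  proof -
    have "(h \<circ> \<kappa>) w = (\<lambda>x. x) w"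
    proof (rule hom_eq_on_generate[OF gens_closed is_group])
      show "h \<circ> \<kappa> \<in> hom W W" using \<kappa>(1) h(1) by (rule Group.hom_compose)
      show "(\<lambda>x. x) \<in> hom W W" by (auto simp: hom_def)
      show "w \<in> generate W S" using that generates by simp
      fix s assume s: "s \<in> S"
      obtain k where "k \<le> n" "s \<in> bag k" using common_bag[OF s s m_self[OF s]] by blast
      then show "(h \<circ> \<kappa>) s = s" using \<kappa>_incl[of k s] h_incl[of k s] by (simp add: generate.incl)
    qed
    then show ?thesis by simp
  qed
  have "bij_betw h (carrier P) (carrier W)"
    by (rule bij_betw_byWitness[where f' = \<kappa>]) (use \<kappa>h h\<kappa> in auto)
  then have iso: "h \<in> iso (gog_pi1 \<Psi> ?T) W"
    using h(1) by (simp add: iso_def pi1)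
  have "visual_decomposition W S \<Psi>"
    unfolding visual_decomposition_def
  proof (intro conjI)
    show "graph_of_groups \<Psi>" by (rule gog)
    show "\<forall>v\<in>gverts \<Psi>. \<exists>H. special_subgroup W S H \<and> vgroup \<Psi> v = W\<lparr>carrier := H\<rparr>"
      using bag_S by (auto simp: special_subgroup_def)
    show "\<forall>e\<in>gedges \<Psi>. \<exists>H. special_subgroup W S H \<and> egroup \<Psi> e = W\<lparr>carrier := H\<rparr>"
      using nbr_S by (auto simp: special_subgroup_def)
    show "\<forall>e\<in>gedges \<Psi>. \<forall>a\<in>carrier (egroup \<Psi> e). inj_src \<Psi> e a = a \<and> inj_tgt \<Psi> e a = a" by simp
    have "maximal_tree \<Psi> ?T" using tree by (simp add: maximal_tree_def)
    moreover have "\<forall>v\<in>gverts \<Psi>. \<forall>g\<in>carrier (vgroup \<Psi> v). h (gog_incl \<Psi> ?T v g) = g"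
      using h_incl by (auto simp: gog_incl_def incl_def X_def R_def)
    ultimately show "\<exists>T. maximal_tree \<Psi> T \<and> (\<exists>h\<in>iso (gog_pi1 \<Psi> T) W.
        \<forall>v\<in>gverts \<Psi>. \<forall>g\<in>carrier (vgroup \<Psi> v). h (gog_incl \<Psi> T v g) = g)"
      using iso by blast
  qed
  moreover have "\<forall>v\<in>gverts \<Psi>. finite (carrier (vgroup \<Psi> v))" using bag_finite by auto
  ultimately show ?thesis by blast
qed

end

section \<open>Virtual freeness of trees of finite groups\<close>

section \<open>Trees of finite groups\<close>

text \<open>Coordinates for a free action: the first component names the orbit, the second the
  position in it.\<close>

abbreviation lmul :: "('g, 'm) monoid_scheme \<Rightarrow> 'g \<Rightarrow> 'q \<times> 'g \<Rightarrow> 'q \<times> 'g" where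
  "lmul G c p \<equiv> (fst p, c \<otimes>\<^bsub>G\<^esub> snd p)"

text \<open>A free \<open>H\<close>-set is free over \<open>C\<close>. A transversal of the right
  cosets of \<open>C\<close> splits each orbit into orbits of \<open>C\<close>, and counting
  elements determines their number.\<close>

lemma (in group) free_action_restrict:
  fixes Q :: "'q set"
  assumes C: "subgroup C G" and H: "subgroup H G" and CH: "C \<subseteq> H" and fin: "finite H" "finite Q"
  obtains \<Phi> where "bij_betw \<Phi> (Q \<times> H) ({..<card Q * card H div card C} \<times> C)"
    "\<And>c p. c \<in> C \<Longrightarrow> p \<in> Q \<times> H \<Longrightarrow> \<Phi> (lmul G c p) = lmul G c (\<Phi> p)"
proof -
  interpret C: subgroup C G by fact
  interpret H: subgroup H G by fact
  obtain rep where "\<forall>w\<in>carrier G. rep w \<in> carrier G \<and> w \<otimes> inv (rep w) \<in> C"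
    "\<forall>c\<in>C. \<forall>w\<in>carrier G. rep (c \<otimes> w) = rep w"
    using right_transversal[OF C] by metis
  then have rep: "\<And>w. w \<in> carrier G \<Longrightarrow> rep w \<in> carrier G"
    "\<And>w. w \<in> carrier G \<Longrightarrow> w \<otimes> inv (rep w) \<in> C"
    "\<And>c w. c \<in> C \<Longrightarrow> w \<in> carrier G \<Longrightarrow> rep (c \<otimes> w) = rep w"
    by simp_all
  define D where "D = rep ` H"
  have split: "h = (h \<otimes> inv (rep h)) \<otimes> rep h" if "h \<in> H" for h
    using that rep(1)[of h] by (simp add: m_assoc)
  have rep_rep: "rep (rep h) = rep h" if h: "h \<in> H" for h
    using rep(3)[OF rep(2) rep(1), of h h] split[OF h] h by simp
  have D_H: "rep h \<in> H" if h: "h \<in> H" for h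
  proof -
    have "inv (h \<otimes> inv (rep h)) \<otimes> h \<in> H" using rep(2)[of h] CH h by auto
    also have "inv (h \<otimes> inv (rep h)) \<otimes> h = rep h"
      using h rep(1)[of h] by (simp add: inv_mult_group m_assoc)
    finally show ?thesis .
  qed
  have finD: "finite (Q \<times> D)" using fin by (simp add: D_def)
  obtain e where e: "bij_betw e (Q \<times> D) {0..<card (Q \<times> D)}"
    using ex_bij_betw_finite_nat[OF finD] by blast
  define \<psi> where "\<psi> p = ((fst p, rep (snd p)), snd p \<otimes> inv (rep (snd p)))" for p :: "'q \<times> 'a"
  define \<psi>' where "\<psi>' x = (fst (fst x), snd x \<otimes> snd (fst x))" for x :: "('q \<times> 'a) \<times> 'a"
  have \<psi>: "bij_betw \<psi> (Q \<times> H) ((Q \<times> D) \<times> C)"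
  proof (rule bij_betw_byWitness[where f' = \<psi>'])
    show "\<forall>p\<in>Q \<times> H. \<psi>' (\<psi> p) = p"
      using split by (auto simp: \<psi>_def \<psi>'_def)
    show "\<forall>x\<in>(Q \<times> D) \<times> C. \<psi> (\<psi>' x) = x"
    proof
      fix x assume "x \<in> (Q \<times> D) \<times> C"
      then obtain q h c where x: "x = ((q, rep h), c)" "q \<in> Q" "h \<in> H" "c \<in> C" by (auto simp: D_def)
      have "rep (c \<otimes> rep h) = rep h" using rep(3)[of c "rep h"] rep(1)[of h] rep_rep x by simp
      then show "\<psi> (\<psi>' x) = x"
        using x rep(1)[of h] by (simp add: \<psi>_def \<psi>'_def m_assoc)
    qed
    show "\<psi> ` (Q \<times> H) \<subseteq> (Q \<times> D) \<times> C" using rep(2) by (auto simp: \<psi>_def D_def)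
    show "\<psi>' ` ((Q \<times> D) \<times> C) \<subseteq> Q \<times> H" using D_H CH by (auto simp: D_def \<psi>'_def)
  qed
  have "C \<noteq> {}" using C.one_closed by blast
  then have "card C > 0" using finite_subset[OF CH fin(1)] by (simp add: card_gt_0_iff)
  moreover have "card Q * card H = card (Q \<times> D) * card C"
    using bij_betw_same_card[OF \<psi>] by (simp add: card_cartesian_product)
  ultimately have card: "card (Q \<times> D) = card Q * card H div card C" by simp
  have "bij_betw (map_prod e id) ((Q \<times> D) \<times> C) ({0..<card (Q \<times> D)} \<times> C)"
    using e by (intro bij_betw_map_prod) auto
  from bij_betw_trans[OF \<psi> this] have "bij_betw (map_prod e id \<circ> \<psi>) (Q \<times> H) ({..<card Q * card H div card C} \<times> C)"
    by (simp add: card lessThan_atLeast0)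
  moreover have "(map_prod e id \<circ> \<psi>) (lmul G c p) = lmul G c ((map_prod e id \<circ> \<psi>) p)"
    if c: "c \<in> C" and p: "p \<in> Q \<times> H" for c p
  proof -
    have h: "snd p \<in> carrier G" using p by auto
    then show ?thesis using rep(3)[OF c h] rep(1)[OF h] c by (simp add: \<psi>_def m_assoc)
  qed
  ultimately show ?thesis by (rule that)
qed

text \<open>Restricted to \<open>C\<close>, both free actions on \<open>N\<close> points have
  \<open>N div card C\<close> orbits and are therefore isomorphic. Transporting the
  \<open>H2\<close>-coordinates along such an isomorphism makes the two actions agree on
  \<open>C\<close>. This is why the actions are free and why \<open>N\<close> is a common multiple
  of the orders.\<close>

lemma (in group) free_action_extend:
  assumes C: "subgroup C G" and H1: "subgroup H1 G" "finite H1" "C \<subseteq> H1" and H2: "subgroup H2 G" "finite H2" "C \<subseteq> H2"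
    and \<Psi>1: "bij_betw \<Psi>1 {..<N} ({..<N div card H1} \<times> H1)" and dvd: "card H1 dvd N" "card H2 dvd N"
  obtains \<Psi>2 where "bij_betw \<Psi>2 {..<N} ({..<N div card H2} \<times> H2)"
    "\<And>c x y. c \<in> C \<Longrightarrow> x < N \<Longrightarrow> y < N \<Longrightarrow> \<Psi>1 y = lmul G c (\<Psi>1 x) \<Longrightarrow> \<Psi>2 y = lmul G c (\<Psi>2 x)"
proof -
  let ?I = "{..<N div card C} \<times> C"
  obtain \<Phi>1 where \<Phi>1: "bij_betw \<Phi>1 ({..<N div card H1} \<times> H1) ?I"
    "\<And>c p. c \<in> C \<Longrightarrow> p \<in> {..<N div card H1} \<times> H1 \<Longrightarrow> \<Phi>1 (lmul G c p) = lmul G c (\<Phi>1 p)"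
    using free_action_restrict[OF C H1(1,3,2), of "{..<N div card H1}"] dvd(1) by auto
  obtain \<Phi>2 where \<Phi>2: "bij_betw \<Phi>2 ({..<N div card H2} \<times> H2) ?I"
    "\<And>c p. c \<in> C \<Longrightarrow> p \<in> {..<N div card H2} \<times> H2 \<Longrightarrow> \<Phi>2 (lmul G c p) = lmul G c (\<Phi>2 p)"
    using free_action_restrict[OF C H2(1,3,2), of "{..<N div card H2}"] dvd(2) by auto
  define \<Phi>2' where "\<Phi>2' = inv_into ({..<N div card H2} \<times> H2) \<Phi>2"
  have \<Phi>2': "bij_betw \<Phi>2' ?I ({..<N div card H2} \<times> H2)" "\<And>x. x \<in> ?I \<Longrightarrow> \<Phi>2 (\<Phi>2' x) = x"
    "\<And>p. p \<in> {..<N div card H2} \<times> H2 \<Longrightarrow> \<Phi>2' (\<Phi>2 p) = p"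
    using bij_betw_inv_into[OF \<Phi>2(1)] bij_betw_inv_into_right[OF \<Phi>2(1)] bij_betw_inv_into_left[OF \<Phi>2(1)]
    by (simp_all add: \<Phi>2'_def)
  define \<Psi>2 where "\<Psi>2 = \<Phi>2' \<circ> (\<Phi>1 \<circ> \<Psi>1)"
  have bij: "bij_betw \<Psi>2 {..<N} ({..<N div card H2} \<times> H2)"
    unfolding \<Psi>2_def by (rule bij_betw_trans[OF bij_betw_trans[OF \<Psi>1 \<Phi>1(1)] \<Phi>2'(1)])
  have "\<Psi>2 y = lmul G c (\<Psi>2 x)" if c: "c \<in> C" and xy: "x < N" "y < N" and eq: "\<Psi>1 y = lmul G c (\<Psi>1 x)" for c x y
  proof -
    have x1: "\<Psi>1 x \<in> {..<N div card H1} \<times> H1" using bij_betw_apply[OF \<Psi>1] xy by simp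
    have x1I: "\<Phi>1 (\<Psi>1 x) \<in> ?I" using bij_betw_apply[OF \<Phi>1(1) x1] .
    have x2: "\<Psi>2 x \<in> {..<N div card H2} \<times> H2" using bij_betw_apply[OF bij] xy by simp
    have "\<Phi>2 (\<Psi>2 x) = \<Phi>1 (\<Psi>1 x)" using \<Phi>2'(2)[OF x1I] by (simp add: \<Psi>2_def)
    then have "\<Phi>1 (\<Psi>1 y) = \<Phi>2 (lmul G c (\<Psi>2 x))"
      using \<Phi>1(2)[OF c x1] \<Phi>2(2)[OF c x2] by (simp add: eq)
    moreover have "lmul G c (\<Psi>2 x) \<in> {..<N div card H2} \<times> H2"
      using x2 c H2(3) subgroup.m_closed[OF H2(1)] by (cases "\<Psi>2 x") auto
    ultimately show ?thesis using \<Phi>2'(3) by (simp add: \<Psi>2_def)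
  qed
  with bij show ?thesis by (rule that)
qed

text \<open>The vertex groups act freely and compatibly on the finite set \<open>{..<N}\<close>, and \<open>u v\<close> is the
  group coordinate of a point for the action of the vertex group at \<open>v\<close>. The cocycle with values
  in the free group on the set \<open>carrier W\<close> which on the vertex group at \<open>v\<close> is the coboundary of
  \<open>b v\<close> is well defined, and evaluating it in \<open>W\<close> gives back the group element up to the
  coboundary of \<open>u root\<close>. So it embeds a point stabilizer in a free group.\<close>

theorem tree_of_finite_groups_virtually_free:
  fixes W :: "'a monoid" and V :: "'v set" and H C :: "'v \<Rightarrow> 'a set" and rank :: "'v \<Rightarrow> nat" and root :: 'v
  assumes "group W" and root: "root \<in> V" and N: "N > 0"
    and H: "\<And>v. v \<in> V \<Longrightarrow> subgroup (H v) W" "\<And>v. v \<in> V \<Longrightarrow> finite (H v)" "\<And>v. v \<in> V \<Longrightarrow> card (H v) dvd N"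
    and par: "\<And>v. v \<in> V \<Longrightarrow> v \<noteq> root \<Longrightarrow> par v \<in> V" "\<And>v. v \<in> V \<Longrightarrow> v \<noteq> root \<Longrightarrow> rank (par v) < rank v"
    and C: "\<And>v. v \<in> V \<Longrightarrow> v \<noteq> root \<Longrightarrow> subgroup (C v) W"
      "\<And>v. v \<in> V \<Longrightarrow> v \<noteq> root \<Longrightarrow> C v \<subseteq> H v" "\<And>v. v \<in> V \<Longrightarrow> v \<noteq> root \<Longrightarrow> C v \<subseteq> H (par v)"
    and gen: "generate W (\<Union>v\<in>V. H v) = carrier W"
    and univ: "\<And>(A :: (nat \<times> 'a word set) set) f.
      (\<And>v. v \<in> V \<Longrightarrow> f v \<in> hom (W\<lparr>carrier := H v\<rparr>) (perm_group A)) \<Longrightarrow>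
      (\<And>v c. v \<in> V \<Longrightarrow> v \<noteq> root \<Longrightarrow> c \<in> C v \<Longrightarrow> f v c = f (par v) c) \<Longrightarrow>
      \<exists>\<rho>\<in>hom W (perm_group A). \<forall>v\<in>V. \<forall>g\<in>H v. \<rho> g = f v g"
  shows "virtually_free W"
proof -
  interpret W: group W by fact
  have HW: "g \<in> carrier W" if "v \<in> V" "g \<in> H v" for v g
    using subgroup.subset[OF H(1)[OF that(1)]] that(2) by blast
  \<comment> \<open>\<open>\<Psi> v\<close> are coordinates on \<open>{..<N}\<close> for a free
    action of \<open>H v\<close>. Going outward from the root they are chosen so that each edge
    group acts alike in the coordinates of \<open>v\<close> and of its parent.\<close>
  define good where "good \<Psi> v \<psi> \<longleftrightarrow>
    (v \<in> V \<longrightarrow> bij_betw \<psi> {..<N} ({..<N div card (H v)} \<times> H v) \<and>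
      (v \<noteq> root \<longrightarrow> (\<forall>c\<in>C v. \<forall>x<N. \<forall>y<N. \<Psi> (par v) y = lmul W c (\<Psi> (par v) x) \<longrightarrow> \<psi> y = lmul W c (\<psi> x))))"
    for \<Psi> :: "'v \<Rightarrow> nat \<Rightarrow> nat \<times> 'a" and v and \<psi> :: "nat \<Rightarrow> nat \<times> 'a"
  have "\<exists>\<Psi>. \<forall>v. good \<Psi> v (\<Psi> v)"
  proof (rule dependent_wf_choice[of "measure rank" good])
    show "wf (measure rank)" by simp
  next
    fix f g :: "'v \<Rightarrow> nat \<Rightarrow> nat \<times> 'a" and v r
    assume "\<And>z. (z, v) \<in> measure rank \<Longrightarrow> f z = g z"
    then have "f (par v) = g (par v)" if "v \<in> V" "v \<noteq> root" using par(2)[OF that] by simp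
    then show "good f v r = good g v r" by (auto simp: good_def)
  next
    fix v and f :: "'v \<Rightarrow> nat \<Rightarrow> nat \<times> 'a"
    assume IH: "\<And>z. (z, v) \<in> measure rank \<Longrightarrow> good f z (f z)"
    show "\<exists>r. good f v r"
    proof (cases "v \<in> V")
      case v: True
      show ?thesis
      proof (cases "v = root")
        case True
        have "card {..<N} = card ({..<N div card (H v)} \<times> H v)"
          using H(3)[OF v] by (simp add: card_cartesian_product)
        moreover have "finite ({..<N div card (H v)} \<times> H v)" using H(2)[OF v] by simp
        ultimately obtain r where "bij_betw r {..<N} ({..<N div card (H v)} \<times> H v)"
          using finite_same_card_bij[of "{..<N}"] by blast
        then show ?thesis using True by (auto simp: good_def)
      next
        case False
        have "good f (par v) (f (par v))" using IH par(2)[OF v False] by simp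
        then have fp: "bij_betw (f (par v)) {..<N} ({..<N div card (H (par v))} \<times> H (par v))"
          using par(1)[OF v False] by (simp add: good_def)
        note p = par(1)[OF v False]
        obtain r where "bij_betw r {..<N} ({..<N div card (H v)} \<times> H v)"
          "\<And>c x y. c \<in> C v \<Longrightarrow> x < N \<Longrightarrow> y < N \<Longrightarrow> f (par v) y = lmul W c (f (par v) x) \<Longrightarrow> r y = lmul W c (r x)"
          using W.free_action_extend[OF C(1)[OF v False] H(1,2)[OF p] C(3)[OF v False]
              H(1,2)[OF v] C(2)[OF v False] fp H(3)[OF p] H(3)[OF v]] by blast
        then have "good f v r" by (auto simp: good_def)
        then show ?thesis by blast
      qed
    qed (simp add: good_def)
  qed
  then obtain \<Psi> where good: "\<And>v. good \<Psi> v (\<Psi> v)" by blast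
  have \<Psi>: "bij_betw (\<Psi> v) {..<N} ({..<N div card (H v)} \<times> H v)" if "v \<in> V" for v
    using good[of v] that by (simp add: good_def)
  have \<Psi>_par: "\<Psi> v y = lmul W c (\<Psi> v x)"
    if "v \<in> V" "v \<noteq> root" "c \<in> C v" "x < N" "y < N" "\<Psi> (par v) y = lmul W c (\<Psi> (par v) x)" for v c x y
    using good[of v] that by (simp add: good_def)
  have \<Psi>_inj: "x = y" if "v \<in> V" "x < N" "y < N" "\<Psi> v x = \<Psi> v y" for v x y
    using \<Psi>[OF that(1)] that(2-4) by (auto simp: bij_betw_def inj_on_def)
  define u where "u v x = snd (\<Psi> v x)" for v x
  have u_H: "u v x \<in> H v" if "v \<in> V" "x < N" for v x
  proof -
    have "\<Psi> v x \<in> {..<N div card (H v)} \<times> H v" using \<Psi>[OF that(1)] that(2) by (auto simp: bij_betw_def)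
    then show ?thesis by (cases "\<Psi> v x") (simp add: u_def)
  qed
  have u_W: "u v x \<in> carrier W" if "v \<in> V" "x < N" for v x
    using HW[OF that(1) u_H[OF that]] .
  define act where "act v g x = inv_into {..<N} (\<Psi> v) (lmul W g (\<Psi> v x))" for v g x
  have act: "act v g x < N" "\<Psi> v (act v g x) = lmul W g (\<Psi> v x)"
    if "v \<in> V" "g \<in> H v" "x < N" for v g x
  proof -
    have "\<Psi> v x \<in> {..<N div card (H v)} \<times> H v" using \<Psi>[OF that(1)] that(3) by (auto simp: bij_betw_def)
    then have "lmul W g (\<Psi> v x) \<in> {..<N div card (H v)} \<times> H v"
      using subgroup.m_closed[OF H(1)[OF that(1)] that(2)] by (cases "\<Psi> v x") auto
    then have *: "lmul W g (\<Psi> v x) \<in> \<Psi> v ` {..<N}" using \<Psi>[OF that(1)] by (simp add: bij_betw_def)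
    show "act v g x < N" using inv_into_into[OF *] by (simp add: act_def)
    show "\<Psi> v (act v g x) = lmul W g (\<Psi> v x)" using f_inv_into_f[OF *] by (simp add: act_def)
  qed
  have u_act: "u v (act v g x) = g \<otimes>\<^bsub>W\<^esub> u v x" if "v \<in> V" "g \<in> H v" "x < N" for v g x
    using act(2)[OF that] by (simp add: u_def)
  have act_eq: "act v g x = y" if "v \<in> V" "g \<in> H v" "x < N" "y < N" "\<Psi> v y = lmul W g (\<Psi> v x)" for v g x y
    using \<Psi>_inj[OF that(1) act(1)[OF that(1-3)] that(4)] act(2)[OF that(1-3)] that(5) by simp
  have act_mult: "act v (g \<otimes>\<^bsub>W\<^esub> h) x = act v g (act v h x)" if "v \<in> V" "g \<in> H v" "h \<in> H v" "x < N" for v g h x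
    by (rule act_eq)
      (use that act[of v h x] act[of v g "act v h x"] subgroup.m_closed[OF H(1)] HW u_W[of v x] in
        \<open>simp_all add: u_def W.m_assoc\<close>)
  have act_one: "act v \<one>\<^bsub>W\<^esub> x = x" if "v \<in> V" "x < N" for v x
    by (rule act_eq) (use that subgroup.one_closed[OF H(1)] u_W[OF that] in \<open>simp_all add: u_def\<close>)
  have act_par: "act v c x = act (par v) c x" if v: "v \<in> V" "v \<noteq> root" and c: "c \<in> C v" and x: "x < N" for v c x
  proof -
    have c': "c \<in> H v" "c \<in> H (par v)" using c C(2,3)[OF v] by auto
    note p = act[OF par(1)[OF v] c'(2) x]
    show ?thesis by (rule act_eq[OF v(1) c'(1) x p(1)]) (rule \<Psi>_par[OF v c x p])
  qed

  \<comment> \<open>One free generator for each element of \<open>W\<close> gives a tautological map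
    \<open>val\<close> back to \<open>W\<close>.\<close>
  define K where "K = free_group (carrier W)"
  interpret K: group K unfolding K_def by (rule group_presented_group)
  define y where "y g = word_class (carrier W) {} [(g, True)]" for g
  have y_closed: "y g \<in> carrier K" if "g \<in> carrier W" for g
    using that by (auto simp: y_def K_def carrier_presented_group)
  obtain val where val: "val \<in> hom K W" and val_y: "\<And>g. g \<in> carrier W \<Longrightarrow> val (y g) = g"
  proof -
    have "(\<lambda>x. x) \<in> carrier W \<rightarrow> carrier W" by simp
    then obtain \<phi> where \<phi>: "\<phi> \<in> hom K W"
      "\<And>w. w \<in> words_over (carrier W) \<Longrightarrow> \<phi> (word_class (carrier W) {} w) = ev W (\<lambda>x. x) w"
      using presented_group_hom[OF W.is_group, of "\<lambda>x. x" "carrier W" "{}"] unfolding K_def by blast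
    have "\<phi> (y g) = g" if "g \<in> carrier W" for g
      using \<phi>(2)[of "[(g, True)]"] that by (simp add: y_def letter_def)
    then show ?thesis using \<phi>(1) that by blast
  qed
  interpret val: group_hom K W val
    using val by (simp add: group_hom_def group_hom_axioms_def K.is_group W.is_group)

  \<comment> \<open>Under an element of \<open>C v\<close> both group coordinates
    \<open>u v x\<close> and \<open>u (par v) x\<close> are multiplied by it on the left, so the
    factor contributed by the edge does not change. Hence \<open>b v\<close> and
    \<open>b (par v)\<close> have the same coboundary on the edge group.\<close>
  define goodb where "goodb b v r \<longleftrightarrow> r = (if v \<in> V \<and> v \<noteq> root
      then (\<lambda>x. y (inv\<^bsub>W\<^esub> u v x \<otimes>\<^bsub>W\<^esub> u (par v) x) \<otimes>\<^bsub>K\<^esub> b (par v) x) else (\<lambda>_. \<one>\<^bsub>K\<^esub>))"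
    for b :: "'v \<Rightarrow> nat \<Rightarrow> 'a word set" and v r
  have "\<exists>b. \<forall>v. goodb b v (b v)"
  proof (rule dependent_wf_choice[of "measure rank" goodb])
    fix f g :: "'v \<Rightarrow> nat \<Rightarrow> 'a word set" and v r
    assume "\<And>z. (z, v) \<in> measure rank \<Longrightarrow> f z = g z"
    then have "f (par v) = g (par v)" if "v \<in> V" "v \<noteq> root" using par(2)[OF that] by simp
    then show "goodb f v r = goodb g v r" by (auto simp: goodb_def)
  qed (auto simp: goodb_def)
  then obtain b where goodb: "\<And>v. goodb b v (b v)" by blast
  have b_root: "b root x = \<one>\<^bsub>K\<^esub>" for x using goodb[of root] by (simp add: goodb_def)
  have b_par: "b v x = y (inv\<^bsub>W\<^esub> u v x \<otimes>\<^bsub>W\<^esub> u (par v) x) \<otimes>\<^bsub>K\<^esub> b (par v) x" if "v \<in> V" "v \<noteq> root" for v x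
    using goodb[of v] that by (simp add: goodb_def)
  \<comment> \<open>The values of the factors telescope along the path to the root.\<close>
  have b: "b v x \<in> carrier K \<and> val (b v x) = inv\<^bsub>W\<^esub> u v x \<otimes>\<^bsub>W\<^esub> u root x" if "v \<in> V" "x < N" for v x
    using that(1)
  proof (induction "rank v" arbitrary: v rule: less_induct)
    case less
    show ?case
    proof (cases "v = root")
      case True
      then show ?thesis using b_root u_W[OF root that(2)] by simp
    next
      case False
      note p = par[OF less.prems False]
      note IH = less.hyps[OF p(2,1)]
      have uu: "u v x \<in> carrier W" "u (par v) x \<in> carrier W" "u root x \<in> carrier W"
        using u_W less.prems p(1) root that(2) by auto
      then show ?thesis
        using IH y_closed[of "inv\<^bsub>W\<^esub> u v x \<otimes>\<^bsub>W\<^esub> u (par v) x"]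
        by (simp add: b_par[OF less.prems False] val_y W.m_assoc)
          (simp flip: W.m_assoc)
    qed
  qed

  define A where "A = {..<N} \<times> carrier K"
  \<comment> \<open>The action on points, with the coboundary of \<open>b v\<close> as a cocycle in
    the second coordinate.\<close>
  define f where "f v g = (\<lambda>(x, k). if x < N \<and> k \<in> carrier K
      then (act v g x, inv\<^bsub>K\<^esub> b v (act v g x) \<otimes>\<^bsub>K\<^esub> (b v x \<otimes>\<^bsub>K\<^esub> k)) else (x, k))" for v g
  have f_in: "f v g p \<in> A" if "v \<in> V" "g \<in> H v" "p \<in> A" for v g p
    using that act(1) b by (auto simp: f_def A_def)
  have f_out: "f v g p = p" if "p \<notin> A" for v g p
    using that by (cases p) (auto simp: f_def A_def)
  have f_mult: "f v (g \<otimes>\<^bsub>W\<^esub> h) p = f v g (f v h p)" if vgh: "v \<in> V" "g \<in> H v" "h \<in> H v" for v g h p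
  proof (cases "p \<in> A")
    case True
    then obtain x k where p: "p = (x, k)" "x < N" "k \<in> carrier K" by (auto simp: A_def)
    let ?hx = "act v h x"
    have hx: "?hx < N" "act v g ?hx < N" using act(1) vgh p by auto
    have bb: "b v x \<in> carrier K" "b v ?hx \<in> carrier K" "b v (act v g ?hx) \<in> carrier K"
      using b vgh(1) p(2) hx by auto
    have "b v ?hx \<otimes>\<^bsub>K\<^esub> (inv\<^bsub>K\<^esub> b v ?hx \<otimes>\<^bsub>K\<^esub> (b v x \<otimes>\<^bsub>K\<^esub> k)) = b v x \<otimes>\<^bsub>K\<^esub> k"
      using bb p(3) by (simp flip: K.m_assoc)
    then show ?thesis
      using p hx bb act_mult[OF vgh p(2)] by (simp add: f_def)
  qed (simp add: f_out)
  have f_one: "f v \<one>\<^bsub>W\<^esub> p = p" if v: "v \<in> V" for v p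
  proof (cases "p \<in> A")
    case True
    then obtain x k where p: "p = (x, k)" "x < N" "k \<in> carrier K" by (auto simp: A_def)
    then show ?thesis
      using act_one[OF v p(2)] b[OF v p(2)] by (simp add: f_def flip: K.m_assoc)
  qed (simp add: f_out)
  have f_perm: "f v g permutes A" if "v \<in> V" "g \<in> H v" for v g
  proof (rule bij_imp_permutes)
    have gi: "inv\<^bsub>W\<^esub> g \<in> H v" using subgroup.m_inv_closed[OF H(1)[OF that(1)] that(2)] .
    have g: "g \<in> carrier W" using HW that by blast
    have "f v (inv\<^bsub>W\<^esub> g) (f v g p) = p" "f v g (f v (inv\<^bsub>W\<^esub> g) p) = p" for p
      using f_mult[OF that(1) gi that(2), of p] f_mult[OF that(1) that(2) gi, of p] f_one[OF that(1)] g
      by simp_all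
    then show "bij_betw (f v g) A A"
      using f_in[OF that] f_in[OF that(1) gi]
      by (intro bij_betw_byWitness[where f' = "f v (inv\<^bsub>W\<^esub> g)"]) auto
  qed (simp add: f_out)
  \<comment> \<open>\<open>univ\<close> is the universal property of the amalgam along the tree, for
    permutations of sets of the one type that occurs here. Its compatibility condition on the edge
    groups is the invariance of the edge factors.\<close>
  have "\<exists>\<rho>\<in>hom W (perm_group A). \<forall>v\<in>V. \<forall>g\<in>H v. \<rho> g = f v g"
  proof (rule univ)
    show "f v \<in> hom (W\<lparr>carrier := H v\<rparr>) (perm_group A)" if "v \<in> V" for v
      using that f_perm f_mult by (intro homI) (auto simp: fun_eq_iff)
    fix v c assume v: "v \<in> V" "v \<noteq> root" and c: "c \<in> C v"
    have c': "c \<in> H v" "c \<in> H (par v)" using c C(2,3)[OF v] by auto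
    note pV = par(1)[OF v]
    show "f v c = f (par v) c"
    proof
      fix p
      show "f v c p = f (par v) c p"
      proof (cases "p \<in> A")
        case True
        then obtain x k where p: "p = (x, k)" "x < N" "k \<in> carrier K" by (auto simp: A_def)
        define x' where "x' = act v c x"
        have x': "x' < N" "x' = act (par v) c x" using act(1)[OF v(1) c'(1) p(2)] act_par[OF v c p(2)] by (auto simp: x'_def)
        have cW: "c \<in> carrier W" using HW[OF v(1) c'(1)] .
        have uu: "u v x \<in> carrier W" "u (par v) x \<in> carrier W" using u_W v(1) pV p(2) by auto
        define z where "z = y (inv\<^bsub>W\<^esub> u v x \<otimes>\<^bsub>W\<^esub> u (par v) x)"
        have z: "z \<in> carrier K" using uu by (simp add: z_def y_closed)
        have "inv\<^bsub>W\<^esub> u v x' \<otimes>\<^bsub>W\<^esub> u (par v) x' = inv\<^bsub>W\<^esub> u v x \<otimes>\<^bsub>W\<^esub> u (par v) x"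
          using u_act[OF v(1) c'(1) p(2)] u_act[OF pV c'(2) p(2)] uu cW x'(2)
          by (simp add: x'_def[symmetric] W.inv_mult_group W.m_assoc)
            (simp flip: W.m_assoc)
        then have bz: "b v x = z \<otimes>\<^bsub>K\<^esub> b (par v) x" "b v x' = z \<otimes>\<^bsub>K\<^esub> b (par v) x'"
          using b_par[OF v] by (simp_all add: z_def)
        have bb: "b (par v) x \<in> carrier K" "b (par v) x' \<in> carrier K" using b pV p(2) x'(1) by auto
        have "inv\<^bsub>K\<^esub> b v x' \<otimes>\<^bsub>K\<^esub> (b v x \<otimes>\<^bsub>K\<^esub> k) =
            inv\<^bsub>K\<^esub> b (par v) x' \<otimes>\<^bsub>K\<^esub> (inv\<^bsub>K\<^esub> z \<otimes>\<^bsub>K\<^esub> z) \<otimes>\<^bsub>K\<^esub> (b (par v) x \<otimes>\<^bsub>K\<^esub> k)"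
          using bb z p(3) by (simp only: bz K.inv_mult_group K.m_assoc K.m_closed K.inv_closed)
        also have "\<dots> = inv\<^bsub>K\<^esub> b (par v) x' \<otimes>\<^bsub>K\<^esub> (b (par v) x \<otimes>\<^bsub>K\<^esub> k)"
          using bb z p(3) by simp
        finally show ?thesis using p x' by (simp add: f_def x'_def[symmetric])
      qed (simp add: f_out)
    qed
  qed
  then obtain \<rho> where \<rho>: "\<rho> \<in> hom W (perm_group A)" "\<And>v g. v \<in> V \<Longrightarrow> g \<in> H v \<Longrightarrow> \<rho> g = f v g" by blast
  note \<rho>_simps = hom_perm_group_simps[OF W.is_group \<rho>(1)]
  note \<rho>_one = \<rho>_simps(2)[OF W.one_closed]
  let ?u = "u root"
  \<comment> \<open>\<open>w\<close> moves the fibre over \<open>x\<close> to the one over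
    \<open>x'\<close> by left translation with \<open>c\<close>, and \<open>val c\<close> determines
    \<open>w\<close> from the root coordinates of both points. At the fixed point 0 of a stabilizer
    this makes \<open>\<eta>\<close> injective.\<close>
  define coc where "coc w \<longleftrightarrow> (\<forall>x<N. \<exists>x'<N. \<exists>c\<in>carrier K.
    (\<forall>k\<in>carrier K. \<rho> w (x, k) = (x', c \<otimes>\<^bsub>K\<^esub> k)) \<and> ?u x' \<otimes>\<^bsub>W\<^esub> val c = w \<otimes>\<^bsub>W\<^esub> ?u x)" for w
  have coc_mult: "coc (g \<otimes>\<^bsub>W\<^esub> w)" if v: "v \<in> V" and g: "g \<in> H v" and w: "w \<in> carrier W" "coc w" for v g w
    unfolding coc_def
  proof (intro allI impI)
    fix x assume x: "x < N"
    obtain x' c where c: "x' < N" "c \<in> carrier K" "\<And>k. k \<in> carrier K \<Longrightarrow> \<rho> w (x, k) = (x', c \<otimes>\<^bsub>K\<^esub> k)"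
      "?u x' \<otimes>\<^bsub>W\<^esub> val c = w \<otimes>\<^bsub>W\<^esub> ?u x"
      using w(2) x unfolding coc_def by blast
    define x'' where "x'' = act v g x'"
    have x'': "x'' < N" using act(1)[OF v g c(1)] by (simp add: x''_def)
    define d where "d = inv\<^bsub>K\<^esub> b v x'' \<otimes>\<^bsub>K\<^esub> b v x'"
    have bb: "b v x' \<in> carrier K" "b v x'' \<in> carrier K" using b v c(1) x'' by auto
    have d: "d \<in> carrier K" using bb by (simp add: d_def)
    have gW: "g \<in> carrier W" using HW[OF v g] .
    have uu: "u v x' \<in> carrier W" "u v x'' \<in> carrier W" "?u x' \<in> carrier W" "?u x'' \<in> carrier W" "?u x \<in> carrier W"
      using u_W v root c(1) x'' x by auto
    have "val d = inv\<^bsub>W\<^esub> (inv\<^bsub>W\<^esub> u v x'' \<otimes>\<^bsub>W\<^esub> ?u x'') \<otimes>\<^bsub>W\<^esub> (inv\<^bsub>W\<^esub> u v x' \<otimes>\<^bsub>W\<^esub> ?u x')"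
      using bb b[OF v c(1)] b[OF v x''] by (simp add: d_def)
    also have "\<dots> = inv\<^bsub>W\<^esub> ?u x'' \<otimes>\<^bsub>W\<^esub> (u v x'' \<otimes>\<^bsub>W\<^esub> inv\<^bsub>W\<^esub> u v x') \<otimes>\<^bsub>W\<^esub> ?u x'"
      using uu by (simp add: W.inv_mult_group W.m_assoc)
    also have "u v x'' \<otimes>\<^bsub>W\<^esub> inv\<^bsub>W\<^esub> u v x' = g"
      using u_act[OF v g c(1)] uu gW by (simp add: x''_def W.m_assoc)
    finally have vd: "?u x'' \<otimes>\<^bsub>W\<^esub> val d = g \<otimes>\<^bsub>W\<^esub> ?u x'"
      using uu gW by (simp flip: W.m_assoc)
    have "?u x'' \<otimes>\<^bsub>W\<^esub> val (d \<otimes>\<^bsub>K\<^esub> c) = (?u x'' \<otimes>\<^bsub>W\<^esub> val d) \<otimes>\<^bsub>W\<^esub> val c"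
      using uu d c(2) by (simp add: W.m_assoc)
    also have "\<dots> = g \<otimes>\<^bsub>W\<^esub> (?u x' \<otimes>\<^bsub>W\<^esub> val c)"
      unfolding vd using uu gW c(2) by (simp add: W.m_assoc)
    also have "\<dots> = g \<otimes>\<^bsub>W\<^esub> w \<otimes>\<^bsub>W\<^esub> ?u x"
      unfolding c(4) using uu gW w(1) by (simp add: W.m_assoc)
    finally have "?u x'' \<otimes>\<^bsub>W\<^esub> val (d \<otimes>\<^bsub>K\<^esub> c) = g \<otimes>\<^bsub>W\<^esub> w \<otimes>\<^bsub>W\<^esub> ?u x" .
    moreover have "\<rho> (g \<otimes>\<^bsub>W\<^esub> w) (x, k) = (x'', d \<otimes>\<^bsub>K\<^esub> c \<otimes>\<^bsub>K\<^esub> k)" if k: "k \<in> carrier K" for k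
    proof -
      have "\<rho> (g \<otimes>\<^bsub>W\<^esub> w) (x, k) = f v g (x', c \<otimes>\<^bsub>K\<^esub> k)"
        using \<rho>_simps(1)[OF gW w(1)] c(3)[OF k] \<rho>(2)[OF v g] by simp
      also have "\<dots> = (x'', d \<otimes>\<^bsub>K\<^esub> c \<otimes>\<^bsub>K\<^esub> k)"
        using c(1,2) k bb by (simp add: f_def x''_def[symmetric] d_def K.m_assoc)
      finally show ?thesis .
    qed
    ultimately show "\<exists>x'<N. \<exists>c\<in>carrier K. (\<forall>k\<in>carrier K. \<rho> (g \<otimes>\<^bsub>W\<^esub> w) (x, k) = (x', c \<otimes>\<^bsub>K\<^esub> k)) \<and>
        ?u x' \<otimes>\<^bsub>W\<^esub> val c = g \<otimes>\<^bsub>W\<^esub> w \<otimes>\<^bsub>W\<^esub> ?u x"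
      using x'' d c(2) by (intro exI[of _ x''] conjI bexI[of _ "d \<otimes>\<^bsub>K\<^esub> c"] ballI) auto
  qed
  have sub: "(\<Union>v\<in>V. H v) \<subseteq> carrier W" using HW by blast
  have coc: "coc w" if "w \<in> carrier W" for w
    using sub that[folded gen]
  proof (induction rule: W.generate_left_induct)
    case one
    show ?case unfolding coc_def
    proof (intro allI impI)
      fix x assume x: "x < N"
      then show "\<exists>x'<N. \<exists>c\<in>carrier K. (\<forall>k\<in>carrier K. \<rho> \<one>\<^bsub>W\<^esub> (x, k) = (x', c \<otimes>\<^bsub>K\<^esub> k)) \<and>
          ?u x' \<otimes>\<^bsub>W\<^esub> val c = \<one>\<^bsub>W\<^esub> \<otimes>\<^bsub>W\<^esub> ?u x"
        using u_W[OF root x] by (intro exI[of _ x] conjI bexI[of _ "\<one>\<^bsub>K\<^esub>"]) (auto simp: \<rho>_one)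
    qed
  next
    case (gen x g)
    then obtain v where "v \<in> V" "x \<in> H v" by blast
    then show ?case using coc_mult gen(2,3) \<open>generate W (\<Union>v\<in>V. H v) = carrier W\<close> by simp
  next
    case (inv x g)
    then obtain v where v: "v \<in> V" "x \<in> H v" by blast
    then have "inv\<^bsub>W\<^esub> x \<in> H v" using subgroup.m_inv_closed[OF H(1)] by blast
    then show ?case
      using coc_mult[OF v(1)] inv(2,3) \<open>generate W (\<Union>v\<in>V. H v) = carrier W\<close> by simp
  qed

  \<comment> \<open>The stabilizer of the point 0, which exists because \<open>N > 0\<close>. Its
    record \<open>\<eta>\<close> need not be surjective; the Nielsen-Schreier theorem makes the
    image free.\<close>
  define F where "F = {w \<in> carrier W. fst (\<rho> w (0, \<one>\<^bsub>K\<^esub>)) = 0}"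
  define \<eta> where "\<eta> w = snd (\<rho> w (0, \<one>\<^bsub>K\<^esub>))" for w
  have \<eta>: "\<eta> w \<in> carrier K" "\<And>k. k \<in> carrier K \<Longrightarrow> \<rho> w (0, k) = (0, \<eta> w \<otimes>\<^bsub>K\<^esub> k)"
    "?u 0 \<otimes>\<^bsub>W\<^esub> val (\<eta> w) = w \<otimes>\<^bsub>W\<^esub> ?u 0" if w: "w \<in> F" for w
  proof -
    obtain x' c where c: "c \<in> carrier K" "\<And>k. k \<in> carrier K \<Longrightarrow> \<rho> w (0, k) = (x', c \<otimes>\<^bsub>K\<^esub> k)"
      "?u x' \<otimes>\<^bsub>W\<^esub> val c = w \<otimes>\<^bsub>W\<^esub> ?u 0"
      using coc[of w] w N unfolding coc_def F_def by blast
    have "x' = 0" "\<eta> w = c" using c(2)[OF K.one_closed] c(1) w by (auto simp: \<eta>_def F_def)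
    then show "\<eta> w \<in> carrier K" "\<And>k. k \<in> carrier K \<Longrightarrow> \<rho> w (0, k) = (0, \<eta> w \<otimes>\<^bsub>K\<^esub> k)"
      "?u 0 \<otimes>\<^bsub>W\<^esub> val (\<eta> w) = w \<otimes>\<^bsub>W\<^esub> ?u 0" using c by auto
  qed
  have FW: "w \<in> carrier W" if "w \<in> F" for w using that by (simp add: F_def)
  have mult: "w \<otimes>\<^bsub>W\<^esub> w' \<in> F \<and> \<eta> (w \<otimes>\<^bsub>W\<^esub> w') = \<eta> w \<otimes>\<^bsub>K\<^esub> \<eta> w'" if "w \<in> F" "w' \<in> F" for w w'
  proof -
    have "\<rho> (w \<otimes>\<^bsub>W\<^esub> w') (0, \<one>\<^bsub>K\<^esub>) = (0, \<eta> w \<otimes>\<^bsub>K\<^esub> \<eta> w')"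
      using \<rho>_simps(1)[OF FW[OF that(1)] FW[OF that(2)]] \<eta>[OF that(1)] \<eta>[OF that(2)] by simp
    then show ?thesis using FW that by (simp add: F_def \<eta>_def)
  qed
  have F: "subgroup F W"
  proof (rule subgroup.intro)
    show "F \<subseteq> carrier W" using FW by blast
    show "\<one>\<^bsub>W\<^esub> \<in> F" by (simp add: F_def \<rho>_one)
    show "w \<otimes>\<^bsub>W\<^esub> w' \<in> F" if "w \<in> F" "w' \<in> F" for w w' using mult that by blast
    show "inv\<^bsub>W\<^esub> w \<in> F" if w: "w \<in> F" for w
    proof -
      have "\<rho> w (0, inv\<^bsub>K\<^esub> \<eta> w) = (0, \<one>\<^bsub>K\<^esub>)" using \<eta>[OF w] by simp
      then have "\<rho> (inv\<^bsub>W\<^esub> w) (0, \<one>\<^bsub>K\<^esub>) = (0, inv\<^bsub>K\<^esub> \<eta> w)"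
        using \<rho>_simps(4)[OF FW[OF w], of "(0, inv\<^bsub>K\<^esub> \<eta> w)"] by simp
      then show ?thesis using FW[OF w] by (simp add: F_def)
    qed
  qed
  have "is_free_group (W\<lparr>carrier := F\<rparr>)"
  proof (rule is_free_group_if_embeds)
    show "group (W\<lparr>carrier := F\<rparr>)" by (rule W.subgroup_imp_group[OF F])
    show "group K" by (rule K.is_group)
    show "is_free_group K" unfolding K_def by (rule is_free_group_free_group)
    show "\<eta> \<in> hom (W\<lparr>carrier := F\<rparr>) K" by (rule homI) (simp_all add: \<eta> mult)
    have "w = w'" if ww: "w \<in> F" "w' \<in> F" "\<eta> w = \<eta> w'" for w w'
    proof -
      have "w \<otimes>\<^bsub>W\<^esub> ?u 0 = w' \<otimes>\<^bsub>W\<^esub> ?u 0"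
        using HOL.trans[OF \<eta>(3)[OF ww(1), symmetric] \<eta>(3)[OF ww(2), folded ww(3)]] .
      then show ?thesis using FW[OF ww(1)] FW[OF ww(2)] u_W[OF root N] by simp
    qed
    then show "inj_on \<eta> (carrier (W\<lparr>carrier := F\<rparr>))" by (simp add: inj_on_def)
  qed
  moreover have "finite (rcosets\<^bsub>W\<^esub> F)"
  proof -
    \<comment> \<open>A right coset of \<open>F\<close> is determined by where the inverse of a
      representative sends 0, so there are at most \<open>N\<close> cosets.\<close>
    define orb where "orb w = fst (\<rho> (inv\<^bsub>W\<^esub> w) (0, \<one>\<^bsub>K\<^esub>))" for w
    have orb: "orb w < N" if "w \<in> carrier W" for w
    proof -
      have "\<rho> (inv\<^bsub>W\<^esub> w) (0, \<one>\<^bsub>K\<^esub>) \<in> A" using \<rho>_simps(3)[of "inv\<^bsub>W\<^esub> w"] that N by (simp add: A_def)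
      then show ?thesis by (auto simp: orb_def A_def)
    qed
    have same: "F #>\<^bsub>W\<^esub> w = F #>\<^bsub>W\<^esub> w'" if w: "w \<in> carrier W" "w' \<in> carrier W" "orb w = orb w'" for w w'
    proof -
      obtain x c where c: "c \<in> carrier K" "\<And>k. k \<in> carrier K \<Longrightarrow> \<rho> (inv\<^bsub>W\<^esub> w) (0, k) = (x, c \<otimes>\<^bsub>K\<^esub> k)"
        using coc[of "inv\<^bsub>W\<^esub> w"] w N unfolding coc_def by (meson W.inv_closed)
      obtain x' c' where c': "c' \<in> carrier K" "\<And>k. k \<in> carrier K \<Longrightarrow> \<rho> (inv\<^bsub>W\<^esub> w') (0, k) = (x', c' \<otimes>\<^bsub>K\<^esub> k)"
        using coc[of "inv\<^bsub>W\<^esub> w'"] w N unfolding coc_def by (meson W.inv_closed)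
      have "x = x'" using w(3) c(2)[OF K.one_closed] c'(2)[OF K.one_closed] by (simp add: orb_def)
      then have "\<rho> (inv\<^bsub>W\<^esub> w') (0, inv\<^bsub>K\<^esub> c' \<otimes>\<^bsub>K\<^esub> c) = \<rho> (inv\<^bsub>W\<^esub> w) (0, \<one>\<^bsub>K\<^esub>)"
        using c c' by (simp flip: K.m_assoc)
      then have "\<rho> w' (\<rho> (inv\<^bsub>W\<^esub> w) (0, \<one>\<^bsub>K\<^esub>)) = (0, inv\<^bsub>K\<^esub> c' \<otimes>\<^bsub>K\<^esub> c)"
        using \<rho>_simps(5)[OF w(2)] by (metis)
      then have F': "w' \<otimes>\<^bsub>W\<^esub> inv\<^bsub>W\<^esub> w \<in> F" using w by (simp add: F_def \<rho>_simps(1))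
      have "w' = (w' \<otimes>\<^bsub>W\<^esub> inv\<^bsub>W\<^esub> w) \<otimes>\<^bsub>W\<^esub> w" using w by (simp add: W.m_assoc)
      then have "w' \<in> F #>\<^bsub>W\<^esub> w" using F' unfolding r_coset_def by blast
      then show ?thesis using W.repr_independence[OF _ w(1) F] by blast
    qed
    have "finite ((\<lambda>w. F #>\<^bsub>W\<^esub> w) ` carrier W)"
    proof (rule finite_surj[of "{..<N}" _ "\<lambda>i. F #>\<^bsub>W\<^esub> (SOME w. w \<in> carrier W \<and> orb w = i)"])
      show "(\<lambda>w. F #>\<^bsub>W\<^esub> w) ` carrier W \<subseteq> (\<lambda>i. F #>\<^bsub>W\<^esub> (SOME w. w \<in> carrier W \<and> orb w = i)) ` {..<N}"
      proof (rule image_subsetI)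
        fix w assume w: "w \<in> carrier W"
        define w' where "w' = (SOME w'. w' \<in> carrier W \<and> orb w' = orb w)"
        have "w' \<in> carrier W \<and> orb w' = orb w" unfolding w'_def by (rule someI[of _ w]) (simp add: w)
        then have "F #>\<^bsub>W\<^esub> w = F #>\<^bsub>W\<^esub> w'" using same w by blast
        then show "F #>\<^bsub>W\<^esub> w \<in> (\<lambda>i. F #>\<^bsub>W\<^esub> (SOME w. w \<in> carrier W \<and> orb w = i)) ` {..<N}"
          using orb[OF w] unfolding w'_def by blast
      qed
    qed simp
    moreover have "rcosets\<^bsub>W\<^esub> F = (\<lambda>w. F #>\<^bsub>W\<^esub> w) ` carrier W" by (auto simp: RCOSETS_def)
    ultimately show ?thesis by simp
  qed
  ultimately show ?thesis
    using F W.is_group by (auto simp: virtually_free_def)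
qed

section \<open>Visual decompositions with finite vertex groups\<close>

lemma shortest_edge_path_reduced:
  assumes "edge_path \<Psi> T u p v" "\<And>q. edge_path \<Psi> T u q v \<Longrightarrow> length p \<le> length q"
  shows "reduced p"
proof (rule ccontr)
  assume "\<not> reduced p"
  then obtain xs e b ys where p: "p = xs @ [(e, b), (e, \<not> b)] @ ys"
    unfolding no_backtracking_iff[symmetric] no_backtracking_def by blast
  obtain w where "edge_path \<Psi> T u xs w" "edge_path \<Psi> T w ([(e, b), (e, \<not> b)] @ ys) v"
    using assms(1) edge_path_append_iff[of \<Psi> T u xs "[(e, b), (e, \<not> b)] @ ys" v] unfolding p by blast
  then have "edge_path \<Psi> T u (xs @ ys) v"
    unfolding edge_path_append_iff[of _ _ _ xs ys] by (cases b) auto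
  from assms(2)[OF this] show False using p by simp
qed

text \<open>A maximal tree is rooted at \<open>v0\<close> by shortest paths. An edge of the tree which is not the last
  edge of one of the chosen paths would close up two of them to a closed path without
  backtracking.\<close>

lemma rooted_tree:
  assumes T: "maximal_tree \<Psi> T" and v0: "v0 \<in> gverts \<Psi>"
  obtains par pe rank where
    "\<And>u. u \<in> gverts \<Psi> \<Longrightarrow> u \<noteq> v0 \<Longrightarrow> par u \<in> gverts \<Psi> \<and> rank (par u) < (rank u :: nat) \<and> pe u \<in> T \<and>
      {gsrc \<Psi> (pe u), gtgt \<Psi> (pe u)} = {u, par u}"
    "\<And>e. e \<in> T \<Longrightarrow> gsrc \<Psi> e \<in> gverts \<Psi> \<Longrightarrow> gtgt \<Psi> e \<in> gverts \<Psi> \<Longrightarrow>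
      \<exists>u\<in>gverts \<Psi>. u \<noteq> v0 \<and> pe u = e"
proof -
  define P where "P u = arg_min length (\<lambda>p. edge_path \<Psi> T v0 p u)" for u
  have P: "edge_path \<Psi> T v0 (P u) u" "\<And>q. edge_path \<Psi> T v0 q u \<Longrightarrow> length (P u) \<le> length q"
    if u: "u \<in> gverts \<Psi>" for u
  proof -
    obtain p where p: "edge_path \<Psi> T v0 p u"
      using T v0 u unfolding maximal_tree_def connected_edges_def by blast
    show "edge_path \<Psi> T v0 (P u) u"
      unfolding P_def by (rule arg_min_natI[of "\<lambda>p. edge_path \<Psi> T v0 p u", OF p])
    show "length (P u) \<le> length q" if "edge_path \<Psi> T v0 q u" for q
      unfolding P_def by (rule arg_min_nat_le[of "\<lambda>p. edge_path \<Psi> T v0 p u", OF that])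
  qed
  have red: "reduced (P u)" if "u \<in> gverts \<Psi>" for u
    by (rule shortest_edge_path_reduced[OF P(1)[OF that] P(2)[OF that]])
  have P0: "P v0 = []" using P(2)[OF v0, of "[]"] v0 by simp
  define par where "par u = step_from \<Psi> (last (P u))" for u
  define pe where "pe u = fst (last (P u))" for u
  define rank where "rank u = length (P u)" for u
  have ends: "{gsrc \<Psi> (fst d), gtgt \<Psi> (fst d)} = {step_to \<Psi> d, step_from \<Psi> d}" for d
    by (cases d) auto
  show ?thesis
  proof (rule that[of par rank pe])
    fix u assume u: "u \<in> gverts \<Psi>" "u \<noteq> v0"
    then have ne: "P u \<noteq> []" using P(1)[OF u(1)] by (cases "P u") auto
    then have "edge_path \<Psi> T v0 (butlast (P u) @ [last (P u)]) u" using P(1)[OF u(1)] by simp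
    then have path: "edge_path \<Psi> T v0 (butlast (P u)) (par u)" "par u \<in> gverts \<Psi>" "fst (last (P u)) \<in> T"
      "step_to \<Psi> (last (P u)) = u"
      unfolding edge_path_append_iff par_def by auto
    have "length (P (par u)) \<le> length (butlast (P u))" by (rule P(2)[OF path(2,1)])
    then have "rank (par u) < rank u" using ne by (simp add: rank_def) (metis Suc_pred le_imp_less_Suc length_greater_0_conv)
    then show "par u \<in> gverts \<Psi> \<and> rank (par u) < rank u \<and> pe u \<in> T \<and>
        {gsrc \<Psi> (pe u), gtgt \<Psi> (pe u)} = {u, par u}"
      using path ends[of "last (P u)"] by (simp add: pe_def par_def)
  next
    fix e assume e: "e \<in> T" "gsrc \<Psi> e \<in> gverts \<Psi>" "gtgt \<Psi> e \<in> gverts \<Psi>"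
    let ?a = "gsrc \<Psi> e" and ?z = "gtgt \<Psi> e"
    \<comment> \<open>The two chosen paths are reduced, so this closed path can backtrack only next
      to \<open>e\<close>, that is if \<open>e\<close> is the last edge of one of them.\<close>
    let ?p = "P ?a @ [(e, True)] @ rev (map flip (P ?z))"
    have "edge_path \<Psi> T ?a [(e, True)] ?z" using e by simp
    then have "edge_path \<Psi> T v0 ?p v0"
      using P(1)[OF e(2)] edge_path_rev[OF P(1)[OF e(3)]] unfolding edge_path_append_iff by blast
    then have "\<not> reduced ?p"
      using T unfolding maximal_tree_def acyclic_edges_def no_backtracking_iff by blast
    then have "P ?a \<noteq> [] \<and> last (P ?a) = (e, False) \<or> P ?z \<noteq> [] \<and> last (P ?z) = (e, True)"
      using red[OF e(2)] red[OF e(3)]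
      by (cases "last (P ?a)"; cases "last (P ?z)") (auto simp: reduced_append reduced_inverse hd_rev last_map)
    then show "\<exists>u\<in>gverts \<Psi>. u \<noteq> v0 \<and> pe u = e"
      using e P0 by (auto simp: pe_def intro: bexI[of _ ?a] bexI[of _ ?z])
  qed
qed

lemma (in group) hom_to_int_trivial:
  assumes "S \<subseteq> carrier G" "generate G S = carrier G" "\<And>s. s \<in> S \<Longrightarrow> s \<otimes> s = \<one>"
    and \<chi>: "\<And>x y. x \<in> carrier G \<Longrightarrow> y \<in> carrier G \<Longrightarrow> \<chi> (x \<otimes> y) = \<chi> x + (\<chi> y :: int)"
    and "x \<in> carrier G"
  shows "\<chi> x = 0"
proof -
  have one: "\<chi> \<one> = 0" using \<chi>[of \<one> \<one>] by simp
  have S: "\<chi> s = 0 \<and> inv s = s" if "s \<in> S" for s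
    using \<chi>[of s s] one assms(1,3) that inv_equality[of s s] by auto
  show ?thesis using assms(1) \<open>x \<in> carrier G\<close>[folded assms(2)]
  proof (induction rule: generate_left_induct)
    case one
    show ?case by (rule \<open>\<chi> \<one> = 0\<close>)
  next
    case (gen s g)
    then show ?case using \<chi>[of s g] S[of s] assms(1,2) by auto
  next
    case (inv s g)
    then show ?case using \<chi>[of s g] S[of s] assms(1,2) by auto
  qed
qed

definition int_group :: "int monoid" where
  "int_group = \<lparr>carrier = UNIV, monoid.mult = (+), one = 0\<rparr>"

lemma int_group_simps [simp]:
  "carrier int_group = UNIV" "x \<otimes>\<^bsub>int_group\<^esub> y = x + y" "\<one>\<^bsub>int_group\<^esub> = 0"
  by (simp_all add: int_group_def)

lemma group_int_group: "group int_group"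
  by (rule groupI) (auto intro: exI[of _ "- x" for x])

lemma inv_int_group [simp]: "inv\<^bsub>int_group\<^esub> x = - x"
  by (rule group.inv_equality[OF group_int_group]) auto

context coxeter_system
begin

text \<open>A stable letter would have infinite order in the abelianization, which is generated by
  involutions.\<close>

lemma visual_decomposition_tree:
  fixes \<Psi> :: "('v, 'e, 'a) gog"
  assumes gog: "graph_of_groups \<Psi>" and T: "T \<subseteq> gedges \<Psi>" and h: "h \<in> iso (gog_pi1 \<Psi> T) W"
  shows "T = gedges \<Psi>"
proof (rule ccontr)
  assume "T \<noteq> gedges \<Psi>"
  then obtain e where e: "e \<in> gedges \<Psi>" "e \<notin> T" using T by blast
  let ?P = "gog_pi1 \<Psi> T" and ?X = "gog_gens \<Psi>" and ?R = "gog_relators \<Psi> T"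
  interpret P: group ?P unfolding gog_pi1_def by (rule group_presented_group)
  \<comment> \<open>The exponent sum of the stable letter \<open>e\<close>. It vanishes on all
    relators: the letter occurs with both signs in its edge relators, and it is not killed since
    \<open>e\<close> is outside \<open>T\<close>.\<close>
  define f :: "'v \<times> 'a + 'e \<Rightarrow> int" where "f = case_sum (\<lambda>_. 0) (\<lambda>e'. if e' = e then 1 else 0)"
  have fX: "f \<in> ?X \<rightarrow> carrier int_group" by simp
  have rel: "ev int_group f r = \<one>\<^bsub>int_group\<^esub>" if "r \<in> ?R" for r
    using that e(2) unfolding gog_relators_def by (auto simp: f_def letter_def)
  obtain \<psi> where \<psi>: "\<psi> \<in> hom ?P int_group" "\<And>w. w \<in> words_over ?X \<Longrightarrow> \<psi> (word_class ?X ?R w) = ev int_group f w"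
    using presented_group_hom[OF group_int_group fX rel] unfolding gog_pi1_def by blast
  define h' where "h' = inv_into (carrier ?P) h"
  have h': "h' \<in> iso W ?P" unfolding h'_def by (rule P.iso_set_sym[OF h])
  define x where "x = word_class ?X ?R [(Inr e, True)]"
  have eX: "Inr e \<in> ?X" using e by (auto simp: gog_gens_def)
  have x: "x \<in> carrier ?P" using eX by (auto simp: x_def gog_pi1_def carrier_presented_group)
  have bij: "bij_betw h (carrier ?P) (carrier W)" using h by (simp add: iso_def)
  have hx: "h x \<in> carrier W" using bij_betw_apply[OF bij x] .
  have "(\<psi> \<circ> h') (h x) = 0"
  proof (rule hom_to_int_trivial[OF gens_closed generates involution _ hx])
    fix a b assume ab: "a \<in> carrier W" "b \<in> carrier W"
    have h'h: "h' \<in> hom W ?P" using h' by (simp add: iso_def)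
    show "(\<psi> \<circ> h') (a \<otimes> b) = (\<psi> \<circ> h') a + (\<psi> \<circ> h') b"
      using hom_mult[OF h'h ab] hom_mult[OF \<psi>(1) hom_in_carrier[OF h'h ab(1)] hom_in_carrier[OF h'h ab(2)]] by simp
  qed
  moreover have "h' (h x) = x" unfolding h'_def by (rule bij_betw_inv_into_left[OF bij x])
  moreover have "\<psi> x = 1" using \<psi>(2)[of "[(Inr e, True)]"] eX by (simp add: x_def letter_def f_def)
  ultimately show False by simp
qed

text \<open>With all edges in the maximal tree every stable letter is trivial, so a homomorphism
  from the fundamental group is a family of homomorphisms on the vertex groups that agree on the
  edge groups.\<close>

theorem visual_decomposition_imp_virtually_free:
  fixes \<Psi> :: "('v, 'e, 'a) gog"
  assumes fin: "finite S" and vis: "visual_decomposition W S \<Psi>"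
    and finv: "\<And>v. v \<in> gverts \<Psi> \<Longrightarrow> finite (carrier (vgroup \<Psi> v))"
  shows "virtually_free W"
proof -
  have gog: "graph_of_groups \<Psi>"
    and vg: "\<And>v. v \<in> gverts \<Psi> \<Longrightarrow> \<exists>H. special_subgroup W S H \<and> vgroup \<Psi> v = W\<lparr>carrier := H\<rparr>"
    and eg: "\<And>e. e \<in> gedges \<Psi> \<Longrightarrow> \<exists>H. special_subgroup W S H \<and> egroup \<Psi> e = W\<lparr>carrier := H\<rparr>"
    and inc: "\<And>e a. e \<in> gedges \<Psi> \<Longrightarrow> a \<in> carrier (egroup \<Psi> e) \<Longrightarrow> inj_src \<Psi> e a = a \<and> inj_tgt \<Psi> e a = a"
    using vis by (simp_all add: visual_decomposition_def)
  obtain T h where T: "maximal_tree \<Psi> T" and h: "h \<in> iso (gog_pi1 \<Psi> T) W"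
    and h_incl: "\<And>v g. v \<in> gverts \<Psi> \<Longrightarrow> g \<in> carrier (vgroup \<Psi> v) \<Longrightarrow> h (gog_incl \<Psi> T v g) = g"
    using vis unfolding visual_decomposition_def by blast
  have TE: "T = gedges \<Psi>"
    using visual_decomposition_tree[OF gog _ h] T by (simp add: maximal_tree_def)
  obtain v0 where v0: "v0 \<in> gverts \<Psi>" using gog by (auto simp: graph_of_groups_def)
  have edge_ends: "gsrc \<Psi> e \<in> gverts \<Psi>" "gtgt \<Psi> e \<in> gverts \<Psi>" if "e \<in> T" for e
    using gog that by (auto simp: graph_of_groups_def TE)
  obtain par pe rank where tree: "\<And>u. u \<in> gverts \<Psi> \<Longrightarrow> u \<noteq> v0 \<Longrightarrow> par u \<in> gverts \<Psi> \<and>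
      rank (par u) < (rank u :: nat) \<and> pe u \<in> T \<and> {gsrc \<Psi> (pe u), gtgt \<Psi> (pe u)} = {u, par u}"
    and pe: "\<And>e. e \<in> T \<Longrightarrow> \<exists>u\<in>gverts \<Psi>. u \<noteq> v0 \<and> pe u = e"
    using rooted_tree[OF T v0] edge_ends by metis
  define H where "H v = carrier (vgroup \<Psi> v)" for v
  define Ce where "Ce e = carrier (egroup \<Psi> e)" for e
  have vgroup: "vgroup \<Psi> v = W\<lparr>carrier := H v\<rparr>" "special_subgroup W S (H v)" if "v \<in> gverts \<Psi>" for v
    using vg[OF that] by (auto simp: H_def)
  have egroup: "egroup \<Psi> e = W\<lparr>carrier := Ce e\<rparr>" "special_subgroup W S (Ce e)" if "e \<in> T" for e
    using eg[of e] that by (auto simp: Ce_def TE)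
  have special_sub: "subgroup K W" if "special_subgroup W S K" for K
    using that gens_closed generate_is_subgroup unfolding special_subgroup_def by blast
  have Ce_sub: "Ce e \<subseteq> H (gsrc \<Psi> e)" "Ce e \<subseteq> H (gtgt \<Psi> e)" if e: "e \<in> T" for e
  proof -
    have "inj_src \<Psi> e \<in> hom (egroup \<Psi> e) (vgroup \<Psi> (gsrc \<Psi> e))"
      "inj_tgt \<Psi> e \<in> hom (egroup \<Psi> e) (vgroup \<Psi> (gtgt \<Psi> e))"
      using gog e by (simp_all add: graph_of_groups_def TE)
    then show "Ce e \<subseteq> H (gsrc \<Psi> e)" "Ce e \<subseteq> H (gtgt \<Psi> e)"
      using inc[of e] e hom_in_carrier unfolding Ce_def H_def TE by (metis subsetI)+
  qed
  \<comment> \<open>The graph may have infinitely many vertices, but finite \<open>S\<close> has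
    only finitely many special subgroups. The product of the orders of the finite ones is a common
    multiple for all vertex groups.\<close>
  define \<H> where "\<H> = {K. special_subgroup W S K \<and> finite K}"
  have "\<H> \<subseteq> generate W ` Pow S" by (auto simp: \<H>_def special_subgroup_def)
  then have fin\<H>: "finite \<H>" using fin by (meson finite_Pow_iff finite_imageI finite_subset)
  define N where "N = (\<Prod>K\<in>\<H>. card K)"
  have "card K \<noteq> 0" if "K \<in> \<H>" for K
    using that subgroup.one_closed[OF special_sub] by (auto simp: \<H>_def)
  then have N: "N > 0" using fin\<H> by (simp add: N_def prod_pos)
  have cardH: "card (H v) dvd N" if "v \<in> gverts \<Psi>" for v
    unfolding N_def using that vgroup finv fin\<H> by (intro dvd_prodI) (auto simp: \<H>_def H_def)

  let ?P = "gog_pi1 \<Psi> T" and ?X = "gog_gens \<Psi>" and ?R = "gog_relators \<Psi> T"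
  let ?cl = "\<lambda>x. word_class ?X ?R [(x, True)]"
  interpret P: group ?P unfolding gog_pi1_def by (rule group_presented_group)
  have bij: "bij_betw h (carrier ?P) (carrier W)" using h by (simp add: iso_def)
  define h' where "h' = inv_into (carrier ?P) h"
  have h': "h' \<in> hom W ?P" using P.iso_set_sym[OF h] by (simp add: h'_def iso_def)
  have incl_closed: "?cl x \<in> carrier ?P" if "x \<in> ?X" for x
    using that by (auto simp: gog_pi1_def carrier_presented_group)
  have XI: "Inl (v, g) \<in> ?X" if "v \<in> gverts \<Psi>" "g \<in> H v" for v g
    using that by (auto simp: gog_gens_def H_def)
  have h'_H: "h' g = ?cl (Inl (v, g))" if "v \<in> gverts \<Psi>" "g \<in> H v" for v g
  proof -
    have "h (?cl (Inl (v, g))) = g" using h_incl[of v g] that by (simp add: gog_incl_def H_def)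
    then show ?thesis
      using bij_betw_inv_into_left[OF bij incl_closed[OF XI[OF that]]] by (simp add: h'_def)
  qed
  have gen: "generate W (\<Union>v\<in>gverts \<Psi>. H v) = carrier W"
  proof
    have sub: "(\<Union>v\<in>gverts \<Psi>. H v) \<subseteq> carrier W"
      using vgroup(2) special_sub subgroup.subset by blast
    then show "generate W (\<Union>v\<in>gverts \<Psi>. H v) \<subseteq> carrier W" by (rule generate_incl)
    interpret h: group_hom ?P W h
      using h by (simp add: group_hom_def group_hom_axioms_def iso_def is_group P.is_group)
    have gens: "?cl ` ?X \<subseteq> carrier ?P" using incl_closed by blast
    have "h ` ?cl ` ?X \<subseteq> generate W (\<Union>v\<in>gverts \<Psi>. H v)"
    proof clarify
      fix x assume x: "x \<in> ?X"
      then consider v g where "x = Inl (v, g)" "v \<in> gverts \<Psi>" "g \<in> H v" | e where "x = Inr e" "e \<in> T"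
        by (auto simp: gog_gens_def H_def TE)
      then show "h (?cl x) \<in> generate W (\<Union>v\<in>gverts \<Psi>. H v)"
      proof cases
        case 1
        then have "h (?cl x) = g" using h_incl by (simp add: gog_incl_def H_def)
        then show ?thesis using 1 by (auto intro: generate.incl)
      next
        case 2
        have "[(x, True)] \<in> ?R" using 2 by (auto simp: gog_relators_def)
        then have "word_eq ?X ?R ([] @ [(x, True)] @ []) ([] @ [])"
          by (rule word_eq.relator) (use x in simp)
        then have "?cl x = \<one>\<^bsub>?P\<^esub>"
          using x by (simp add: gog_pi1_def one_presented_group word_class_eq_iff)
        then show ?thesis by (simp add: generate.one)
      qed
    qed
    then have "generate W (h ` ?cl ` ?X) \<subseteq> generate W (\<Union>v\<in>gverts \<Psi>. H v)"
      by (rule generate_subgroup_incl[OF _ generate_is_subgroup[OF sub]])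
    moreover have "generate W (h ` ?cl ` ?X) = h ` carrier ?P"
      using h.generate_img[OF gens] generate_presented_group[of ?X ?R] by (simp add: gog_pi1_def)
    ultimately show "carrier W \<subseteq> generate W (\<Union>v\<in>gverts \<Psi>. H v)"
      using bij by (simp add: bij_betw_def)
  qed
  show ?thesis
  proof (rule tree_of_finite_groups_virtually_free[where V = "gverts \<Psi>" and root = v0 and H = H and N = N
        and C = "\<lambda>u. Ce (pe u)" and par = par and rank = rank, OF is_group v0 N _ _ cardH _ _ _ _ _ gen])
    fix v assume v: "v \<in> gverts \<Psi>"
    show "subgroup (H v) W" by (rule special_sub[OF vgroup(2)[OF v]])
    show "finite (H v)" using finv[OF v] by (simp add: H_def)
    assume "v \<noteq> v0"
    note t = tree[OF v this]
    show "par v \<in> gverts \<Psi>" "rank (par v) < rank v" using t by auto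
    show "subgroup (Ce (pe v)) W" using special_sub egroup(2) t by blast
    show "Ce (pe v) \<subseteq> H v" "Ce (pe v) \<subseteq> H (par v)"
      using Ce_sub[of "pe v"] t by (auto simp: doubleton_eq_iff)
  next
    fix A :: "(nat \<times> 'a word set) set" and f
    assume f: "\<And>v. v \<in> gverts \<Psi> \<Longrightarrow> f v \<in> hom (W\<lparr>carrier := H v\<rparr>) (perm_group A)"
      and f_par: "\<And>v c. v \<in> gverts \<Psi> \<Longrightarrow> v \<noteq> v0 \<Longrightarrow> c \<in> Ce (pe v) \<Longrightarrow> f v c = f (par v) c"
    define \<phi> :: "'v \<times> 'a + 'e \<Rightarrow> nat \<times> 'a word set \<Rightarrow> nat \<times> 'a word set"
      where "\<phi> = case_sum (\<lambda>(v, g). f v g) (\<lambda>_. \<one>\<^bsub>perm_group A\<^esub>)"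
    interpret A: group "perm_group A" by (rule group_perm_group)
    have f_closed: "f v g \<in> carrier (perm_group A)" if "v \<in> gverts \<Psi>" "g \<in> H v" for v g
      using hom_in_carrier[OF f[OF that(1)]] that(2) by simp
    have \<phi>: "\<phi> \<in> ?X \<rightarrow> carrier (perm_group A)"
      using f_closed A.one_closed unfolding \<phi>_def gog_gens_def H_def by auto
    \<comment> \<open>Each edge joins some vertex to its parent, in one of the two orientations, so
      compatibility with parents covers all edge relators.\<close>
    have f_edge: "f (gsrc \<Psi> e) a = f (gtgt \<Psi> e) a" if e: "e \<in> T" and a: "a \<in> Ce e" for e a
    proof -
      obtain u where u: "u \<in> gverts \<Psi>" "u \<noteq> v0" "pe u = e" using pe[OF e] by blast
      have "f u a = f (par u) a" using f_par[OF u(1,2)] a u(3) by simp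
      moreover have "{gsrc \<Psi> e, gtgt \<Psi> e} = {u, par u}" using tree[OF u(1,2)] u(3) by simp
      ultimately show ?thesis by (auto simp: doubleton_eq_iff)
    qed
    have rel: "ev (perm_group A) \<phi> r = \<one>\<^bsub>perm_group A\<^esub>" if r: "r \<in> ?R" for r
    proof -
      consider v x y where "v \<in> gverts \<Psi>" "x \<in> H v" "y \<in> H v"
          "r = [(Inl (v, x), True), (Inl (v, y), True), (Inl (v, x \<otimes> y), False)]"
        | e a where "e \<in> T" "a \<in> Ce e"
          "r = [(Inr e, True), (Inl (gtgt \<Psi> e, a), True), (Inr e, False), (Inl (gsrc \<Psi> e, a), False)]"
        | e where "r = [(Inr e, True)]"
      proof -
        have mult: "x \<otimes>\<^bsub>vgroup \<Psi> v\<^esub> y = x \<otimes> y" if "v \<in> gverts \<Psi>" for v x y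
          by (simp add: vgroup(1)[OF that])
        have inc': "inj_src \<Psi> e a = a" "inj_tgt \<Psi> e a = a" if "e \<in> T" "a \<in> Ce e" for e a
          using inc that by (simp_all add: TE Ce_def)
        show ?thesis
          using r that mult inc' unfolding gog_relators_def H_def[symmetric] Ce_def[symmetric] TE[symmetric]
          by (elim UnE CollectE exE conjE) metis+
      qed
      then show ?thesis
      proof cases
        case 1
        have "f v (x \<otimes> y) = f v x \<otimes>\<^bsub>perm_group A\<^esub> f v y"
          using hom_mult[OF f[OF 1(1)]] 1(2,3) by simp
        then show ?thesis
          using f_closed[OF 1(1,2)] f_closed[OF 1(1,3)] A.r_inv[of "f v x \<otimes>\<^bsub>perm_group A\<^esub> f v y"]
          unfolding 1(4) by (simp add: letter_def \<phi>_def A.m_assoc[symmetric] del: perm_group_simps)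
      next
        case 2
        have "f (gtgt \<Psi> e) a \<in> carrier (perm_group A)"
          using f_closed[OF edge_ends(2)[OF 2(1)]] Ce_sub(2)[OF 2(1)] 2(2) by blast
        then show ?thesis
          unfolding 2(3) using f_edge[OF 2(1,2)] by (simp add: letter_def \<phi>_def del: perm_group_simps)
      next
        case 3
        then show ?thesis by (simp add: letter_def \<phi>_def del: perm_group_simps)
      qed
    qed
    obtain \<rho> where \<rho>: "\<rho> \<in> hom ?P (perm_group A)"
      "\<And>w. w \<in> words_over ?X \<Longrightarrow> \<rho> (word_class ?X ?R w) = ev (perm_group A) \<phi> w"
      using presented_group_hom[OF A.is_group \<phi> rel] unfolding gog_pi1_def by blast
    have "(\<rho> \<circ> h') g = f v g" if "v \<in> gverts \<Psi>" "g \<in> H v" for v g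
      using \<rho>(2)[of "[(Inl (v, g), True)]"] XI[OF that] h'_H[OF that] f_closed[OF that]
      by (simp add: letter_def \<phi>_def del: perm_group_simps)
    moreover have "\<rho> \<circ> h' \<in> hom W (perm_group A)" by (rule Group.hom_compose[OF h' \<rho>(1)])
    ultimately show "\<exists>\<rho>\<in>hom W (perm_group A). \<forall>v\<in>gverts \<Psi>. \<forall>g\<in>H v. \<rho> g = f v g" by blast
  qed
qed

end

theorem theorem34:
  fixes W :: "'a monoid" and S :: "'a set" and m :: "'a \<Rightarrow> 'a \<Rightarrow> enat"
  assumes "coxeter_system W S m" and "finite S"
  shows
    "(virtually_free W \<longleftrightarrow>
        (\<exists>\<Psi> :: ('v::infinite, 'e::infinite, 'a) gog.
           visual_decomposition W S \<Psi> \<and> (\<forall>v\<in>gverts \<Psi>. finite (carrier (vgroup \<Psi> v)))))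
     \<and>
     (virtually_free W \<longleftrightarrow>
        (\<forall>K\<subseteq>S. complete_lgraph (induced_lgraph (presentation_diagram S m) K) \<longrightarrow>
                finite (generate W K)) \<and>
        \<not> (\<exists>A\<subseteq>S. card A > 3 \<and> circuit_lgraph (induced_lgraph (presentation_diagram S m) A)))"
  (is "(?vf \<longleftrightarrow> ?dec) \<and> (?vf \<longleftrightarrow> ?complete \<and> ?chordal)")
proof -
  interpret coxeter_system W S m by fact
  have "?vf \<Longrightarrow> ?complete \<and> ?chordal"
    using virtually_free_imp_diagram \<open>finite S\<close> by blast
  moreover have "?complete \<and> ?chordal \<Longrightarrow> ?dec"
    using diagram_imp_visual_decomposition[OF \<open>finite S\<close>, where 'v = 'v and 'e = 'e] by blast
  moreover have "?dec \<Longrightarrow> ?vf"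
    using visual_decomposition_imp_virtually_free[OF \<open>finite S\<close>] by blast
  ultimately show ?thesis by blast
qed

end
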